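(* Let $\mathcal L:=\overline{\operatorname{conv}(\mathcal Z)}\subset\mathcal H$, where $\mathcal Z\subset\mathcal H$ is the set of gradients defined in the context, and let $\partial^\circ G(0)$ denote the Clarke subgradient of $G$ at $0\in\mathcal H$ (regarded as a subset of $\mathcal H$ through the Riesz isomorphism $\mathcal H^*\cong\mathcal H$). Then $$\mathcal L=\partial^\circ G(0).$$
   Context: Setting. $\mathsf D\subset\mathbb R^d$ is a bounded Lipschitz domain, $\Gamma\subset\mathsf D$ a smooth Lipschitz manifold, $\Omega\subset\mathsf D$ a fixed Lipschitz set with $\Gamma\subset\partial\Omega$, $\Gamma^N:=\partial\Omega\setminus\Gamma$, $\omega\subset\mathsf D$ is open with $\Gamma\subset\omega$, and $K:=\overline{\Omega\setminus\omega}$. $n$ is the normal vector on $\Gamma^N$; $f\in H^1(\mathsf D)^d$, $g\in H^2(\mathsf D)^d$, $\delta>0$, $V>0$, $\alpha>0$, Lamé coefficients $\lambda,\mu>0$. $\partial v$ is the Jacobian, $\varepsilon(v):=\frac12(\partial v+\partial v^\top)$, $A(M):=2\mu M+\lambda\operatorname{tr}(M)I_d$, $B(M):=6\mu M+(\lambda-2\mu)\operatorname{tr}(M)I_d$, $M:N$ is the Frobenius product, $\sigma_M^2(v):=B\varepsilon(v):\varepsilon(v)$. $H^1_\Gamma(\Omega)^d:=\{v\in H^1(\Omega)^d\mid v|_\Gamma=0\}$. State. For a Lipschitz set $\Omega'\subset\mathsf D$ with $\Gamma\subset\partial\Omega'$, $u_{\Omega'}\in H^1_\Gamma(\Omega')^d$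 is the unique solution (unique solvability is understood) of $\int_{\Omega'}A\varepsilon(u_{\Omega'}):\varepsilon(\varphi)\,dx=\int_{\Omega'}f\cdot\varphi\,dx+\int_{\partial\Omega'\setminus\Gamma}g\cdot\varphi\,dS$ for all $\varphi\in H^1_\Gamma(\Omega')^d$. Functionals. $J_{\mathrm{vol}}(\Omega'):=(|\Omega'|-V)^2$, $J_\sigma(\Omega'):=\max\{\max_{x\in\overline{\Omega'\setminus\omega}}\sigma_M^2(u_{\Omega'})(x)-\delta,0\}$, $J:=J_{\mathrm{vol}}+\alpha J_\sigma$. Perturbations. For $X,Y\in C^1(\overline{\mathsf D})^d$ with supports in $\mathsf D\setminus\overline\omega$, $\|Y\|_{C^1(\overline{\mathsf D})^d}$ and $t\ge0$ sufficiently small, $F_{Y,t}:=\mathrm{Id}+Y+tX$, $u^{Y,t}:=u_{F_{Y,t}(\Omega)}\circ F_{Y,t}$, $u^Y:=u^{Y,0}$, $u:=u_\Omega$, $F_t:=\mathrm{Id}+tX$, $\Omega_t:=F_t(\Omega)$. For $x\in K$, $J_\sigma^x(\Omega_t):=\sigma_M^2(u_{\Omega_t})(F_t(x))-\delta$. For a functional $\tilde J$, $D\tilde J(\Omega)(X):=\lim_{t\searrow0}(\tilde J(\Omega_t)-\tilde J(\Omega))/t$. Material derivative. For given $X$, $\dot u\in H^1_\Gamma(\Omega)^d$ is the unique solution of, for all $\varphi\in H^1_\Gamma(\Omega)^d$, $$\begin{aligned}\int_\Omega A\varepsilon(\dot u):\varepsilon(\varphi)\,dx=&\tfrac12\int_\Omega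 A[\partial u\,\partial X+\partial X^\top\partial u^\top]:\varepsilon(\varphi)\,dx-\int_\Omega\operatorname{div}X\,A\varepsilon(u):\varepsilon(\varphi)\,dx\\&+\tfrac12\int_\Omega A\varepsilon(u):[\partial\varphi\,\partial X+\partial X^\top\partial\varphi^\top]\,dx+\int_\Omega\operatorname{div}X\,f\cdot\varphi\,dx+\int_\Omega\partial f\,X\cdot\varphi\,dx\\&+\int_{\Gamma^N}(\operatorname{div}X-(\partial X\,n)\cdot n)\,g\cdot\varphi\,dS+\int_{\Gamma^N}\partial g\,X\cdot\varphi\,dS.\end{aligned}$$ Standing regularity assumption. For every such $X$: $u^{Y,t}\in C^1(K)^d$ for $\|Y\|_{C^1(\overline{\mathsf D})^d}$, $t\ge 0$ small, $\lim_{Y\to0,\,t\searrow0}\|u^{Y,t}-u\|_{C^1(K)^d}=0$ and $\lim_{Y\to0,\,t\searrow0}\|\frac{u^{Y,t}-u^Y}{t}-\dot u\|_{C^1(K)^d}=0$ (with $Y\to0$ in $C^1(\overline{\mathsf D})^d$). Pointwise values of gradients are those of these $C^1$ representatives. Hilbert space. $\mathcal H$ is a Hilbert space with $\mathcal H\subset\{X\in C^1(\overline{\mathsf D})^d\mid\operatorname{supp}(X)\subset\mathsf D\setminus\overline\omega\}$ on which point evaluation of the gradient and $X\mapsto DJ_{\mathrm{vol}}(\Omega)(X)$ are continuous. Let $A(u):=\{z\in K\mid\sigma_M^2(u)(z)=\max_{x\in K}\sigma_M^2(u)(x)\}$. For $x\in A(u)$ the maps $X\mapsto DJ_{\mathrm{vol}}(\Omega)(X)$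 and $X\mapsto DJ_\sigma^x(\Omega)(X)$ are linear and continuous on $\mathcal H$; $\nabla J_{\mathrm{vol}},\nabla J_\sigma^x\in\mathcal H$ are their Riesz representatives. Define $$\mathcal Z:=\begin{cases}\{\nabla J_{\mathrm{vol}}+\alpha\nabla J_\sigma^x\mid x\in A(u)\}, & \text{if }\sigma_M^2(u)|_{A(u)}>\delta,\\ \{\nabla J_{\mathrm{vol}}+\alpha\nabla J_\sigma^x\mid x\in A(u)\}\cup\{\nabla J_{\mathrm{vol}}\}, & \text{if }\sigma_M^2(u)|_{A(u)}=\delta,\\ \{\nabla J_{\mathrm{vol}}\}, & \text{if }\sigma_M^2(u)|_{A(u)}<\delta.\end{cases}$$ The function $G$. For sufficiently small $\rho>0$, $G:B_\rho(0)\subset\mathcal H\to\mathbb R$, $G(X):=J((\mathrm{Id}+X)(\Omega))$. Clarke subgradient. For a function $h$ defined near $x_0$ in a Banach space $\mathcal X$, $h^\circ(x_0;v):=\limsup_{y\to x_0,\,t\searrow0}\frac{h(y+tv)-h(y)}{t}$ and $\partial^\circ h(x_0):=\{x^*\in\mathcal X^*\mid h^\circ(x_0;v)\ge x^*(v)\text{ for all }v\in\mathcal X\}$. *)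

theory Defs
  imports "HOL-Analysis.Analysis"
begin

section \<open>Smooth functions, Lipschitz sets, surface measure\<close>

definition pd :: "'n::finite \<Rightarrow> (real^'n \<Rightarrow> 'b::real_normed_vector) \<Rightarrow> real^'n \<Rightarrow> 'b" where
  "pd i f x = frechet_derivative f (at x) (axis i 1)"

text \<open>Intended for open \<open>S\<close>.\<close>

primrec Ck_on :: "nat \<Rightarrow> (real^'n::finite) set \<Rightarrow> (real^'n \<Rightarrow> 'b::real_normed_vector) \<Rightarrow> bool" where
  "Ck_on 0 S f \<longleftrightarrow> continuous_on S f"
| "Ck_on (Suc k) S f \<longleftrightarrow> f differentiable_on S \<and> (\<forall>i. Ck_on k S (pd i f))"

definition smooth_on :: "(real^'n::finite) set \<Rightarrow> (real^'n \<Rightarrow> 'b::real_normed_vector) \<Rightarrow> bool" where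
  "smooth_on S f \<longleftrightarrow> (\<forall>k. Ck_on k S f)"

definition test_function :: "(real^'n::finite) set \<Rightarrow> (real^'n \<Rightarrow> real) \<Rightarrow> bool" where
  "test_function S \<phi> \<longleftrightarrow> smooth_on UNIV \<phi> \<and> compact (closure {x. \<phi> x \<noteq> 0}) \<and> closure {x. \<phi> x \<noteq> 0} \<subseteq> S"

text \<open>
  The local subgraph condition is written without a change of coordinates: \<open>e\<close> is the
  vertical direction and \<open>z - (z \<bullet> e) *\<^sub>R e\<close> the horizontal part of \<open>z\<close>.
\<close>

definition lipschitz_set :: "(real^'n::finite) set \<Rightarrow> bool" where
  "lipschitz_set S \<longleftrightarrow> open S \<and> bounded S \<and>
     (\<forall>x\<in>frontier S. \<exists>e \<gamma> L r. norm e = 1 \<and> L-lipschitz_on UNIV \<gamma> \<and> 0 < r \<and>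
        (\<forall>z\<in>ball x r. z \<in> S \<longleftrightarrow> z \<bullet> e < (\<gamma> (z - (z \<bullet> e) *\<^sub>R e) :: real)))"

text \<open>
  A smooth embedded hypersurface whose relative boundary (if any) is Lipschitz: in a smooth
  chart it is an open piece of the hyperplane orthogonal to \<open>a\<close> or, near a relative boundary
  point, a Lipschitz subgraph inside that hyperplane. The relative boundary itself may or may
  not belong to the set.
\<close>

definition smooth_lipschitz_hypersurface :: "(real^'n::finite) set \<Rightarrow> bool" where
  "smooth_lipschitz_hypersurface \<Gamma> \<longleftrightarrow>
     (\<forall>x\<in>closure \<Gamma>. \<exists>U W (\<Phi> :: real^'n \<Rightarrow> real^'n) \<Psi> a P.
        open U \<and> x \<in> U \<and> open W \<and> homeomorphism U W \<Phi> \<Psi> \<and> smooth_on U \<Phi> \<and> smooth_on W \<Psi> \<and>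
        norm a = 1 \<and> \<Phi> ` (\<Gamma> \<inter> U) = W \<inter> {z. z \<bullet> a = 0} \<inter> P \<and>
        (P = UNIV \<or>
         (\<exists>e (\<gamma> :: real^'n \<Rightarrow> real) L. norm e = 1 \<and> e \<bullet> a = 0 \<and> L-lipschitz_on UNIV \<gamma> \<and>
            (P = {z. z \<bullet> e < \<gamma> (z - (z \<bullet> e) *\<^sub>R e)} \<or> P = {z. z \<bullet> e \<le> \<gamma> (z - (z \<bullet> e) *\<^sub>R e)}))))"

text \<open>
  Surface measure is the \<open>(d-1)\<close>-dimensional Hausdorff measure. The usual
  normalisation makes it agree with the classical surface area; \<open>diam\<^sup>0 = 1\<close> for nonempty sets
  makes it the counting measure for \<open>d = 1\<close>. The outer measure is countably additive on Borel
  sets by the Caratheodory criterion, so \<open>measure_of\<close> returns its restriction to them.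
\<close>

definition hausdorff_premeasure :: "nat \<Rightarrow> real \<Rightarrow> 'a::metric_space set \<Rightarrow> ennreal" where
  "hausdorff_premeasure s \<eta> A =
     (INF U \<in> {U :: nat \<Rightarrow> 'a set. A \<subseteq> (\<Union>i. U i) \<and> (\<forall>i. bounded (U i) \<and> diameter (U i) \<le> \<eta>)}.
        \<Sum>i. if U i = {} then 0 else ennreal (unit_ball_vol (real s) * (diameter (U i) / 2) ^ s))"

definition hausdorff_outer :: "nat \<Rightarrow> 'a::metric_space set \<Rightarrow> ennreal" where
  "hausdorff_outer s A = (SUP \<eta>\<in>{0<..}. hausdorff_premeasure s \<eta> A)"

definition surface_measure :: "(real^'n::finite) measure" where
  "surface_measure = measure_of UNIV (sets borel) (hausdorff_outer (CARD('n) - 1))"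

definition surface_on :: "(real^'n::finite) set \<Rightarrow> (real^'n) measure" where
  "surface_on S = restrict_space surface_measure S"

text \<open>
  The tangential half-space description determines the outward unit normal wherever it exists,
  which for a Lipschitz set is at almost every boundary point.
\<close>

definition is_outer_normal :: "(real^'n::finite) set \<Rightarrow> real^'n \<Rightarrow> real^'n \<Rightarrow> bool" where
  "is_outer_normal S x \<nu> \<longleftrightarrow> norm \<nu> = 1 \<and>
     (\<forall>\<epsilon>>0. \<exists>r>0. \<forall>y\<in>ball x r.
        (y \<in> S \<longrightarrow> \<nu> \<bullet> (y - x) \<le> \<epsilon> * norm (y - x)) \<and>
        (y \<notin> S \<longrightarrow> \<nu> \<bullet> (y - x) \<ge> - \<epsilon> * norm (y - x)))"

definition outer_normal :: "(real^'n::finite) set \<Rightarrow> real^'n \<Rightarrow> real^'n" where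
  "outer_normal S x = (SOME \<nu>. is_outer_normal S x \<nu>)"


section \<open>Sobolev spaces and traces\<close>

text \<open>
  Elements of the spaces are represented by functions on the whole of \<open>\<real>\<^sup>d\<close>; only the values on
  the given set, up to null sets, matter. Weak derivatives and traces are unique up to null sets,
  so they are selected by \<open>SOME\<close>.
\<close>

definition L2 :: "(real^'n::finite) set \<Rightarrow> (real^'n \<Rightarrow> 'b::euclidean_space) \<Rightarrow> bool" where
  "L2 S v \<longleftrightarrow> v \<in> borel_measurable (lebesgue_on S) \<and> integrable (lebesgue_on S) (\<lambda>x. (norm (v x))\<^sup>2)"

definition has_weak_pd ::
  "(real^'n::finite) set \<Rightarrow> 'n \<Rightarrow> (real^'n \<Rightarrow> 'b::euclidean_space) \<Rightarrow> (real^'n \<Rightarrow> 'b) \<Rightarrow> bool" where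
  "has_weak_pd S i v w \<longleftrightarrow> L2 S v \<and> L2 S w \<and>
     (\<forall>\<phi>. test_function S \<phi> \<longrightarrow>
        (LINT x|lebesgue_on S. pd i \<phi> x *\<^sub>R v x) = - (LINT x|lebesgue_on S. \<phi> x *\<^sub>R w x))"

definition weak_pd ::
  "(real^'n::finite) set \<Rightarrow> 'n \<Rightarrow> (real^'n \<Rightarrow> 'b::euclidean_space) \<Rightarrow> real^'n \<Rightarrow> 'b" where
  "weak_pd S i v = (SOME w. has_weak_pd S i v w)"

definition H1 :: "(real^'n::finite) set \<Rightarrow> (real^'n \<Rightarrow> 'b::euclidean_space) \<Rightarrow> bool" where
  "H1 S v \<longleftrightarrow> L2 S v \<and> (\<forall>i. \<exists>w. has_weak_pd S i v w)"

definition H2 :: "(real^'n::finite) set \<Rightarrow> (real^'n \<Rightarrow> 'b::euclidean_space) \<Rightarrow> bool" where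
  "H2 S v \<longleftrightarrow> H1 S v \<and> (\<forall>i. H1 S (weak_pd S i v))"

definition weak_jacobian ::
  "(real^'n::finite) set \<Rightarrow> (real^'n \<Rightarrow> real^'m::finite) \<Rightarrow> real^'n \<Rightarrow> real^'n^'m" where
  "weak_jacobian S v x = (\<chi> k i. weak_pd S i v x $ k)"

text \<open>The trace operator: the extension by density of restriction to the boundary.\<close>

definition is_trace ::
  "(real^'n::finite) set \<Rightarrow> (real^'n \<Rightarrow> 'b::euclidean_space) \<Rightarrow> (real^'n \<Rightarrow> 'b) \<Rightarrow> bool" where
  "is_trace S v w \<longleftrightarrow>
     w \<in> borel_measurable (surface_on (frontier S)) \<and>
     integrable (surface_on (frontier S)) (\<lambda>x. (norm (w x))\<^sup>2) \<and>
     (\<exists>\<phi> :: nat \<Rightarrow> real^'n \<Rightarrow> 'b.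
        (\<forall>k. smooth_on UNIV (\<phi> k)) \<and>
        (\<lambda>k. \<integral>\<^sup>+x. ennreal ((norm (\<phi> k x - v x))\<^sup>2) \<partial>lebesgue_on S) \<longlonglongrightarrow> 0 \<and>
        (\<forall>i. (\<lambda>k. \<integral>\<^sup>+x. ennreal ((norm (pd i (\<phi> k) x - weak_pd S i v x))\<^sup>2) \<partial>lebesgue_on S) \<longlonglongrightarrow> 0) \<and>
        (\<lambda>k. \<integral>\<^sup>+x. ennreal ((norm (\<phi> k x - w x))\<^sup>2) \<partial>surface_on (frontier S)) \<longlonglongrightarrow> 0)"

definition boundary_trace ::
  "(real^'n::finite) set \<Rightarrow> (real^'n \<Rightarrow> 'b::euclidean_space) \<Rightarrow> real^'n \<Rightarrow> 'b" where
  "boundary_trace S v = (SOME w. is_trace S v w)"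

definition H1_zero_on ::
  "(real^'n::finite) set \<Rightarrow> (real^'n) set \<Rightarrow> (real^'n \<Rightarrow> 'b::euclidean_space) \<Rightarrow> bool" where
  "H1_zero_on \<Gamma> S v \<longleftrightarrow> H1 S v \<and> (AE x in surface_measure. x \<in> \<Gamma> \<longrightarrow> boundary_trace S v x = 0)"

definition unique_ae_on :: "(real^'n::finite) set \<Rightarrow> ((real^'n \<Rightarrow> 'b) \<Rightarrow> bool) \<Rightarrow> bool" where
  "unique_ae_on S P \<longleftrightarrow> (\<exists>v. P v) \<and> (\<forall>v w. P v \<longrightarrow> P w \<longrightarrow> (AE x in lebesgue_on S. v x = w x))"


section \<open>Functions of class \<open>C\<^sup>1\<close> on a compact set\<close>

text \<open>
  \<open>C\<^sup>1(K)\<close> for \<open>K = closure (\<Omega> - \<omega>)\<close> consists of the functions that are \<open>C\<^sup>1\<close> in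
  the interior of \<open>K\<close> (which is \<open>\<Omega> - closure \<omega>\<close>) and extend continuously, together with
  their gradients, to the closure; the value and gradient at points of \<open>K\<close> are those of this
  extension. Points of \<open>K\<close> outside \<open>closure (interior K)\<close>, where a function on \<open>K\<close> does not
  determine a gradient, are assigned the value 0; there are none if \<open>K\<close> is the closure of an
  open set.
  The argument \<open>v\<close> is only given almost everywhere; \<open>w\<close> is its \<open>C\<^sup>1\<close> representative
  and \<open>M\<close> the gradient of \<open>w\<close>.
\<close>

definition C1_rep ::
  "(real^'n::finite) set \<Rightarrow> (real^'n \<Rightarrow> real^'n) \<Rightarrow> (real^'n \<Rightarrow> real^'n) \<Rightarrow> (real^'n \<Rightarrow> real^'n^'n) \<Rightarrow> bool"
where
  "C1_rep K v w M \<longleftrightarrow>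
     continuous_on (closure (interior K)) w \<and> continuous_on (closure (interior K)) M \<and>
     (\<forall>x\<in>interior K. (w has_derivative (\<lambda>h. M x *v h)) (at x)) \<and>
     (AE x in lebesgue_on (interior K). v x = w x)"

definition in_C1 :: "(real^'n::finite) set \<Rightarrow> (real^'n \<Rightarrow> real^'n) \<Rightarrow> bool" where
  "in_C1 K v \<longleftrightarrow> (\<exists>w M. C1_rep K v w M)"

definition C1_val :: "(real^'n::finite) set \<Rightarrow> (real^'n \<Rightarrow> real^'n) \<Rightarrow> real^'n \<Rightarrow> real^'n" where
  "C1_val K v x = (if x \<in> closure (interior K) then (SOME w. \<exists>M. C1_rep K v w M) x else 0)"

definition C1_grad :: "(real^'n::finite) set \<Rightarrow> (real^'n \<Rightarrow> real^'n) \<Rightarrow> real^'n \<Rightarrow> real^'n^'n" where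
  "C1_grad K v x = (if x \<in> closure (interior K) then (SOME M. \<exists>w. C1_rep K v w M) x else 0)"

definition C1_norm :: "(real^'n::finite) set \<Rightarrow> (real^'n \<Rightarrow> real^'n) \<Rightarrow> real" where
  "C1_norm K v = (SUP x\<in>K. norm (C1_val K v x)) + (SUP x\<in>K. norm (C1_grad K v x))"


section \<open>Perturbation fields\<close>

text \<open>
  A \<open>C\<^sup>1\<close> field on \<open>closure D\<close> with support in \<open>D - closure \<omega>\<close> is identified with its extension
  by zero, which is \<open>C\<^sup>1\<close> on the whole space.
\<close>

definition admissible_fields ::
  "(real^'n::finite) set \<Rightarrow> (real^'n) set \<Rightarrow> (real^'n \<Rightarrow> real^'n) set" where
  "admissible_fields D \<omega> = {X. Ck_on 1 UNIV X \<and> closure {x. X x \<noteq> 0} \<subseteq> D - closure \<omega>}"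

definition field_jac :: "(real^'n::finite \<Rightarrow> real^'n) \<Rightarrow> real^'n \<Rightarrow> real^'n^'n" where
  "field_jac X x = jacobian X (at x)"

definition field_div :: "(real^'n::finite \<Rightarrow> real^'n) \<Rightarrow> real^'n \<Rightarrow> real" where
  "field_div X x = trace (field_jac X x)"

definition field_norm :: "(real^'n::finite) set \<Rightarrow> (real^'n \<Rightarrow> real^'n) \<Rightarrow> real" where
  "field_norm D X = (SUP x\<in>closure D. norm (X x)) + (SUP x\<in>closure D. norm (field_jac X x))"

definition deform :: "(real^'n::finite \<Rightarrow> real^'n) \<Rightarrow> real^'n \<Rightarrow> real^'n" where
  "deform X x = x + X x"

abbreviation scale_field :: "real \<Rightarrow> (real^'n::finite \<Rightarrow> real^'n) \<Rightarrow> real^'n \<Rightarrow> real^'n" where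
  "scale_field t X \<equiv> (\<lambda>x. t *\<^sub>R X x)"


section \<open>Elasticity\<close>

text \<open>
  The inner product on \<open>real^'n^'n\<close> is the Frobenius product. Throughout, \<open>lam\<close> and \<open>mu\<close> are the
  Lame coefficients.
\<close>

definition symm :: "real^'n^'n::finite \<Rightarrow> real^'n^'n" where
  "symm M = (1/2) *\<^sub>R (M + transpose M)"

definition A_op :: "real \<Rightarrow> real \<Rightarrow> real^'n^'n::finite \<Rightarrow> real^'n^'n" where
  "A_op lam mu M = (2 * mu) *\<^sub>R M + (lam * trace M) *\<^sub>R mat 1"

definition B_op :: "real \<Rightarrow> real \<Rightarrow> real^'n^'n::finite \<Rightarrow> real^'n^'n" where
  "B_op lam mu M = (6 * mu) *\<^sub>R M + ((lam - 2 * mu) * trace M) *\<^sub>R mat 1"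

definition weak_strain :: "(real^'n::finite) set \<Rightarrow> (real^'n \<Rightarrow> real^'n) \<Rightarrow> real^'n \<Rightarrow> real^'n^'n" where
  "weak_strain S v x = symm (weak_jacobian S v x)"

definition is_state ::
  "real \<Rightarrow> real \<Rightarrow> (real^'n::finite \<Rightarrow> real^'n) \<Rightarrow> (real^'n \<Rightarrow> real^'n) \<Rightarrow> (real^'n) set \<Rightarrow>
   (real^'n) set \<Rightarrow> (real^'n \<Rightarrow> real^'n) \<Rightarrow> bool"
where
  "is_state lam mu f g \<Gamma> S u \<longleftrightarrow> H1_zero_on \<Gamma> S u \<and>
     (\<forall>\<phi>. H1_zero_on \<Gamma> S \<phi> \<longrightarrow>
        (LINT x|lebesgue_on S. A_op lam mu (weak_strain S u x) \<bullet> weak_strain S \<phi> x) =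
        (LINT x|lebesgue_on S. f x \<bullet> \<phi> x) +
        (LINT x|surface_on (frontier S - \<Gamma>). boundary_trace S g x \<bullet> boundary_trace S \<phi> x))"

definition state ::
  "real \<Rightarrow> real \<Rightarrow> (real^'n::finite \<Rightarrow> real^'n) \<Rightarrow> (real^'n \<Rightarrow> real^'n) \<Rightarrow> (real^'n) set \<Rightarrow>
   (real^'n) set \<Rightarrow> real^'n \<Rightarrow> real^'n"
where
  "state lam mu f g \<Gamma> S = (SOME u. is_state lam mu f g \<Gamma> S u)"

definition is_material_derivative ::
  "real \<Rightarrow> real \<Rightarrow> (real^'n::finite \<Rightarrow> real^'n) \<Rightarrow> (real^'n \<Rightarrow> real^'n) \<Rightarrow> (real^'n) set \<Rightarrow>
   (real^'n) set \<Rightarrow> (real^'n) set \<Rightarrow> (real^'n \<Rightarrow> real^'n) \<Rightarrow> (real^'n \<Rightarrow> real^'n) \<Rightarrow> bool"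
where
  "is_material_derivative lam mu f g \<Gamma> D \<Omega> X ud \<longleftrightarrow>
     (let u = state lam mu f g \<Gamma> \<Omega>;
          Du = weak_jacobian \<Omega> u;
          DX = field_jac X;
          n = outer_normal \<Omega>
      in H1_zero_on \<Gamma> \<Omega> ud \<and>
        (\<forall>\<phi>. H1_zero_on \<Gamma> \<Omega> \<phi> \<longrightarrow>
          (LINT x|lebesgue_on \<Omega>. A_op lam mu (weak_strain \<Omega> ud x) \<bullet> weak_strain \<Omega> \<phi> x) =
            1/2 * (LINT x|lebesgue_on \<Omega>.
               A_op lam mu (Du x ** DX x + transpose (DX x) ** transpose (Du x)) \<bullet> weak_strain \<Omega> \<phi> x)
            - (LINT x|lebesgue_on \<Omega>.
               field_div X x * (A_op lam mu (weak_strain \<Omega> u x) \<bullet> weak_strain \<Omega> \<phi> x))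
            + 1/2 * (LINT x|lebesgue_on \<Omega>.
               A_op lam mu (weak_strain \<Omega> u x) \<bullet>
                 (weak_jacobian \<Omega> \<phi> x ** DX x + transpose (DX x) ** transpose (weak_jacobian \<Omega> \<phi> x)))
            + (LINT x|lebesgue_on \<Omega>. field_div X x * (f x \<bullet> \<phi> x))
            + (LINT x|lebesgue_on \<Omega>. (weak_jacobian D f x *v X x) \<bullet> \<phi> x)
            + (LINT x|surface_on (frontier \<Omega> - \<Gamma>).
               (field_div X x - (DX x *v n x) \<bullet> n x) *
               (boundary_trace \<Omega> g x \<bullet> boundary_trace \<Omega> \<phi> x))
            + (LINT x|surface_on (frontier \<Omega> - \<Gamma>).
               (boundary_trace \<Omega> (weak_jacobian D g) x *v X x) \<bullet> boundary_trace \<Omega> \<phi> x)))"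

definition material_derivative ::
  "real \<Rightarrow> real \<Rightarrow> (real^'n::finite \<Rightarrow> real^'n) \<Rightarrow> (real^'n \<Rightarrow> real^'n) \<Rightarrow> (real^'n) set \<Rightarrow>
   (real^'n) set \<Rightarrow> (real^'n) set \<Rightarrow> (real^'n \<Rightarrow> real^'n) \<Rightarrow> real^'n \<Rightarrow> real^'n"
where
  "material_derivative lam mu f g \<Gamma> D \<Omega> X = (SOME ud. is_material_derivative lam mu f g \<Gamma> D \<Omega> X ud)"

text \<open>The function \<open>u\<^sup>Y\<^sup>,\<^sup>t\<close>, that is, the state on \<open>F(\<Omega>)\<close> composed with \<open>F = id + Y + t X\<close>.\<close>

definition pulled_state ::
  "real \<Rightarrow> real \<Rightarrow> (real^'n::finite \<Rightarrow> real^'n) \<Rightarrow> (real^'n \<Rightarrow> real^'n) \<Rightarrow> (real^'n) set \<Rightarrow>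
   (real^'n) set \<Rightarrow> (real^'n \<Rightarrow> real^'n) \<Rightarrow> (real^'n \<Rightarrow> real^'n) \<Rightarrow> real \<Rightarrow> real^'n \<Rightarrow> real^'n"
where
  "pulled_state lam mu f g \<Gamma> \<Omega> X Y t =
     (let F = deform (\<lambda>x. Y x + t *\<^sub>R X x) in state lam mu f g \<Gamma> (F ` \<Omega>) \<circ> F)"

definition standing_regularity ::
  "real \<Rightarrow> real \<Rightarrow> (real^'n::finite \<Rightarrow> real^'n) \<Rightarrow> (real^'n \<Rightarrow> real^'n) \<Rightarrow> (real^'n) set \<Rightarrow>
   (real^'n) set \<Rightarrow> (real^'n) set \<Rightarrow> (real^'n) set \<Rightarrow> bool"
where
  "standing_regularity lam mu f g \<Gamma> D \<Omega> \<omega> \<longleftrightarrow>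
     (\<forall>X\<in>admissible_fields D \<omega>.
        let K = closure (\<Omega> - \<omega>);
            u = state lam mu f g \<Gamma> \<Omega>;
            ud = material_derivative lam mu f g \<Gamma> D \<Omega> X;
            w = pulled_state lam mu f g \<Gamma> \<Omega> X
        in in_C1 K ud \<and>
           (\<exists>\<rho>>0. \<forall>Y\<in>admissible_fields D \<omega>. \<forall>t. field_norm D Y < \<rho> \<longrightarrow> 0 \<le> t \<longrightarrow> t < \<rho> \<longrightarrow>
              in_C1 K (w Y t)) \<and>
           (\<forall>\<epsilon>>0. \<exists>\<rho>>0. \<forall>Y\<in>admissible_fields D \<omega>. \<forall>t. field_norm D Y < \<rho> \<longrightarrow> 0 < t \<longrightarrow> t < \<rho> \<longrightarrow>
              C1_norm K (\<lambda>x. w Y t x - u x) < \<epsilon>) \<and>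
           (\<forall>\<epsilon>>0. \<exists>\<rho>>0. \<forall>Y\<in>admissible_fields D \<omega>. \<forall>t. field_norm D Y < \<rho> \<longrightarrow> 0 < t \<longrightarrow> t < \<rho> \<longrightarrow>
              C1_norm K (\<lambda>x. (w Y t x - w Y 0 x) /\<^sub>R t - ud x) < \<epsilon>))"


section \<open>Shape functionals\<close>

text \<open>The von Mises stress \<open>\<sigma>\<^sub>M\<^sup>2(u\<^sub>S)(x)\<close> of the state on \<open>S\<close>, for \<open>x\<close> in \<open>closure (S - \<omega>)\<close>.\<close>

definition stress ::
  "real \<Rightarrow> real \<Rightarrow> (real^'n::finite \<Rightarrow> real^'n) \<Rightarrow> (real^'n \<Rightarrow> real^'n) \<Rightarrow> (real^'n) set \<Rightarrow>
   (real^'n) set \<Rightarrow> (real^'n) set \<Rightarrow> real^'n \<Rightarrow> real"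
where
  "stress lam mu f g \<Gamma> \<omega> S x =
     (let e = symm (C1_grad (closure (S - \<omega>)) (state lam mu f g \<Gamma> S) x)
      in B_op lam mu e \<bullet> e)"

definition J_vol :: "real \<Rightarrow> (real^'n::finite) set \<Rightarrow> real" where
  "J_vol V S = (measure lebesgue S - V)\<^sup>2"

definition J_sigma ::
  "real \<Rightarrow> real \<Rightarrow> (real^'n::finite \<Rightarrow> real^'n) \<Rightarrow> (real^'n \<Rightarrow> real^'n) \<Rightarrow> (real^'n) set \<Rightarrow>
   (real^'n) set \<Rightarrow> real \<Rightarrow> (real^'n) set \<Rightarrow> real"
where
  "J_sigma lam mu f g \<Gamma> \<omega> \<delta> S =
     max ((SUP x\<in>closure (S - \<omega>). stress lam mu f g \<Gamma> \<omega> S x) - \<delta>) 0"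

definition J_total ::
  "real \<Rightarrow> real \<Rightarrow> (real^'n::finite \<Rightarrow> real^'n) \<Rightarrow> (real^'n \<Rightarrow> real^'n) \<Rightarrow> (real^'n) set \<Rightarrow>
   (real^'n) set \<Rightarrow> real \<Rightarrow> real \<Rightarrow> real \<Rightarrow> (real^'n) set \<Rightarrow> real"
where
  "J_total lam mu f g \<Gamma> \<omega> \<delta> V \<alpha> S = J_vol V S + \<alpha> * J_sigma lam mu f g \<Gamma> \<omega> \<delta> S"

definition shape_derivative ::
  "((real^'n::finite) set \<Rightarrow> real) \<Rightarrow> (real^'n) set \<Rightarrow> (real^'n \<Rightarrow> real^'n) \<Rightarrow> real"
where
  "shape_derivative J \<Omega> X = Lim (at_right 0) (\<lambda>t. (J (deform (scale_field t X) ` \<Omega>) - J \<Omega>) / t)"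

text \<open>
  \<open>J\<^sub>\<sigma>\<^sup>x(\<Omega>\<^sub>t)\<close> also depends on the transformation \<open>F\<^sub>t\<close>, so it takes \<open>X\<close> and \<open>t\<close> as arguments.
\<close>

definition J_point ::
  "real \<Rightarrow> real \<Rightarrow> (real^'n::finite \<Rightarrow> real^'n) \<Rightarrow> (real^'n \<Rightarrow> real^'n) \<Rightarrow> (real^'n) set \<Rightarrow>
   (real^'n) set \<Rightarrow> real \<Rightarrow> (real^'n) set \<Rightarrow> real^'n \<Rightarrow> (real^'n \<Rightarrow> real^'n) \<Rightarrow> real \<Rightarrow> real"
where
  "J_point lam mu f g \<Gamma> \<omega> \<delta> \<Omega> x X t =
     (let F = deform (scale_field t X) in stress lam mu f g \<Gamma> \<omega> (F ` \<Omega>) (F x) - \<delta>)"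

definition DJ_point ::
  "real \<Rightarrow> real \<Rightarrow> (real^'n::finite \<Rightarrow> real^'n) \<Rightarrow> (real^'n \<Rightarrow> real^'n) \<Rightarrow> (real^'n) set \<Rightarrow>
   (real^'n) set \<Rightarrow> real \<Rightarrow> (real^'n) set \<Rightarrow> real^'n \<Rightarrow> (real^'n \<Rightarrow> real^'n) \<Rightarrow> real"
where
  "DJ_point lam mu f g \<Gamma> \<omega> \<delta> \<Omega> x X =
     Lim (at_right 0) (\<lambda>t. (J_point lam mu f g \<Gamma> \<omega> \<delta> \<Omega> x X t - J_point lam mu f g \<Gamma> \<omega> \<delta> \<Omega> x X 0) / t)"

definition active_set ::
  "real \<Rightarrow> real \<Rightarrow> (real^'n::finite \<Rightarrow> real^'n) \<Rightarrow> (real^'n \<Rightarrow> real^'n) \<Rightarrow> (real^'n) set \<Rightarrow>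
   (real^'n) set \<Rightarrow> (real^'n) set \<Rightarrow> (real^'n) set"
where
  "active_set lam mu f g \<Gamma> \<omega> \<Omega> =
     {z \<in> closure (\<Omega> - \<omega>).
        stress lam mu f g \<Gamma> \<omega> \<Omega> z = (SUP x\<in>closure (\<Omega> - \<omega>). stress lam mu f g \<Gamma> \<omega> \<Omega> x)}"


section \<open>The Hilbert space of fields, gradients, Clarke subgradient\<close>

text \<open>
  A Hilbert space of admissible fields is a Hilbert space type together with an injective linear
  map \<open>E\<close> (the inclusion) into the admissible fields. Continuity of point evaluation of the gradient
  ties the Hilbert norm to the fields.
\<close>

definition hilbert_space_of_fields ::
  "(real^'n::finite) set \<Rightarrow> (real^'n) set \<Rightarrow> ('h::{real_inner,complete_space} \<Rightarrow> real^'n \<Rightarrow> real^'n) \<Rightarrow> bool"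
where
  "hilbert_space_of_fields D \<omega> E \<longleftrightarrow>
     inj E \<and> range E \<subseteq> admissible_fields D \<omega> \<and>
     (\<forall>x. linear (\<lambda>h. E h x)) \<and>
     (\<forall>x\<in>closure D. continuous_on UNIV (\<lambda>h. field_jac (E h) x))"

definition riesz_representative :: "('h::real_inner \<Rightarrow> real) \<Rightarrow> 'h" where
  "riesz_representative l = (THE g. \<forall>h. g \<bullet> h = l h)"

definition grad_J_vol ::
  "real \<Rightarrow> (real^'n::finite) set \<Rightarrow> ('h::real_inner \<Rightarrow> real^'n \<Rightarrow> real^'n) \<Rightarrow> 'h"
where
  "grad_J_vol V \<Omega> E = riesz_representative (\<lambda>h. shape_derivative (J_vol V) \<Omega> (E h))"

definition grad_J_point ::
  "real \<Rightarrow> real \<Rightarrow> (real^'n::finite \<Rightarrow> real^'n) \<Rightarrow> (real^'n \<Rightarrow> real^'n) \<Rightarrow> (real^'n) set \<Rightarrow>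
   (real^'n) set \<Rightarrow> real \<Rightarrow> (real^'n) set \<Rightarrow> ('h::real_inner \<Rightarrow> real^'n \<Rightarrow> real^'n) \<Rightarrow> real^'n \<Rightarrow> 'h"
where
  "grad_J_point lam mu f g \<Gamma> \<omega> \<delta> \<Omega> E x =
     riesz_representative (\<lambda>h. DJ_point lam mu f g \<Gamma> \<omega> \<delta> \<Omega> x (E h))"

definition Z_set ::
  "real \<Rightarrow> real \<Rightarrow> (real^'n::finite \<Rightarrow> real^'n) \<Rightarrow> (real^'n \<Rightarrow> real^'n) \<Rightarrow> (real^'n) set \<Rightarrow>
   (real^'n) set \<Rightarrow> real \<Rightarrow> real \<Rightarrow> real \<Rightarrow> (real^'n) set \<Rightarrow>
   ('h::real_inner \<Rightarrow> real^'n \<Rightarrow> real^'n) \<Rightarrow> 'h set"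
where
  "Z_set lam mu f g \<Gamma> \<omega> \<delta> V \<alpha> \<Omega> E =
     (let A = active_set lam mu f g \<Gamma> \<omega> \<Omega>;
          s = stress lam mu f g \<Gamma> \<omega> \<Omega>;
          z = (\<lambda>x. grad_J_vol V \<Omega> E + \<alpha> *\<^sub>R grad_J_point lam mu f g \<Gamma> \<omega> \<delta> \<Omega> E x)
      in if \<forall>x\<in>A. s x > \<delta> then z ` A
         else if \<forall>x\<in>A. s x = \<delta> then z ` A \<union> {grad_J_vol V \<Omega> E}
         else {grad_J_vol V \<Omega> E})"

definition G_fun ::
  "real \<Rightarrow> real \<Rightarrow> (real^'n::finite \<Rightarrow> real^'n) \<Rightarrow> (real^'n \<Rightarrow> real^'n) \<Rightarrow> (real^'n) set \<Rightarrow>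
   (real^'n) set \<Rightarrow> real \<Rightarrow> real \<Rightarrow> real \<Rightarrow> (real^'n) set \<Rightarrow>
   ('h::real_inner \<Rightarrow> real^'n \<Rightarrow> real^'n) \<Rightarrow> 'h \<Rightarrow> real"
where
  "G_fun lam mu f g \<Gamma> \<omega> \<delta> V \<alpha> \<Omega> E h = J_total lam mu f g \<Gamma> \<omega> \<delta> V \<alpha> (deform (E h) ` \<Omega>)"

definition clarke_derivative :: "('a::real_normed_vector \<Rightarrow> real) \<Rightarrow> 'a \<Rightarrow> 'a \<Rightarrow> ereal" where
  "clarke_derivative h x0 v =
     Limsup (nhds x0 \<times>\<^sub>F at_right 0) (\<lambda>(y, t). ereal ((h (y + t *\<^sub>R v) - h y) / t))"

definition clarke_subgradient :: "('a::real_normed_vector \<Rightarrow> real) \<Rightarrow> 'a \<Rightarrow> ('a \<Rightarrow>\<^sub>L real) set" where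
  "clarke_subgradient h x0 = {l. \<forall>v. ereal (blinfun_apply l v) \<le> clarke_derivative h x0 v}"

end

theory Submission
  imports Defs
begin

text \<open>The functional \<open>G\<close> is, near \<open>0\<close>, a maximum of functions that are strictly differentiable, uniformly
  in the index, and for such a maximum the generalised directional derivative at \<open>0\<close> is the
  maximum of the derivatives of the active functions. The theorem says this in dual form.

  Write \<open>F = id + E y\<close>. For \<open>y\<close> near \<open>0\<close> the map \<open>F\<close> is a diffeomorphism onto its image that fixes
  \<open>\<omega>\<close>, so it carries \<open>K = closure (\<Omega> - \<omega>)\<close> onto the corresponding set of \<open>F(\<Omega>)\<close>, and
  \<open>G(y) = J\<^sub>v\<^sub>o\<^sub>l(F(\<Omega>)) + \<alpha> max(s(y,x) - \<delta>, 0)\<close> maximised over \<open>x \<in> K\<close>, with \<open>s(y,x)\<close> the stress of the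
  state on \<open>F(\<Omega>)\<close> at \<open>F(x)\<close>. The constant \<open>0\<close> is one more index, called \<open>None\<close>; this way the three
  cases in the definition of \<open>\<Z>\<close> are one: \<open>\<Z>\<close> consists of the gradients of the active indices
  (\<open>clarke_subgradient_G_fun\<close>).

  Strict differentiability along \<open>v\<close> means that the quotients \<open>(f(y + tv,x) - f(y,x)) / t\<close> converge
  uniformly in \<open>x\<close> as \<open>y \<rightarrow> 0\<close> and \<open>t \<down> 0\<close> together. It is stable under linear and bilinear operations and under
  division, and it has three sources. The Jacobian of \<open>E y\<close> is linear in \<open>y\<close>, and bounded by
  the norm of \<open>y\<close> because of the uniform boundedness principle (\<open>field_norm_bound\<close>). The gradient of the
  pulled-back state is strictly differentiable by the standing regularity assumption; the chain rule
  turns it into the gradient that enters the stress (\<open>strict_deriv_along_moved_grad\<close>). The volume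
  is an integral of \<open>det (1 + D(E y))\<close> by the change of variables formula
  (\<open>strictly_C1_along_volume\<close>).

  The derivative of the maximum (\<open>clarke_derivative_SUP\<close>) needs that the derivative of an index
  which is nearly maximal exceeds that of some active one by little. On the closure of the interior of \<open>K\<close> this is
  compactness; elsewhere in \<open>K\<close> gradients are zero by convention and stress and derivative vanish
  (\<open>near_active\<close>). Finally, a vector of a Hilbert space lies in the closed convex hull of \<open>\<Z>\<close> iff it
  is bounded by the support function of \<open>\<Z>\<close>, by separation (\<open>closure_convex_hull_iff_support\<close>).\<close>

section \<open>Projection, separation and uniform boundedness in Hilbert space\<close>

text \<open>Closed balls need not be compact here, so a minimising sequence is shown to be Cauchy, by the
  parallelogram law applied to two of its members and their midpoint in \<open>S\<close>.\<close>

lemma closest_point_hilbert: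
  fixes S :: "'h::{real_inner,complete_space} set"
  assumes "convex S" "closed S" "S \<noteq> {}"
  obtains p where "p \<in> S" "\<And>z. z \<in> S \<Longrightarrow> dist a p \<le> dist a z"
proof -
  define d where "d = infdist a S"
  have d_le: "d \<le> norm (z - a)" if "z \<in> S" for z
    using infdist_le[OF that, of a] by (simp add: d_def dist_norm norm_minus_commute)
  have d0: "0 \<le> d" by (simp add: d_def infdist_nonneg)
  have "\<exists>z\<in>S. norm (z - a) < d + inverse (Suc n)" for n
  proof (rule ccontr)
    assume "\<not> ?thesis"
    then have "d + inverse (Suc n) \<le> infdist a S"
      unfolding infdist_notempty[OF assms(3)]
      by (intro cINF_greatest assms(3)) (auto simp: not_less dist_norm norm_minus_commute)
    then show False by (simp add: d_def)
  qed
  then obtain z where zS: "\<And>n. z n \<in> S" and zd: "\<And>n. norm (z n - a) < d + inverse (Suc n)"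
    by metis
  have par: "(norm (x - y))\<^sup>2 \<le> 2 * (norm (x - a))\<^sup>2 + 2 * (norm (y - a))\<^sup>2 - 4 * d\<^sup>2"
    if "x \<in> S" "y \<in> S" for x y
  proof -
    have "(1/2) *\<^sub>R x + (1/2) *\<^sub>R y \<in> S"
      using assms(1) that by (intro convexD) auto
    from d_le[OF this] have "d\<^sup>2 \<le> (norm ((1/2) *\<^sub>R x + (1/2) *\<^sub>R y - a))\<^sup>2"
      using d0 by (intro power_mono) auto
    moreover have "4 * (norm ((1/2) *\<^sub>R x + (1/2) *\<^sub>R y - a))\<^sup>2 + (norm (x - y))\<^sup>2
       = 2 * (norm (x - a))\<^sup>2 + 2 * (norm (y - a))\<^sup>2"
      unfolding power2_norm_eq_inner
      by (simp add: inner_diff_left inner_diff_right inner_add_left inner_add_right inner_commute algebra_simps)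
    ultimately show ?thesis by linarith
  qed
  have "Cauchy z"
  proof (rule metric_CauchyI)
    fix e :: real assume e: "0 < e"
    have "(\<lambda>n. 4 * (d + inverse (Suc n))\<^sup>2 - 4 * d\<^sup>2) \<longlonglongrightarrow> 4 * (d + 0)\<^sup>2 - 4 * d\<^sup>2"
      by (intro tendsto_intros LIMSEQ_inverse_real_of_nat)
    then have "\<forall>\<^sub>F n in sequentially. 4 * (d + inverse (Suc n))\<^sup>2 - 4 * d\<^sup>2 < e\<^sup>2"
      using e by (intro order_tendstoD(2)) auto
    then obtain N where N: "4 * (d + inverse (Suc N))\<^sup>2 - 4 * d\<^sup>2 < e\<^sup>2"
      by (auto simp: eventually_sequentially)
    have bd: "(norm (z n - a))\<^sup>2 \<le> (d + inverse (Suc N))\<^sup>2" if "N \<le> n" for n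
    proof -
      have "inverse (real (Suc n)) \<le> inverse (real (Suc N))"
        using that by (intro le_imp_inverse_le) auto
      then have "norm (z n - a) \<le> d + inverse (real (Suc N))" using zd[of n] by linarith
      then show ?thesis by (intro power_mono) auto
    qed
    show "\<exists>M. \<forall>m\<ge>M. \<forall>n\<ge>M. dist (z m) (z n) < e"
    proof (intro exI allI impI)
      fix m n assume "N \<le> m" "N \<le> n"
      then have "(norm (z m - z n))\<^sup>2 < e\<^sup>2"
        using par[OF zS zS, of m n] bd[of m] bd[of n] N by linarith
      then show "dist (z m) (z n) < e"
        using e by (simp add: dist_norm power_less_imp_less_base)
    qed
  qed
  then obtain p where p: "z \<longlonglongrightarrow> p"
    using Cauchy_convergent convergent_def by blast
  have "p \<in> S" using assms(2) zS p by (metis closed_sequentially)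
  moreover have "norm (p - a) \<le> d"
  proof -
    have "(\<lambda>n. d + inverse (real (Suc n))) \<longlonglongrightarrow> d + 0"
      by (intro tendsto_intros LIMSEQ_inverse_real_of_nat)
    then have *: "(\<lambda>n. d + inverse (real (Suc n))) \<longlonglongrightarrow> d" by simp
    have "(\<lambda>n. norm (z n - a)) \<longlonglongrightarrow> norm (p - a)"
      using p by (intro tendsto_intros)
    then show ?thesis using * by (rule LIMSEQ_le) (use zd less_imp_le in blast)
  qed
  ultimately show ?thesis
    using that[of p] d_le by (metis dist_commute dist_norm order_trans)
qed

lemma separate_point_hilbert:
  fixes S :: "'h::{real_inner,complete_space} set"
  assumes "convex S" "closed S" "S \<noteq> {}" "a \<notin> S"
  obtains v c where "\<And>z. z \<in> S \<Longrightarrow> z \<bullet> v \<le> c" "c < a \<bullet> v"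
proof -
  obtain p where p: "p \<in> S" "\<And>z. z \<in> S \<Longrightarrow> dist a p \<le> dist a z"
    using closest_point_hilbert[OF assms(1-3)] by blast
  have "(a - p) \<bullet> (z - p) \<le> 0" if "z \<in> S" for z
    using any_closest_point_dot[OF assms(1,2) p(1) that] p(2) by blast
  then have 1: "z \<bullet> (a - p) \<le> p \<bullet> (a - p)" if "z \<in> S" for z
    using that by (fastforce simp: inner_diff_right inner_diff_left inner_commute)
  have "a \<noteq> p" using p(1) assms(4) by blast
  then have "0 < (a - p) \<bullet> (a - p)" by simp
  then have 2: "p \<bullet> (a - p) < a \<bullet> (a - p)" by (simp add: inner_diff_left)
  show ?thesis using that[OF 1 2] .
qed

text \<open>The normal vector that separates the kernel of \<open>l\<close> from a point outside it is orthogonal to the kernel;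
  a multiple of it represents \<open>l\<close>.\<close>

lemma riesz_representation:
  fixes l :: "'h::{real_inner,complete_space} \<Rightarrow> real"
  assumes "bounded_linear l"
  shows "\<exists>g. \<forall>h. g \<bullet> h = l h"
proof (cases "\<forall>h. l h = 0")
  case True
  then show ?thesis by (intro exI[of _ 0]) simp
next
  case False
  interpret bounded_linear l by fact
  obtain a where a: "l a \<noteq> 0" using False by blast
  define S where "S = {h. l h = 0}"
  have "convex S" unfolding S_def by (simp add: convex_def add scaleR)
  moreover have "closed S"
    unfolding S_def using continuous_on[OF continuous_on_id] by (intro closed_Collect_eq) auto
  moreover have "0 \<in> S" by (simp add: S_def zero)
  moreover have "a \<notin> S" using a by (simp add: S_def)
  ultimately obtain w c where w: "\<And>z. z \<in> S \<Longrightarrow> z \<bullet> w \<le> c" "c < a \<bullet> w"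
    using separate_point_hilbert[of S a] by blast
  \<comment> \<open>A linear functional bounded above on a subspace vanishes there.\<close>
  have orth: "z \<bullet> w = 0" if "z \<in> S" for z
  proof (rule ccontr)
    assume n: "z \<bullet> w \<noteq> 0"
    have "((c + 1) / (z \<bullet> w)) *\<^sub>R z \<in> S" using that by (simp add: S_def scaleR)
    from w(1)[OF this] show False using n by simp
  qed
  have "l h * (a \<bullet> w) = l a * (h \<bullet> w)" for h
  proof -
    have "l a *\<^sub>R h - l h *\<^sub>R a \<in> S" by (simp add: S_def diff scaleR)
    from orth[OF this] show ?thesis by (simp add: inner_diff_left)
  qed
  moreover have "a \<bullet> w \<noteq> 0" using w(1)[OF \<open>0 \<in> S\<close>] w(2) by auto
  ultimately have "\<forall>h. ((l a / (a \<bullet> w)) *\<^sub>R w) \<bullet> h = l h"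
    by (simp add: field_simps inner_commute)
  then show ?thesis by blast
qed

lemma riesz_representative_inner:
  fixes l :: "'h::{real_inner,complete_space} \<Rightarrow> real"
  assumes "bounded_linear l"
  shows "riesz_representative l \<bullet> h = l h"
proof -
  obtain g where g: "\<forall>h. g \<bullet> h = l h" using riesz_representation[OF assms] by blast
  have "(THE g. \<forall>h. g \<bullet> h = l h) = g"
  proof (intro the_equality)
    show "\<forall>h. g \<bullet> h = l h" by (rule g)
    fix g' assume "\<forall>h. g' \<bullet> h = l h"
    then have "\<forall>h. g' \<bullet> h = g \<bullet> h" using g by simp
    then show "g' = g" by (simp only: vector_eq_rdot)
  qed
  then show ?thesis using g by (simp add: riesz_representative_def)
qed

text \<open>By Baire's theorem one of the closed sets on which all \<open>T i\<close> are bounded by \<open>n\<close> contains a ball.\<close>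

lemma uniform_boundedness:
  fixes T :: "'i \<Rightarrow> 'h::{real_normed_vector,complete_space} \<Rightarrow> 'b::real_normed_vector"
  assumes bl: "\<And>i. i \<in> I \<Longrightarrow> bounded_linear (T i)"
    and pt: "\<And>h. bounded ((\<lambda>i. T i h) ` I)"
  obtains C where "0 \<le> C" "\<And>i h. i \<in> I \<Longrightarrow> norm (T i h) \<le> C * norm h"
proof -
  define S where "S n = {h. \<forall>i\<in>I. norm (T i h) \<le> real n}" for n :: nat
  have "closed (S n)" for n
  proof -
    have "S n = (\<Inter>i\<in>I. {h. norm (T i h) \<le> real n})" by (auto simp: S_def)
    moreover have "closed {h. norm (T i h) \<le> real n}" if "i \<in> I" for i
      using bounded_linear.continuous_on[OF bl[OF that] continuous_on_id]
      by (intro closed_Collect_le continuous_intros) auto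
    ultimately show ?thesis by auto
  qed
  moreover have "(\<Union>n. S n) = UNIV"
  proof -
    have "h \<in> (\<Union>n. S n)" for h
    proof -
      obtain B where "\<And>i. i \<in> I \<Longrightarrow> norm (T i h) \<le> B"
        using pt[of h] by (auto simp: bounded_iff)
      moreover obtain n where "B \<le> real n" using real_arch_simple by blast
      ultimately have "h \<in> S n" by (auto simp: S_def intro: order_trans)
      then show ?thesis by blast
    qed
    then show ?thesis by blast
  qed
  ultimately have "\<exists>n. interior (S n) \<noteq> {}"
    using Baire_category_alt[of "euclidean :: 'h topology" "range S"]
    by (auto simp: completely_metrizable_space_euclidean)
  then obtain n x e where e: "0 < e" "cball x e \<subseteq> S n"
    by (metis all_not_in_conv interior_subset mem_interior_cball)
  show ?thesis
  proof (rule that[of "2 * real n / e"])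
    show "0 \<le> 2 * real n / e" using e by simp
    fix i h assume i: "i \<in> I"
    interpret bounded_linear "T i" by (rule bl[OF i])
    show "norm (T i h) \<le> 2 * real n / e * norm h"
    proof (cases "h = 0")
      case True
      then show ?thesis by (simp add: zero)
    next
      case False
      define k where "k = (e / norm h) *\<^sub>R h"
      have "x + k \<in> S n" "x \<in> S n"
        using e False by (auto simp: k_def dist_norm intro!: subsetD[OF e(2)])
      then have "norm (T i (x + k)) \<le> n" "norm (T i x) \<le> n" using i by (auto simp: S_def)
      then have "norm (T i k) \<le> 2 * n"
        using norm_triangle_ineq4[of "T i (x + k)" "T i x"] by (simp add: add)
      moreover have "norm (T i k) = e / norm h * norm (T i h)"
        using e by (simp add: k_def scaleR)
      ultimately show ?thesis using e False by (simp add: field_simps)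
    qed
  qed
qed

text \<open>A closed half-space that contains \<open>Z\<close> contains its closed convex hull, and these half-spaces
  separate all other points. The supremum is taken in \<open>ereal\<close> since the support function of an
  unbounded set may be infinite.\<close>

lemma closure_convex_hull_iff_support:
  fixes Z :: "'h::{real_inner,complete_space} set"
  assumes "Z \<noteq> {}"
  shows "h \<in> closure (convex hull Z) \<longleftrightarrow> (\<forall>v. ereal (h \<bullet> v) \<le> (SUP z\<in>Z. ereal (z \<bullet> v)))"
proof (intro iffI allI)
  fix v assume h: "h \<in> closure (convex hull Z)"
  obtain z0 where z0: "z0 \<in> Z" using assms by blast
  show "ereal (h \<bullet> v) \<le> (SUP z\<in>Z. ereal (z \<bullet> v))"
  proof (cases "SUP z\<in>Z. ereal (z \<bullet> v)")
    case (real c)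
    have "z \<bullet> v \<le> c" if "z \<in> Z" for z
      using SUP_upper[OF that, of "\<lambda>z. ereal (z \<bullet> v)"] real by simp
    then have "Z \<subseteq> {z. z \<bullet> v \<le> c}" by blast
    moreover have "convex {z. z \<bullet> v \<le> c}"
      using convex_halfspace_le[of v c] by (simp add: inner_commute)
    ultimately have "convex hull Z \<subseteq> {z. z \<bullet> v \<le> c}" by (rule hull_minimal)
    moreover have "closed {z. z \<bullet> v \<le> c}"
      using closed_halfspace_le[of v c] by (simp add: inner_commute)
    ultimately have "closure (convex hull Z) \<subseteq> {z. z \<bullet> v \<le> c}" by (rule closure_minimal)
    then show ?thesis using h real by auto
  next
    case MInf
    then show ?thesis using SUP_upper[OF z0, of "\<lambda>z. ereal (z \<bullet> v)"] by simp
  qed simp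
next
  assume *: "\<forall>v. ereal (h \<bullet> v) \<le> (SUP z\<in>Z. ereal (z \<bullet> v))"
  show "h \<in> closure (convex hull Z)"
  proof (rule ccontr)
    assume "h \<notin> closure (convex hull Z)"
    moreover have "closure (convex hull Z) \<noteq> {}" using assms by simp
    moreover have "convex (closure (convex hull Z))" by (intro convex_closure) simp
    ultimately obtain v c where vc: "\<And>z. z \<in> closure (convex hull Z) \<Longrightarrow> z \<bullet> v \<le> c" "c < h \<bullet> v"
      using separate_point_hilbert[of "closure (convex hull Z)" h] by auto
    have "z \<bullet> v \<le> c" if "z \<in> Z" for z
      using vc(1) that by (meson closure_subset hull_subset subsetD)
    then have "(SUP z\<in>Z. ereal (z \<bullet> v)) \<le> ereal c" by (intro SUP_least) simp
    then show False using *[rule_format, of v] vc(2) by (metis ereal_less_eq(3) not_le order_trans)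
  qed
qed

section \<open>Strict derivatives, uniformly in a parameter\<close>

text \<open>The index \<open>x \<in> X\<close> is a parameter in which everything is uniform. Strictness, that is, letting the base
  point \<open>y\<close> move while \<open>t \<down> 0\<close>, is what the limes superior in the generalised derivative asks for.
  The bounds are included because products of uniform limits converge uniformly only if the limits
  are bounded.\<close>

definition strict_deriv_along ::
  "'a::real_normed_vector \<Rightarrow> 'i set \<Rightarrow> ('a \<Rightarrow> 'i \<Rightarrow> 'b::real_normed_vector) \<Rightarrow> ('i \<Rightarrow> 'b) \<Rightarrow> bool"
where
  "strict_deriv_along v X f f' \<longleftrightarrow>
     bounded (f 0 ` X) \<and> bounded (f' ` X) \<and> uniform_limit X f (f 0) (nhds 0) \<and>
     uniform_limit X (\<lambda>(y, t) x. (f (y + t *\<^sub>R v) x - f y x) /\<^sub>R t) f' (nhds 0 \<times>\<^sub>F at_right 0)"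

lemma filterlim_base_point:
  "filterlim fst (nhds (0::'a::real_normed_vector)) (nhds 0 \<times>\<^sub>F at_right (0::real))"
  by (rule filterlim_fst)

lemma filterlim_moved_point:
  fixes v :: "'a::real_normed_vector"
  shows "filterlim (\<lambda>z. fst z + snd z *\<^sub>R v) (nhds 0) (nhds 0 \<times>\<^sub>F at_right (0::real))"
proof -
  have "filterlim snd (at_right (0::real)) (nhds (0::'a) \<times>\<^sub>F at_right (0::real))"
    by (rule filterlim_snd)
  then have "filterlim snd (nhds (0::real)) (nhds (0::'a) \<times>\<^sub>F at_right (0::real))"
    by (simp add: filterlim_at)
  with filterlim_base_point[where 'a='a]
  have "((\<lambda>z::'a\<times>real. fst z + snd z *\<^sub>R v) \<longlongrightarrow> 0 + 0 *\<^sub>R v) (nhds 0 \<times>\<^sub>F at_right (0::real))"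
    by (intro tendsto_intros)
  then show ?thesis by simp
qed

lemma eventually_step_pos:
  "\<forall>\<^sub>F z in nhds (0::'a::real_normed_vector) \<times>\<^sub>F at_right (0::real). 0 < snd z \<and> snd z < e" if "0 < e"
proof -
  have "\<forall>\<^sub>F t in at_right (0::real). 0 < t \<and> t < e"
    using eventually_at_right_real[OF that] by (auto elim: eventually_mono)
  then have "\<forall>\<^sub>F z in nhds (0::'a) \<times>\<^sub>F at_right (0::real). case z of (y, t) \<Rightarrow> 0 < t \<and> t < e"
    using eventually_prod2[of "nhds (0::'a)" "\<lambda>t. 0 < t \<and> t < e" "at_right 0"] by simp
  then show ?thesis by (auto elim: eventually_mono)
qed

lemma eventually_base_and_moved:
  fixes v :: "'a::real_normed_vector"
  assumes "\<forall>\<^sub>F y in nhds 0. P y"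
  shows "\<forall>\<^sub>F z in nhds 0 \<times>\<^sub>F at_right (0::real). P (fst z) \<and> P (fst z + snd z *\<^sub>R v)"
  using eventually_compose_filterlim[OF assms filterlim_base_point]
    eventually_compose_filterlim[OF assms filterlim_moved_point] by (rule eventually_conj)

lemma strict_deriv_alongD:
  assumes "strict_deriv_along v X f f'"
  shows "bounded (f 0 ` X)" "bounded (f' ` X)"
    "uniform_limit X f (f 0) (nhds 0)"
    "uniform_limit X (\<lambda>z x. (f (fst z + snd z *\<^sub>R v) x - f (fst z) x) /\<^sub>R snd z) f' (nhds 0 \<times>\<^sub>F at_right 0)"
  using assms by (simp_all add: strict_deriv_along_def case_prod_beta')

lemma strict_deriv_along_base:
  assumes "strict_deriv_along v X f f'"
  shows "uniform_limit X (\<lambda>z. f (fst z)) (f 0) (nhds 0 \<times>\<^sub>F at_right (0::real))"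
    and "uniform_limit X (\<lambda>z. f (fst z + snd z *\<^sub>R v)) (f 0) (nhds 0 \<times>\<^sub>F at_right (0::real))"
  using filterlim_compose[OF strict_deriv_alongD(3)[OF assms] filterlim_base_point]
    filterlim_compose[OF strict_deriv_alongD(3)[OF assms] filterlim_moved_point] by auto

lemma strict_deriv_alongI:
  assumes "bounded (f 0 ` X)" "bounded (f' ` X)"
    "uniform_limit X f (f 0) (nhds 0)"
    "uniform_limit X (\<lambda>z x. (f (fst z + snd z *\<^sub>R v) x - f (fst z) x) /\<^sub>R snd z) f' (nhds 0 \<times>\<^sub>F at_right 0)"
  shows "strict_deriv_along v X f f'"
  using assms by (simp add: strict_deriv_along_def case_prod_beta')

lemma uniform_limit_eventually_cong:
  assumes "uniform_limit X f l F" "\<forall>\<^sub>F z in F. \<forall>x\<in>X. g z x = f z x"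
  shows "uniform_limit X g l F"
proof (rule uniform_limitI)
  fix e :: real assume "0 < e"
  from uniform_limitD[OF assms(1) this] assms(2)
  show "\<forall>\<^sub>F z in F. \<forall>x\<in>X. dist (g z x) (l x) < e"
    by eventually_elim simp
qed

lemma strict_deriv_along_cong:
  assumes "strict_deriv_along v X f f'" "\<forall>\<^sub>F y in nhds 0. \<forall>x\<in>X. g y x = f y x"
  shows "strict_deriv_along v X g f'"
proof -
  have 0: "\<forall>x\<in>X. g 0 x = f 0 x" using assms(2) eventually_nhds_x_imp_x by blast
  note f = strict_deriv_alongD[OF assms(1)]
  show ?thesis
  proof (rule strict_deriv_alongI)
    show "bounded (g 0 ` X)" using f(1) 0 by (simp cong: image_cong_simp)
    show "uniform_limit X g (g 0) (nhds 0)"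
    proof -
      have "uniform_limit X g (f 0) (nhds 0)" by (rule uniform_limit_eventually_cong[OF f(3) assms(2)])
      then show ?thesis using 0 by (auto simp: uniform_limit_iff)
    qed
    show "uniform_limit X (\<lambda>z x. (g (fst z + snd z *\<^sub>R v) x - g (fst z) x) /\<^sub>R snd z) f'
            (nhds 0 \<times>\<^sub>F at_right 0)"
      using eventually_base_and_moved[OF assms(2), of v]
      by (intro uniform_limit_eventually_cong[OF f(4)]) (auto elim: eventually_mono)
  qed (rule f(2))
qed

lemma strict_deriv_along_const:
  assumes "bounded (c ` X)"
  shows "strict_deriv_along v X (\<lambda>y. c) (\<lambda>x. 0)"
  using assms by (intro strict_deriv_alongI) (auto simp: uniform_limit_const image_constant_conv)

lemma bounded_image_add:
  fixes f g :: "'i \<Rightarrow> 'b::real_normed_vector"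
  assumes "bounded (f ` X)" "bounded (g ` X)"
  shows "bounded ((\<lambda>x. f x + g x) ` X)"
proof -
  obtain a b where "\<And>x. x \<in> X \<Longrightarrow> norm (f x) \<le> a" "\<And>x. x \<in> X \<Longrightarrow> norm (g x) \<le> b"
    using assms by (auto simp: bounded_iff)
  then show ?thesis by (intro boundedI[of _ "a + b"]) (auto intro!: norm_triangle_mono)
qed

lemma strict_deriv_along_add:
  assumes "strict_deriv_along v X f f'" "strict_deriv_along v X g g'"
  shows "strict_deriv_along v X (\<lambda>y x. f y x + g y x) (\<lambda>x. f' x + g' x)"
proof (rule strict_deriv_alongI)
  note f = strict_deriv_alongD[OF assms(1)] and g = strict_deriv_alongD[OF assms(2)]
  show "bounded ((\<lambda>x. f 0 x + g 0 x) ` X)" "bounded ((\<lambda>x. f' x + g' x) ` X)"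
    by (intro bounded_image_add f g)+
  show "uniform_limit X (\<lambda>y x. f y x + g y x) (\<lambda>x. f 0 x + g 0 x) (nhds 0)"
    by (intro uniform_limit_add f g)
  show "uniform_limit X (\<lambda>z x. (f (fst z + snd z *\<^sub>R v) x + g (fst z + snd z *\<^sub>R v) x -
          (f (fst z) x + g (fst z) x)) /\<^sub>R snd z) (\<lambda>x. f' x + g' x) (nhds 0 \<times>\<^sub>F at_right 0)"
    using uniform_limit_add[OF f(4) g(4)]
    by (rule uniform_limit_eventually_cong) (simp add: algebra_simps)
qed

lemma (in bounded_linear) bounded_image:
  assumes "bounded (g ` X)" shows "bounded ((\<lambda>x. f (g x)) ` X)"
  using bounded_linear_image[OF assms bounded_linear_axioms] by (simp add: image_image)

lemma (in bounded_linear) strict_deriv_along: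
  assumes "strict_deriv_along v X g g'"
  shows "strict_deriv_along v X (\<lambda>y x. f (g y x)) (\<lambda>x. f (g' x))"
proof (rule strict_deriv_alongI)
  note g = strict_deriv_alongD[OF assms]
  show "bounded ((\<lambda>x. f (g 0 x)) ` X)" "bounded ((\<lambda>x. f (g' x)) ` X)"
    by (intro bounded_image g)+
  show "uniform_limit X (\<lambda>y x. f (g y x)) (\<lambda>x. f (g 0 x)) (nhds 0)"
    by (intro uniform_limit g)
  show "uniform_limit X (\<lambda>z x. (f (g (fst z + snd z *\<^sub>R v) x) - f (g (fst z) x)) /\<^sub>R snd z)
         (\<lambda>x. f (g' x)) (nhds 0 \<times>\<^sub>F at_right 0)"
    using uniform_limit[OF g(4)]
    by (rule uniform_limit_eventually_cong) (simp add: scaleR diff)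
qed

lemma (in bounded_bilinear) bounded_image:
  assumes "bounded (f ` X)" "bounded (g ` X)"
  shows "bounded ((\<lambda>x. prod (f x) (g x)) ` X)"
proof -
  obtain K where K: "0 \<le> K" "\<And>a b. norm (prod a b) \<le> norm a * norm b * K"
    using nonneg_bounded by blast
  obtain a b where "\<And>x. x \<in> X \<Longrightarrow> norm (f x) \<le> a" "\<And>x. x \<in> X \<Longrightarrow> norm (g x) \<le> b"
    using assms by (auto simp: bounded_iff)
  then have "norm (prod (f x) (g x)) \<le> a * b * K" if "x \<in> X" for x
    using that K by (intro order_trans[OF K(2)] mult_right_mono mult_mono') auto
  then show ?thesis by (intro boundedI[of _ "a * b * K"]) auto
qed

lemma (in bounded_bilinear) strict_deriv_along:
  assumes "strict_deriv_along v X f f'" "strict_deriv_along v X g g'"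
  shows "strict_deriv_along v X (\<lambda>y x. prod (f y x) (g y x))
           (\<lambda>x. prod (f' x) (g 0 x) + prod (f 0 x) (g' x))"
proof (rule strict_deriv_alongI)
  note f = strict_deriv_alongD[OF assms(1)] and g = strict_deriv_alongD[OF assms(2)]
  show "bounded ((\<lambda>x. prod (f 0 x) (g 0 x)) ` X)"
    "bounded ((\<lambda>x. prod (f' x) (g 0 x) + prod (f 0 x) (g' x)) ` X)"
    by (intro bounded_image bounded_image_add f g)+
  show "uniform_limit X (\<lambda>y x. prod (f y x) (g y x)) (\<lambda>x. prod (f 0 x) (g 0 x)) (nhds 0)"
    by (intro bounded_uniform_limit f g)
  have "uniform_limit X
     (\<lambda>z x. prod ((f (fst z + snd z *\<^sub>R v) x - f (fst z) x) /\<^sub>R snd z) (g (fst z + snd z *\<^sub>R v) x) +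
            prod (f (fst z) x) ((g (fst z + snd z *\<^sub>R v) x - g (fst z) x) /\<^sub>R snd z))
     (\<lambda>x. prod (f' x) (g 0 x) + prod (f 0 x) (g' x)) (nhds 0 \<times>\<^sub>F at_right 0)"
    by (intro uniform_limit_add bounded_uniform_limit f g strict_deriv_along_base[OF assms(1)]
          strict_deriv_along_base[OF assms(2)])
  then show "uniform_limit X (\<lambda>z x. (prod (f (fst z + snd z *\<^sub>R v) x) (g (fst z + snd z *\<^sub>R v) x) -
        prod (f (fst z) x) (g (fst z) x)) /\<^sub>R snd z)
     (\<lambda>x. prod (f' x) (g 0 x) + prod (f 0 x) (g' x)) (nhds 0 \<times>\<^sub>F at_right 0)"
    by (rule uniform_limit_eventually_cong)
      (simp add: scaleR_left scaleR_right diff_left diff_right algebra_simps)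
qed


text \<open>Since \<open>Q = R - Q A\<close> with \<open>A\<close> small, \<open>Q\<close> is bounded by twice \<open>R\<close>; hence \<open>Q A\<close> tends to \<open>0\<close> and \<open>Q\<close>
  has the limit of \<open>R\<close>. With a bilinear \<open>prod\<close> this is division by \<open>1 + A\<close> without using
  inverses.\<close>

lemma uniform_limit_divide:
  fixes prod :: "'b::real_normed_vector \<Rightarrow> 'c::real_normed_vector \<Rightarrow> 'b"
  assumes bb: "bounded_bilinear prod"
    and R: "uniform_limit X R R0 F" "bounded (R0 ` X)"
    and A: "uniform_limit X A (\<lambda>x. 0) F"
    and eq: "\<forall>\<^sub>F z in F. \<forall>x\<in>X. Q z x + prod (Q z x) (A z x) = R z x"
  shows "uniform_limit X Q R0 F"
proof (rule uniform_limitI)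
  fix e :: real assume e: "0 < e"
  obtain K where K: "0 < K" "\<And>a b. norm (prod a b) \<le> norm a * norm b * K"
    using bounded_bilinear.pos_bounded[OF bb] by blast
  obtain B where B: "0 < B" "\<And>x. x \<in> X \<Longrightarrow> norm (R0 x) \<le> B"
    using R(2) by (auto simp: bounded_pos)
  \<comment> \<open>\<open>M\<close> will bound \<open>Q\<close>; the two entries of \<open>d\<close> make \<open>prod Q A\<close> at most \<open>norm Q / 2\<close> and \<open>e / 2\<close>.\<close>
  define M where "M = 2 * (B + 1)"
  define d where "d = min (1 / (2 * K)) (e / (2 * (M * K)))"
  have M: "0 < M" using B by (simp add: M_def)
  have d: "0 < d" using K e M by (simp add: d_def)
  have d1: "d * K \<le> 1/2" using K by (auto simp: d_def field_simps min_def)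
  have d2: "M * d * K \<le> e/2" using K M by (auto simp: d_def field_simps min_def)
  have e2: "0 < min (e/2) 1" using e by simp
  show "\<forall>\<^sub>F z in F. \<forall>x\<in>X. dist (Q z x) (R0 x) < e"
    using uniform_limitD[OF R(1) e2] uniform_limitD[OF A d] eq
  proof (eventually_elim, intro ballI)
    fix z x assume *: "\<forall>x\<in>X. dist (R z x) (R0 x) < min (e/2) 1" "\<forall>x\<in>X. dist (A z x) 0 < d"
      "\<forall>x\<in>X. Q z x + prod (Q z x) (A z x) = R z x" and x: "x \<in> X"
    have r: "norm (R z x - R0 x) < e/2" "norm (R z x - R0 x) < 1"
      using *(1) x by (auto simp: dist_norm)
    have a: "norm (A z x) \<le> d" using *(2) x by (auto intro: less_imp_le)
    have p: "norm (prod (Q z x) (A z x)) \<le> norm (Q z x) * d * K"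
      using K a by (intro order_trans[OF K(2)] mult_right_mono mult_left_mono) auto
    also have "\<dots> \<le> norm (Q z x) * (1/2)"
      using mult_left_mono[OF d1, of "norm (Q z x)"] by (simp add: mult.assoc)
    finally have p1: "norm (prod (Q z x) (A z x)) \<le> norm (Q z x) / 2" by simp
    have Qeq: "Q z x = R z x - prod (Q z x) (A z x)" using *(3) x by (metis add_diff_cancel_right')
    have "norm (R z x) \<le> B + 1"
      using B(2)[OF x] r(2) norm_triangle_sub[of "R z x" "R0 x"] by simp
    then have "norm (Q z x) \<le> M"
      using p1 norm_triangle_ineq4[of "R z x" "prod (Q z x) (A z x)"] Qeq by (simp add: M_def)
    then have "norm (Q z x) * (d * K) \<le> M * (d * K)"
      using d K by (intro mult_right_mono) auto
    then have p2: "norm (prod (Q z x) (A z x)) \<le> e/2" using p d2 by (simp add: mult.assoc)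
    have "dist (Q z x) (R0 x) = norm ((R z x - R0 x) - prod (Q z x) (A z x))"
      unfolding dist_norm by (subst Qeq) (simp add: algebra_simps)
    also have "\<dots> < e"
      using norm_triangle_ineq4[of "R z x - R0 x" "prod (Q z x) (A z x)"] r(1) p2 by linarith
    finally show "dist (Q z x) (R0 x) < e" .
  qed
qed

text \<open>Subtracting the equations at \<open>y + t v\<close> and at \<open>y\<close>, the difference quotient of \<open>N\<close> solves an equation of the
  same form, to which the previous lemma applies again.\<close>

lemma strict_deriv_along_divide:
  fixes prod :: "'b::real_normed_vector \<Rightarrow> 'c::real_normed_vector \<Rightarrow> 'b"
  assumes bb: "bounded_bilinear prod"
    and P: "strict_deriv_along v X P P'" and A: "strict_deriv_along v X A A'"
    and A0: "\<And>x. x \<in> X \<Longrightarrow> A 0 x = 0"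
    and eq: "\<forall>\<^sub>F y in nhds 0. \<forall>x\<in>X. N y x + prod (N y x) (A y x) = P y x"
  shows "strict_deriv_along v X N (\<lambda>x. P' x - prod (P 0 x) (A' x))"
proof -
  interpret bounded_bilinear prod by fact
  note p = strict_deriv_alongD[OF P] and a = strict_deriv_alongD[OF A]
  have A0': "uniform_limit X A (\<lambda>x. 0) (nhds 0)"
    using a(3) A0 by (auto simp: uniform_limit_iff)
  have N0: "N 0 x = P 0 x" if "x \<in> X" for x
    using eventually_nhds_x_imp_x[OF eq] A0 that by (auto simp: zero_right)
  have limN: "uniform_limit X N (P 0) (nhds 0)"
    by (rule uniform_limit_divide[OF bb p(3) p(1) A0' eq])
  have bd: "bounded ((\<lambda>x. P' x - prod (P 0 x) (A' x)) ` X)"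
    using bounded_image_add[OF p(2) bounded_linear.bounded_image[OF bounded_linear_minus[OF bounded_linear_ident]
      bounded_image[OF p(1) a(2)]]] by simp
  show ?thesis
  proof (rule strict_deriv_alongI)
    show "bounded (N 0 ` X)" using p(1) N0 by (simp cong: image_cong_simp)
    show "uniform_limit X N (N 0) (nhds 0)" using limN N0 by (auto simp: uniform_limit_iff)
    have "uniform_limit X
        (\<lambda>z x. (P (fst z + snd z *\<^sub>R v) x - P (fst z) x) /\<^sub>R snd z -
               prod (N (fst z) x) ((A (fst z + snd z *\<^sub>R v) x - A (fst z) x) /\<^sub>R snd z))
        (\<lambda>x. P' x - prod (P 0 x) (A' x)) (nhds 0 \<times>\<^sub>F at_right 0)"
      by (intro uniform_limit_minus bounded_uniform_limit p a
            filterlim_compose[OF limN filterlim_base_point])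
    moreover
      have "\<forall>\<^sub>F z in nhds 0 \<times>\<^sub>F at_right 0. \<forall>x\<in>X.
          (N (fst z + snd z *\<^sub>R v) x - N (fst z) x) /\<^sub>R snd z +
          prod ((N (fst z + snd z *\<^sub>R v) x - N (fst z) x) /\<^sub>R snd z) (A (fst z + snd z *\<^sub>R v) x) =
          (P (fst z + snd z *\<^sub>R v) x - P (fst z) x) /\<^sub>R snd z -
          prod (N (fst z) x) ((A (fst z + snd z *\<^sub>R v) x - A (fst z) x) /\<^sub>R snd z)"
        using eventually_base_and_moved[OF eq, of v]
      proof (eventually_elim, intro ballI)
        fix z :: "'a \<times> real" and x
        assume *: "(\<forall>x\<in>X. N (fst z) x + prod (N (fst z) x) (A (fst z) x) = P (fst z) x) \<and>
           (\<forall>x\<in>X. N (fst z + snd z *\<^sub>R v) x +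
              prod (N (fst z + snd z *\<^sub>R v) x) (A (fst z + snd z *\<^sub>R v) x) = P (fst z + snd z *\<^sub>R v) x)"
          and x: "x \<in> X"
        let ?n = "N (fst z) x" and ?m = "N (fst z + snd z *\<^sub>R v) x"
        let ?a = "A (fst z) x" and ?b = "A (fst z + snd z *\<^sub>R v) x"
        have "P (fst z) x = ?n + prod ?n ?a" "P (fst z + snd z *\<^sub>R v) x = ?m + prod ?m ?b"
          using * x by auto
        then show "(?m - ?n) /\<^sub>R snd z + prod ((?m - ?n) /\<^sub>R snd z) ?b =
           (P (fst z + snd z *\<^sub>R v) x - P (fst z) x) /\<^sub>R snd z - prod ?n ((?b - ?a) /\<^sub>R snd z)"
          by (simp add: scaleR_left scaleR_right diff_left diff_right algebra_simps)
      qed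
    ultimately show "uniform_limit X (\<lambda>z x. (N (fst z + snd z *\<^sub>R v) x - N (fst z) x) /\<^sub>R snd z)
       (\<lambda>x. P' x - prod (P 0 x) (A' x)) (nhds 0 \<times>\<^sub>F at_right 0)"
      by (rule uniform_limit_divide[OF bb _ bd filterlim_compose[OF A0' filterlim_moved_point]])
  qed (rule bd)
qed


section \<open>Generalised derivative and subgradient of a maximum\<close>

text \<open>Upper bound: a nearly maximal index for \<open>y + t v\<close> bounds the quotient of the maxima by its own
  quotient, and it is nearly maximal at \<open>0\<close>, so the hypothesis on nearly maximal indices compares its
  derivative with that of an active one. Lower bound: along \<open>y = 0\<close> each active index bounds the
  quotient of the maxima from below by its own.\<close>

theorem clarke_derivative_SUP:
  fixes s :: "'a::real_normed_vector \<Rightarrow> 'i \<Rightarrow> real" and I :: "'i set"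
  defines "m \<equiv> (\<lambda>y. SUP i\<in>I. s y i)"
  assumes sd: "strict_deriv_along v I s s'"
    and A: "A = {i\<in>I. s 0 i = m 0}" "A \<noteq> {}"
    and near: "\<And>\<epsilon>. 0 < \<epsilon> \<Longrightarrow> \<exists>\<eta>>0. \<forall>i\<in>I. m 0 - \<eta> < s 0 i \<longrightarrow> (\<exists>a\<in>A. s' i - \<epsilon> < s' a)"
    and G: "\<forall>\<^sub>F y in nhds 0. G y = m y"
  shows "clarke_derivative G 0 v = (SUP a\<in>A. ereal (s' a))"
proof -
  let ?F = "nhds (0::'a) \<times>\<^sub>F at_right (0::real)"
  note s = strict_deriv_alongD[OF sd]
  have I: "I \<noteq> {}" using A by auto
  have "\<forall>\<^sub>F y in nhds 0. bdd_above (s y ` I)"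
    using uniform_limitD[OF s(3) zero_less_one]
  proof eventually_elim
    fix y assume y: "\<forall>i\<in>I. dist (s y i) (s 0 i) < 1"
    obtain B where B: "\<And>i. i \<in> I \<Longrightarrow> norm (s 0 i) \<le> B" using s(1) by (auto simp: bounded_iff)
    show "bdd_above (s y ` I)"
    proof (rule bdd_aboveI2)
      fix i assume "i \<in> I"
      with y B[of i] show "s y i \<le> B + 1" by (fastforce simp: dist_real_def)
    qed
  qed
  from eventually_base_and_moved[OF eventually_conj[OF this G], of v]
  have ev: "\<forall>\<^sub>F z in ?F. bdd_above (s (fst z) ` I) \<and> bdd_above (s (fst z + snd z *\<^sub>R v) ` I) \<and>
      G (fst z) = m (fst z) \<and> G (fst z + snd z *\<^sub>R v) = m (fst z + snd z *\<^sub>R v)"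
    by (auto elim: eventually_mono)
  have bdd0: "bdd_above (s 0 ` I)"
    using s(1) by (rule bounded_imp_bdd_above)
  have bddA: "bdd_above (s' ` A)"
    using bounded_imp_bdd_above[OF s(2)] by (rule bdd_above_mono) (auto simp: A)
  define S where "S = (SUP a\<in>A. s' a)"
  have S: "s' a \<le> S" if "a \<in> A" for a
    unfolding S_def by (rule cSUP_upper[OF that bddA])
  have le: "clarke_derivative G 0 v \<le> ereal (S + 3 * \<epsilon>)" if e: "0 < \<epsilon>" for \<epsilon>
    unfolding clarke_derivative_def
  proof (rule Limsup_bounded)
    \<comment> \<open>\<open>\<eta>\<close> is spent in four quarters: the change of \<open>m\<close>, the change of \<open>s i\<close>, and the error \<open>t * \<epsilon>\<close> made
      in the choice of \<open>i\<close> use three of them.\<close>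
    obtain \<eta> where eta: "0 < \<eta>" "\<And>i. i \<in> I \<Longrightarrow> m 0 - \<eta> < s 0 i \<Longrightarrow> \<exists>a\<in>A. s' i - \<epsilon> < s' a"
      using near[OF e] by blast
    have eta4: "0 < \<eta>/4" "0 < \<eta>/4/\<epsilon>" using eta e by simp_all
    show "\<forall>\<^sub>F z in ?F. (case z of (y, t) \<Rightarrow> ereal ((G (y + t *\<^sub>R v) - G y) / t)) \<le> ereal (S + 3 * \<epsilon>)"
      using ev eventually_step_pos[OF eta4(2)] uniform_limitD[OF s(4) e]
        uniform_limitD[OF strict_deriv_along_base(2)[OF sd] eta4(1)]
    proof eventually_elim
      fix z :: "'a \<times> real"
      assume ev: "bdd_above (s (fst z) ` I) \<and> bdd_above (s (fst z + snd z *\<^sub>R v) ` I) \<and>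
          G (fst z) = m (fst z) \<and> G (fst z + snd z *\<^sub>R v) = m (fst z + snd z *\<^sub>R v)"
        and t: "0 < snd z \<and> snd z < \<eta>/4/\<epsilon>"
        and q: "\<forall>i\<in>I. dist ((s (fst z + snd z *\<^sub>R v) i - s (fst z) i) /\<^sub>R snd z) (s' i) < \<epsilon>"
        and c: "\<forall>i\<in>I. dist (s (fst z + snd z *\<^sub>R v) i) (s 0 i) < \<eta>/4"
      let ?y = "fst z" and ?t = "snd z" and ?w = "fst z + snd z *\<^sub>R v"
      have te: "0 < ?t * \<epsilon>" "?t * \<epsilon> < \<eta>/4" using t e by (auto simp: field_simps)
      have "\<exists>i\<in>I. m ?w - ?t * \<epsilon> < s ?w i"
        using less_cSUP_iff[OF I, of "s ?w" "m ?w - ?t * \<epsilon>"] ev te by (simp add: m_def)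
      then obtain i where i: "i \<in> I" "m ?w - ?t * \<epsilon> < s ?w i" by blast
      have "m 0 - \<eta>/4 \<le> m ?w"
      proof -
        have "s 0 j \<le> m ?w + \<eta>/4" if "j \<in> I" for j
        proof -
          have "s ?w j \<le> m ?w" unfolding m_def using ev that by (intro cSUP_upper) auto
          then show ?thesis using c[rule_format, OF that] unfolding dist_real_def by linarith
        qed
        then have "m 0 \<le> m ?w + \<eta>/4" unfolding m_def by (intro cSUP_least I)
        then show ?thesis by simp
      qed
      then have "m 0 - \<eta> < s 0 i"
        using i(2) te(2) eta(1) c[rule_format, OF i(1)] unfolding dist_real_def by linarith
      then obtain a where "a \<in> A" "s' i - \<epsilon> < s' a" using eta(2) i(1) by blast
      then have si: "s' i < S + \<epsilon>" using S[of a] by simp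
      have qi: "(s ?w i - s ?y i) / ?t < S + 2 * \<epsilon>"
        using q[rule_format, OF i(1)] si by (simp add: dist_real_def abs_less_iff divide_inverse mult.commute)
      have "s ?y i \<le> m ?y" unfolding m_def using ev i(1) by (intro cSUP_upper) auto
      then have "m ?w - m ?y \<le> (s ?w i - s ?y i) + ?t * \<epsilon>" using i(2) by simp
      then have "(m ?w - m ?y) / ?t \<le> ((s ?w i - s ?y i) + ?t * \<epsilon>) / ?t"
        using t by (intro divide_right_mono) auto
      also have "\<dots> = (s ?w i - s ?y i) / ?t + \<epsilon>" using t by (simp add: field_simps)
      finally have "(G ?w - G ?y) / ?t \<le> S + 3 * \<epsilon>" using qi ev by simp
      then show "(case z of (y, t) \<Rightarrow> ereal ((G (y + t *\<^sub>R v) - G y) / t)) \<le> ereal (S + 3 * \<epsilon>)"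
        by (simp add: case_prod_beta)
    qed
  qed
  have "clarke_derivative G 0 v \<le> ereal S"
  proof (rule ereal_le_epsilon2)
    fix e :: real assume "0 < e"
    then show "clarke_derivative G 0 v \<le> ereal S + ereal e" using le[of "e/3"] by simp
  qed
  also have "ereal S \<le> (SUP a\<in>A. ereal (s' a))"
  proof -
    obtain a0 where a0: "a0 \<in> A" using A by blast
    show ?thesis
    proof (cases "SUP a\<in>A. ereal (s' a)")
      case (real c)
      have "s' a \<le> c" if "a \<in> A" for a
        using SUP_upper[OF that, of "\<lambda>a. ereal (s' a)"] real by simp
      then show ?thesis unfolding real S_def using A(2) by (simp add: cSUP_least)
    next
      case MInf
      then show ?thesis using SUP_upper[OF a0, of "\<lambda>a. ereal (s' a)"] by simp
    qed simp
  qed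
  moreover have "(SUP a\<in>A. ereal (s' a)) \<le> clarke_derivative G 0 v"
  proof (rule SUP_least, rule ccontr)
    fix a assume a: "a \<in> A" and "\<not> ereal (s' a) \<le> clarke_derivative G 0 v"
    then obtain c where c: "clarke_derivative G 0 v < ereal c" "c < s' a"
      using ereal_dense2[of "clarke_derivative G 0 v" "ereal (s' a)"] by (auto simp: not_le)
    have "\<forall>\<^sub>F z in ?F. (case z of (y, t) \<Rightarrow> ereal ((G (y + t *\<^sub>R v) - G y) / t)) < ereal c"
      using c(1) unfolding clarke_derivative_def by (rule Limsup_lessD)
    with ev eventually_step_pos[OF zero_less_one] uniform_limitD[OF s(4), of "s' a - c"] c(2)
    have "\<forall>\<^sub>F z in ?F. (case z of (y, t) \<Rightarrow> ereal ((G (y + t *\<^sub>R v) - G y) / t)) < ereal c \<and>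
       (bdd_above (s (fst z + snd z *\<^sub>R v) ` I) \<and>
        G (fst z) = m (fst z) \<and> G (fst z + snd z *\<^sub>R v) = m (fst z + snd z *\<^sub>R v)) \<and> 0 < snd z \<and>
       (\<forall>i\<in>I. dist ((s (fst z + snd z *\<^sub>R v) i - s (fst z) i) /\<^sub>R snd z) (s' i) < s' a - c)"
      by (auto simp: eventually_conj_iff elim: eventually_mono)
    then obtain P Q where PQ: "\<forall>\<^sub>F y in nhds 0. P y" "\<forall>\<^sub>F t in at_right 0. Q t"
      and imp: "\<And>y t. P y \<Longrightarrow> Q t \<Longrightarrow> (G (y + t *\<^sub>R v) - G y) / t < c \<and>
         (bdd_above (s (y + t *\<^sub>R v) ` I) \<and> G y = m y \<and> G (y + t *\<^sub>R v) = m (y + t *\<^sub>R v)) \<and> 0 < t \<and>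
         (\<forall>i\<in>I. dist ((s (y + t *\<^sub>R v) i - s y i) /\<^sub>R t) (s' i) < s' a - c)"
      unfolding eventually_prod_filter by fastforce
    obtain t where "Q t" using eventually_happens[OF PQ(2)] by auto
    from imp[OF eventually_nhds_x_imp_x[OF PQ(1)] this]
    have t: "(m (t *\<^sub>R v) - m 0) / t < c" "bdd_above (s (t *\<^sub>R v) ` I)" "0 < t"
      "dist ((s (t *\<^sub>R v) a - s 0 a) /\<^sub>R t) (s' a) < s' a - c"
      using a A by auto
    have "s (t *\<^sub>R v) a \<le> m (t *\<^sub>R v)" unfolding m_def using t(2) a A by (intro cSUP_upper) auto
    then have "(s (t *\<^sub>R v) a - s 0 a) / t \<le> (m (t *\<^sub>R v) - m 0) / t"
      using a A t(3) by (intro divide_right_mono) auto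
    then show False
      using t(1,4) by (simp add: dist_real_def abs_less_iff divide_inverse mult.commute)
  qed
  ultimately show ?thesis by (metis antisym order_trans)
qed

text \<open>By the derivative formula the subgradient is the set of vectors bounded by the support function of the
  gradients \<open>\<zeta> a\<close> of the active functions.\<close>

theorem clarke_subgradient_SUP:
  fixes s :: "'h::{real_inner,complete_space} \<Rightarrow> 'i \<Rightarrow> real"
  assumes sd: "\<And>v. strict_deriv_along v I s (s' v)"
    and A: "A = {i\<in>I. s 0 i = (SUP j\<in>I. s 0 j)}" "A \<noteq> {}"
    and near: "\<And>v \<epsilon>. 0 < \<epsilon> \<Longrightarrow>
      \<exists>\<eta>>0. \<forall>i\<in>I. (SUP j\<in>I. s 0 j) - \<eta> < s 0 i \<longrightarrow> (\<exists>a\<in>A. s' v i - \<epsilon> < s' v a)"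
    and G: "\<forall>\<^sub>F y in nhds 0. G y = (SUP i\<in>I. s y i)"
    and \<zeta>: "\<And>a v. a \<in> A \<Longrightarrow> \<zeta> a \<bullet> v = s' v a"
  shows "closure (convex hull (\<zeta> ` A)) = {h. blinfun_inner_left h \<in> clarke_subgradient G 0}"
proof -
  have "clarke_derivative G 0 v = (SUP z\<in>\<zeta> ` A. ereal (z \<bullet> v))" for v
  proof -
    have "clarke_derivative G 0 v = (SUP a\<in>A. ereal (s' v a))"
      by (rule clarke_derivative_SUP[OF sd A near G])
    then show ?thesis using \<zeta> by (simp add: image_image)
  qed
  then show ?thesis
    using closure_convex_hull_iff_support[of "\<zeta> ` A"] A(2)
    by (auto simp: clarke_subgradient_def inner_commute)
qed

section \<open>Perturbation fields and perturbed identities\<close>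

lemma norm_matrix_vector_mult_le:
  fixes A :: "real^'n^'m"
  shows "norm (A *v x) \<le> norm A * norm x"
proof -
  have "norm (A *v x) = L2_set (\<lambda>i. \<bar>A $ i \<bullet> x\<bar>) UNIV"
    by (simp add: norm_vec_def matrix_vector_mult_def inner_vec_def)
  also have "\<dots> \<le> L2_set (\<lambda>i. norm (A $ i) * norm x) UNIV"
    by (intro L2_set_mono Cauchy_Schwarz_ineq2) auto
  also have "\<dots> = norm A * norm x"
    unfolding norm_vec_def[of A] by (simp add: L2_set_left_distrib)
  finally show ?thesis .
qed

lemma bounded_bilinear_matrix_mult:
  "bounded_bilinear ((**) :: real^'n^'m \<Rightarrow> real^'k^'n \<Rightarrow> real^'k^'m)"
  unfolding bilinear_conv_bounded_bilinear[symmetric] bilinear_def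
  by (intro conjI allI linearI)
    (simp_all add: matrix_matrix_mult_def vec_eq_iff sum.distrib distrib_left distrib_right
       sum_distrib_left mult.assoc mult.left_commute)

lemma bounded_linear_if_isCont_0:
  fixes f :: "'a::real_normed_vector \<Rightarrow> 'b::real_normed_vector"
  assumes "linear f" "isCont f 0"
  shows "bounded_linear f"
proof -
  interpret linear f by fact
  obtain d where d: "0 < d" "\<And>x. norm x < d \<Longrightarrow> norm (f x) < 1"
  proof -
    have "\<exists>d>0. \<forall>x. dist x 0 < d \<longrightarrow> dist (f x) (f 0) < 1"
      using assms(2)[unfolded continuous_at_eps_delta, rule_format, OF zero_less_one] .
    then show ?thesis using that by (auto simp: zero)
  qed
  have "norm (f x) \<le> norm x * (2 / d)" for x
  proof (cases "x = 0")
    case True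
    then show ?thesis by (simp add: zero)
  next
    case False
    have "norm (f ((d / 2 / norm x) *\<^sub>R x)) < 1"
      using d(1) False by (intro d(2)) simp
    then show ?thesis using d(1) False by (simp add: scale field_simps)
  qed
  then show ?thesis
    by (intro bounded_linear_intro[of f "2 / d"] add scale)
qed

lemma admissible_field_props:
  fixes X :: "real^'n::finite \<Rightarrow> real^'n"
  assumes X: "X \<in> admissible_fields D \<omega>"
  shows field_has_derivative: "(X has_derivative (\<lambda>h. field_jac X x *v h)) (at x)"
    and continuous_field_jac: "continuous_on S (field_jac X)"
    and field_outside: "x \<notin> D \<Longrightarrow> X x = 0"
    and field_jac_outside: "x \<notin> D \<Longrightarrow> field_jac X x = 0"
    and field_on_omega: "x \<in> \<omega> \<Longrightarrow> X x = 0"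
proof -
  have d: "X differentiable (at x)" for x
    using X by (simp add: admissible_fields_def differentiable_on_def)
  then show der: "(X has_derivative (\<lambda>h. field_jac X x *v h)) (at x)" for x
    by (simp add: field_jac_def jacobian_works)
  have pd: "continuous_on UNIV (pd i X)" for i
    using X by (simp add: admissible_fields_def)
  have "field_jac X = (\<lambda>x. \<chi> i j. pd j X x $ i)"
    by (simp add: field_jac_def jacobian_def matrix_def pd_def fun_eq_iff)
  moreover have "continuous_on UNIV (\<lambda>x. \<chi> i j. pd j X x $ i)"
    by (intro continuous_intros pd)
  ultimately show "continuous_on S (field_jac X)"
    by (metis continuous_on_subset subset_UNIV)
  have out: "X x = 0" if "x \<notin> closure {x. X x \<noteq> 0}" for x
    using that closure_subset[of "{x. X x \<noteq> 0}"] by auto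
  have supp: "closure {x. X x \<noteq> 0} \<subseteq> D - closure \<omega>"
    using X by (simp add: admissible_fields_def)
  then show "x \<notin> D \<Longrightarrow> X x = 0" using out[of x] by auto
  show "x \<in> \<omega> \<Longrightarrow> X x = 0" using supp out[of x] closure_subset[of \<omega>] by auto
  show "field_jac X x = 0" if "x \<notin> D"
  proof -
    let ?C = "- closure {x. X x \<noteq> 0}"
    have "(X has_derivative (\<lambda>h. 0)) (at x)"
    proof (rule has_derivative_transform_within_open[OF has_derivative_const, where s = ?C])
      show "open ?C" by (intro open_Compl closed_closure)
      show "x \<in> ?C" using that supp by auto
      show "\<And>y. y \<in> ?C \<Longrightarrow> 0 = X y" by (rule out[symmetric]) simp
    qed
    then have "(\<lambda>h. field_jac X x *v h) = (\<lambda>h. 0)"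
      by (rule has_derivative_unique[OF der])
    then have "field_jac X x *v h = 0 *v h" for h
      using fun_cong[of "\<lambda>h. field_jac X x *v h" "\<lambda>h. 0" h] by simp
    then show ?thesis unfolding matrix_eq by simp
  qed
qed

lemma admissible_field_bounds:
  fixes X :: "real^'n::finite \<Rightarrow> real^'n"
  assumes X: "X \<in> admissible_fields D \<omega>" and D: "bounded D" "D \<noteq> {}"
  shows bounded_field_jac: "bounded (field_jac X ` S)"
    and norm_field_jac_le: "norm (field_jac X x) \<le> field_norm D X"
proof -
  have cont: "continuous_on (closure D) X"
    by (intro continuous_at_imp_continuous_on ballI has_derivative_continuous[OF field_has_derivative[OF X]])
  have comp: "compact (closure D)" using D by simp
  have b1: "bounded (X ` closure D)" "bounded (field_jac X ` closure D)"
    by (intro compact_imp_bounded compact_continuous_image cont continuous_field_jac[OF X] comp)+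
  then have b2: "bdd_above ((\<lambda>x. norm (X x)) ` closure D)"
    "bdd_above ((\<lambda>x. norm (field_jac X x)) ` closure D)"
    by (auto simp: bounded_iff bdd_above_def)
  obtain x0 where x0: "x0 \<in> closure D" using D closure_subset by blast
  have u1: "norm (X x) \<le> (SUP x\<in>closure D. norm (X x))" if "x \<in> closure D" for x
    using cSUP_upper[OF that b2(1)] .
  have u2: "norm (field_jac X x) \<le> (SUP x\<in>closure D. norm (field_jac X x))" if "x \<in> closure D" for x
    using cSUP_upper[OF that b2(2)] .
  have n: "0 \<le> (SUP x\<in>closure D. norm (X x))" "0 \<le> (SUP x\<in>closure D. norm (field_jac X x))"
    using u1[OF x0] u2[OF x0] norm_ge_zero order_trans by blast+
  have jac: "norm (field_jac X x) \<le> (SUP x\<in>closure D. norm (field_jac X x))" for x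
    using u2[of x] field_jac_outside[OF X, of x] n closure_subset by (cases "x \<in> D") auto
  then show "norm (field_jac X x) \<le> field_norm D X"
    using n(1) jac[of x] unfolding field_norm_def by linarith
  show "bounded (field_jac X ` S)" using jac by (auto simp: bounded_iff)
qed

lemma admissible_field_lipschitz:
  fixes X :: "real^'n::finite \<Rightarrow> real^'n"
  assumes X: "X \<in> admissible_fields D \<omega>" and B: "\<And>x. norm (field_jac X x) \<le> B"
  shows "norm (X a - X b) \<le> B * norm (a - b)"
proof (rule differentiable_bound[OF convex_UNIV])
  show "(X has_derivative (\<lambda>h. field_jac X x *v h)) (at x within UNIV)" for x
    using field_has_derivative[OF X] by simp
  show "onorm (\<lambda>h. field_jac X x *v h) \<le> B" for x
  proof (rule onorm_bound)
    show "0 \<le> B" using B[of x] norm_ge_zero[of "field_jac X x"] by linarith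
    show "norm (field_jac X x *v h) \<le> B * norm h" for h
      using mult_right_mono[OF B[of x], of "norm h"] norm_matrix_vector_mult_le[of "field_jac X x" h]
      by simp
  qed
qed auto

text \<open>Only the gradient has to be controlled: the fields vanish outside the bounded set \<open>D\<close>, so the
  mean value theorem bounds their values by their gradients.\<close>

lemma field_norm_le_gradient:
  fixes D :: "(real^'n::finite) set"
  assumes D: "bounded D" "D \<noteq> {}"
  obtains c where "0 \<le> c"
    "\<And>X B \<omega>. X \<in> admissible_fields D \<omega> \<Longrightarrow> (\<And>x. x \<in> closure D \<Longrightarrow> norm (field_jac X x) \<le> B) \<Longrightarrow>
       field_norm D X \<le> c * B"
proof -
  obtain R where R: "0 < R" "\<And>x. x \<in> D \<Longrightarrow> norm x \<le> R"
    using D(1) by (auto simp: bounded_pos)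
  obtain p :: "real^'n" where p: "norm p = R + 1" using R(1) vector_choose_size[of "R + 1"] by auto
  have pD: "p \<notin> D" using R(2)[of p] p by auto
  have ne: "closure D \<noteq> {}" using D by simp
  show ?thesis
  proof (rule that[of "2 * R + 2"])
    show "0 \<le> 2 * R + 2" using R by simp
    fix X :: "real^'n \<Rightarrow> real^'n" and B \<omega>
    assume X: "X \<in> admissible_fields D \<omega>" and B: "\<And>x. x \<in> closure D \<Longrightarrow> norm (field_jac X x) \<le> B"
    have B0: "0 \<le> B" using B ne norm_ge_zero order_trans by (metis ex_in_conv)
    have Ball: "norm (field_jac X x) \<le> B" for x
      using B[of x] B0 field_jac_outside[OF X, of x] closure_subset by (cases "x \<in> D") auto
    have "norm (X x) \<le> (2 * R + 1) * B" for x
    proof (cases "x \<in> D")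
      case True
      have "norm (X x) = norm (X x - X p)" using field_outside[OF X pD] by simp
      also have "\<dots> \<le> B * norm (x - p)" by (rule admissible_field_lipschitz[OF X Ball])
      also have "\<dots> \<le> B * (2 * R + 1)"
        using B0 R(2)[OF True] p norm_triangle_ineq4[of x p] by (intro mult_left_mono) auto
      finally show ?thesis by (simp add: mult.commute)
    next
      case False
      then show ?thesis using field_outside[OF X] B0 R by simp
    qed
    then have "(SUP x\<in>closure D. norm (X x)) \<le> (2 * R + 1) * B"
      by (intro cSUP_least ne)
    moreover have "(SUP x\<in>closure D. norm (field_jac X x)) \<le> B"
      by (intro cSUP_least ne B)
    ultimately show "field_norm D X \<le> (2 * R + 2) * B"
      by (simp add: field_norm_def algebra_simps)
  qed
qed

lemma field_jac_linear_combination: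
  fixes X Y :: "real^'n::finite \<Rightarrow> real^'n"
  assumes X: "X \<in> admissible_fields D \<omega>" and Y: "Y \<in> admissible_fields D \<omega>"
  shows "field_jac (\<lambda>x. Y x + t *\<^sub>R X x) x = field_jac Y x + t *\<^sub>R field_jac X x"
proof -
  have "((\<lambda>x. Y x + t *\<^sub>R X x) has_derivative (\<lambda>h. field_jac Y x *v h + t *\<^sub>R (field_jac X x *v h))) (at x)"
    by (intro derivative_intros field_has_derivative[OF X] field_has_derivative[OF Y])
  then have *: "frechet_derivative (\<lambda>x. Y x + t *\<^sub>R X x) (at x) =
      (\<lambda>h. field_jac Y x *v h + t *\<^sub>R (field_jac X x *v h))"
    by (rule frechet_derivative_at[symmetric])
  have "field_jac (\<lambda>x. Y x + t *\<^sub>R X x) x *v h = (field_jac Y x + t *\<^sub>R field_jac X x) *v h" for h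
    unfolding field_jac_def[of "\<lambda>x. Y x + t *\<^sub>R X x"] jacobian_def *
    by (subst matrix_works)
      (auto intro!: linear_compose_add linear_compose_scale_right
        simp: linear_matrix_vector_mul_eq matrix_vector_mult_add_rdistrib scaleR_matrix_vector_assoc)
  then show ?thesis by (simp add: matrix_eq)
qed

locale field_space =
  fixes D \<omega> :: "(real^'n::finite) set" and E :: "'h::{real_inner,complete_space} \<Rightarrow> real^'n \<Rightarrow> real^'n"
  assumes hilbert: "hilbert_space_of_fields D \<omega> E" and bounded_D: "bounded D" and D_nonempty: "D \<noteq> {}"
begin

lemma E_admissible: "E h \<in> admissible_fields D \<omega>"
  using hilbert by (auto simp: hilbert_space_of_fields_def)

lemma E_linear: "linear (\<lambda>h. E h x)"
  using hilbert by (simp add: hilbert_space_of_fields_def)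

lemma E_add_scaleR: "E (y + t *\<^sub>R v) = (\<lambda>x. E y x + t *\<^sub>R E v x)"
  by (simp add: fun_eq_iff linear_add[OF E_linear] linear_scale[OF E_linear])

lemma E_0: "E 0 = (\<lambda>x. 0)"
  by (simp add: fun_eq_iff linear_0[OF E_linear])

lemma E_scaleR: "E (t *\<^sub>R v) = scale_field t (E v)"
  by (simp add: fun_eq_iff linear_scale[OF E_linear])

lemma jac_add_scaleR: "field_jac (E (y + t *\<^sub>R v)) x = field_jac (E y) x + t *\<^sub>R field_jac (E v) x"
  unfolding E_add_scaleR by (rule field_jac_linear_combination[OF E_admissible E_admissible])

lemma jac_0: "field_jac (E 0) x = 0"
  using jac_add_scaleR[of 0 1 0 x] by simp

lemma linear_jac: "linear (\<lambda>h. field_jac (E h) x)"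
proof (rule linearI)
  show "field_jac (E (a + b)) x = field_jac (E a) x + field_jac (E b) x" for a b
    using jac_add_scaleR[of a 1 b x] by simp
  show "field_jac (E (r *\<^sub>R a)) x = r *\<^sub>R field_jac (E a) x" for r a
    using jac_add_scaleR[of 0 r a x] by (simp add: jac_0)
qed

text \<open>Gradient evaluation is only assumed to be continuous point by point; the uniform boundedness
  principle turns this into an embedding of the Hilbert space into \<open>C\<^sup>1\<close>.\<close>

lemma field_norm_bound:
  obtains C where "0 \<le> C" "\<And>h. field_norm D (E h) \<le> C * norm h"
proof -
  have "bounded_linear (\<lambda>h. field_jac (E h) x)" if "x \<in> closure D" for x
  proof (rule bounded_linear_if_isCont_0[OF linear_jac])
    show "isCont (\<lambda>h. field_jac (E h) x) 0"
      using hilbert that by (auto simp: hilbert_space_of_fields_def continuous_on_eq_continuous_at)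
  qed
  then obtain C where C: "0 \<le> C" "\<And>x h. x \<in> closure D \<Longrightarrow> norm (field_jac (E h) x) \<le> C * norm h"
    using uniform_boundedness[of "closure D" "\<lambda>x h. field_jac (E h) x"]
      bounded_field_jac[OF E_admissible bounded_D D_nonempty] by blast
  obtain c where "0 \<le> c" "\<And>h B. (\<And>x. x \<in> closure D \<Longrightarrow> norm (field_jac (E h) x) \<le> B) \<Longrightarrow>
       field_norm D (E h) \<le> c * B"
    using field_norm_le_gradient[OF bounded_D D_nonempty] E_admissible by metis
  then show ?thesis using that[of "c * C"] C by (simp add: mult.assoc)
qed

lemma eventually_field_norm_less:
  assumes "0 < e" shows "\<forall>\<^sub>F y in nhds 0. field_norm D (E y) < e"
proof -
  obtain C where C: "0 \<le> C" "\<And>h. field_norm D (E h) \<le> C * norm h"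
    using field_norm_bound by blast
  have "((\<lambda>y::'h. C * norm y) \<longlongrightarrow> C * norm (0::'h)) (nhds 0)"
    by (intro tendsto_intros filterlim_ident)
  then have "\<forall>\<^sub>F y::'h in nhds 0. C * norm y < e"
    using assms by (intro order_tendstoD(2)) auto
  then show ?thesis by eventually_elim (use C(2) le_less_trans in blast)
qed

text \<open>\<open>y \<mapsto> field_jac (E y)\<close> is linear, so its difference quotients do not even depend on \<open>y\<close> and \<open>t\<close>;
  only boundedness with respect to the norm is at stake.\<close>

lemma strict_deriv_along_field_jac:
  "strict_deriv_along v S (\<lambda>y. field_jac (E y)) (field_jac (E v))"
proof (rule strict_deriv_alongI)
  show "bounded (field_jac (E 0) ` S)" "bounded (field_jac (E v) ` S)"
    by (rule bounded_field_jac[OF E_admissible bounded_D D_nonempty])+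
  show "uniform_limit S (\<lambda>y. field_jac (E y)) (field_jac (E 0)) (nhds 0)"
  proof (rule uniform_limitI)
    fix e :: real assume "0 < e"
    from eventually_field_norm_less[OF this]
    show "\<forall>\<^sub>F y in nhds 0. \<forall>x\<in>S. dist (field_jac (E y) x) (field_jac (E 0) x) < e"
      by eventually_elim
        (auto simp: jac_0 intro: le_less_trans[OF norm_field_jac_le[OF E_admissible bounded_D D_nonempty]])
  qed
  show "uniform_limit S (\<lambda>z x. (field_jac (E (fst z + snd z *\<^sub>R v)) x - field_jac (E (fst z)) x) /\<^sub>R snd z)
     (field_jac (E v)) (nhds 0 \<times>\<^sub>F at_right 0)"
    using uniform_limit_const
    by (rule uniform_limit_eventually_cong)
      (use eventually_step_pos[OF zero_less_one] in \<open>auto simp: jac_add_scaleR elim: eventually_mono\<close>)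
qed

end

text \<open>A field of \<open>C\<^sup>1\<close> norm at most \<open>1/2\<close> is a contraction. Hence \<open>id + X\<close> is injective, shrinks distances by a
  factor of at most \<open>2\<close>, and has invertible Jacobians; being open by invariance of domain, it commutes with
  interior and, on bounded sets, with closure.\<close>

locale small_field =
  fixes D \<omega> :: "(real^'n::finite) set" and X :: "real^'n \<Rightarrow> real^'n"
  assumes X: "X \<in> admissible_fields D \<omega>" and bounded_D: "bounded D" and D_nonempty: "D \<noteq> {}"
    and small: "field_norm D X \<le> 1/2"
begin

abbreviation "F \<equiv> deform X"
abbreviation "DF x \<equiv> mat 1 + field_jac X x"

lemma jac_small: "norm (field_jac X x) \<le> 1/2"
  using norm_field_jac_le[OF X bounded_D D_nonempty] small order_trans by blast

lemma deform_has_derivative: "(F has_derivative (\<lambda>h. DF x *v h)) (at x)"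
proof -
  have "((\<lambda>x. x + X x) has_derivative (\<lambda>h. h + field_jac X x *v h)) (at x)"
    by (intro derivative_intros field_has_derivative[OF X])
  then show ?thesis
    by (simp add: deform_def[abs_def] matrix_vector_mult_add_rdistrib)
qed

lemma deform_expands: "norm (a - b) \<le> 2 * norm (F a - F b)"
proof -
  have "norm (X a - X b) \<le> 1/2 * norm (a - b)"
    by (rule admissible_field_lipschitz[OF X jac_small])
  moreover have "norm (a - b) \<le> norm (F a - F b) + norm (X a - X b)"
    using norm_triangle_ineq4[of "F a - F b" "X a - X b"] by (simp add: deform_def)
  ultimately show ?thesis by simp
qed

lemma inj_deform: "inj_on F S"
proof (rule inj_onI)
  fix a b assume "F a = F b"
  then show "a = b" using deform_expands[of a b] by simp
qed

lemma continuous_deform: "continuous_on S F"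
  by (intro continuous_at_imp_continuous_on ballI has_derivative_continuous[OF deform_has_derivative])

lemma open_deform: "open S \<Longrightarrow> open (F ` S)"
  by (rule invariance_of_domain[OF continuous_deform _ inj_deform])

definition "Finv = inv_into UNIV F"

lemma Finv_deform [simp]: "Finv (F x) = x"
  using inj_deform by (simp add: Finv_def)

lemma continuous_Finv: "continuous_on (range F) Finv"
proof (rule continuous_on_iff[THEN iffD2], intro ballI allI impI)
  fix y e assume y: "y \<in> range F" and e: "(0::real) < e"
  show "\<exists>d>0. \<forall>y'\<in>range F. dist y' y < d \<longrightarrow> dist (Finv y') (Finv y) < e"
  proof (intro exI[of _ "e/2"] conjI ballI impI)
    fix y' assume "y' \<in> range F" "dist y' y < e/2"
    with y show "dist (Finv y') (Finv y) < e"
      by (auto simp: dist_norm intro: le_less_trans[OF deform_expands])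
  qed (use e in simp)
qed

lemma interior_deform_image: "interior (F ` S) = F ` interior S"
proof
  show "F ` interior S \<subseteq> interior (F ` S)"
    by (intro interior_maximal image_mono interior_subset open_deform open_interior)
  have "open (F -` interior (F ` S))"
    using continuous_deform[of UNIV] by (intro open_vimage) auto
  moreover have "F -` interior (F ` S) \<subseteq> S"
    using interior_subset[of "F ` S"] inj_deform[of UNIV] by (auto dest: injD)
  ultimately have *: "F -` interior (F ` S) \<subseteq> interior S" by (intro interior_maximal)
  show "interior (F ` S) \<subseteq> F ` interior S"
  proof
    fix y assume y: "y \<in> interior (F ` S)"
    then obtain x where "y = F x" using interior_subset by blast
    then show "y \<in> F ` interior S" using y * by blast
  qed
qed

lemma closure_deform_image:
  assumes "bounded S" shows "closure (F ` S) = F ` closure S"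
proof
  have "compact (F ` closure S)"
    using assms by (intro compact_continuous_image continuous_deform) simp
  then show "closure (F ` S) \<subseteq> F ` closure S"
    by (intro closure_minimal image_mono closure_subset compact_imp_closed)
  show "F ` closure S \<subseteq> closure (F ` S)"
    by (rule image_closure_subset[OF continuous_deform closed_closure closure_subset])
qed

lemma invertible_DF: "invertible (DF x)"
proof -
  have "\<forall>h. DF x *v h = 0 \<longrightarrow> h = 0"
  proof (intro allI impI)
    fix h assume "DF x *v h = 0"
    then have "norm h = norm (field_jac X x *v h)"
      by (metis add.commute matrix_vector_mul_lid matrix_vector_mult_add_rdistrib norm_minus_cancel
          add_eq_0_iff2 minus_minus)
    also have "\<dots> \<le> norm (field_jac X x) * norm h" by (rule norm_matrix_vector_mult_le)
    also have "\<dots> \<le> 1/2 * norm h" by (intro mult_right_mono jac_small) simp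
    finally show "h = 0" by simp
  qed
  then show ?thesis
    unfolding invertible_left_inverse matrix_left_invertible_ker .
qed

lemma deform_on_omega: "x \<in> \<omega> \<Longrightarrow> F x = x"
  using field_on_omega[OF X] by (simp add: deform_def)

lemma deform_diff_omega: "F ` S - \<omega> = F ` (S - \<omega>)"
proof -
  have "F ` \<omega> = \<omega>" using deform_on_omega by force
  then show ?thesis using image_set_diff[OF inj_deform[of UNIV], of S \<omega>] by simp
qed

lemma closure_deform_diff_omega:
  assumes "bounded S" shows "closure (F ` S - \<omega>) = F ` closure (S - \<omega>)"
  unfolding deform_diff_omega using assms by (intro closure_deform_image bounded_diff)

end

section \<open>Gradients of \<open>C\<^sup>1\<close> representatives\<close>

lemma AE_lebesgue_on_iff_negligible:
  assumes "S \<in> sets lebesgue"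
  shows "(AE x in lebesgue_on S. P x) \<longleftrightarrow> negligible {x \<in> S. \<not> P x}"
proof -
  have "(AE x in lebesgue_on S. P x) \<longleftrightarrow> (AE x in lebesgue. x \<in> S \<longrightarrow> P x)"
    using assms by (intro AE_restrict_space_iff) simp
  also have "\<dots> \<longleftrightarrow> (\<exists>N. negligible N \<and> {x. \<not> (x \<in> S \<longrightarrow> P x)} \<subseteq> N)"
    by (rule eventually_ae_filter_negligible)
  also have "{x. \<not> (x \<in> S \<longrightarrow> P x)} = {x \<in> S. \<not> P x}" by auto
  finally show ?thesis using negligible_subset by blast
qed

text \<open>This makes the choices in \<open>C1_val\<close> and \<open>C1_grad\<close> harmless. Two representatives differ on an open subset of
  the interior, which is null and therefore empty; derivatives and continuous extensions to the
  closure then agree as well.\<close>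

lemma C1_rep_unique:
  assumes 1: "C1_rep K v w M" and 2: "C1_rep K v w' M'" and x: "x \<in> closure (interior K)"
  shows "w x = w' x \<and> M x = M' x"
proof -
  let ?I = "interior K"
  note r1 = 1[unfolded C1_rep_def] and r2 = 2[unfolded C1_rep_def]
  have I: "?I \<in> sets lebesgue" by auto
  have wd: "w y = w' y" if y: "y \<in> ?I" for y
  proof (rule ccontr)
    assume ne: "w y \<noteq> w' y"
    let ?U = "{y \<in> ?I. w y - w' y \<in> - {0}}"
    have "continuous_on ?I (\<lambda>y. w y - w' y)"
      using r1 r2 closure_subset[of ?I] by (intro continuous_intros) (auto intro: continuous_on_subset)
    then have "open ?U"
      using continuous_open_preimage[of ?I "\<lambda>y. w y - w' y" "- {0}"] by (simp add: vimage_def Int_def open_Compl)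
    moreover have "negligible ?U"
    proof (rule negligible_subset)
      show "negligible ({y \<in> ?I. v y \<noteq> w y} \<union> {y \<in> ?I. v y \<noteq> w' y})"
        using r1 r2 by (intro negligible_Un) (auto simp: AE_lebesgue_on_iff_negligible[OF I])
    qed auto
    moreover have "y \<in> ?U" using ne y by auto
    ultimately show False using open_not_negligible by blast
  qed
  have Md: "M y = M' y" if y: "y \<in> ?I" for y
  proof -
    have "(w has_derivative (\<lambda>h. M y *v h)) (at y)" using r1 y by blast
    moreover have "(w has_derivative (\<lambda>h. M' y *v h)) (at y)"
    proof (rule has_derivative_transform_within_open[where f = w'])
      show "(w' has_derivative (\<lambda>h. M' y *v h)) (at y)" using r2 y by blast
    qed (use y wd in auto)
    ultimately have "(\<lambda>h. M y *v h) = (\<lambda>h. M' y *v h)" by (rule has_derivative_unique)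
    then show ?thesis unfolding matrix_eq by meson
  qed
  have "w x - w' x = 0"
    by (rule continuous_constant_on_closure[OF _ _ x])
      (use r1 r2 wd in \<open>auto intro!: continuous_intros\<close>)
  moreover have "M x - M' x = 0"
    by (rule continuous_constant_on_closure[OF _ _ x])
      (use r1 r2 Md in \<open>auto intro!: continuous_intros\<close>)
  ultimately show ?thesis by simp
qed

lemma C1_grad_eq:
  assumes "C1_rep K v w M" "x \<in> closure (interior K)"
  shows "C1_grad K v x = M x"
proof -
  have "\<exists>M w. C1_rep K v w M" using assms by blast
  then have "\<exists>w. C1_rep K v w (SOME M. \<exists>w. C1_rep K v w M)" by (rule someI_ex)
  then show ?thesis using C1_rep_unique[OF assms(1) _ assms(2)] assms(2) by (auto simp: C1_grad_def)
qed

lemma C1_val_eq: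
  assumes "C1_rep K v w M" "x \<in> closure (interior K)"
  shows "C1_val K v x = w x"
proof -
  have "\<exists>w M. C1_rep K v w M" using assms by blast
  then have "\<exists>M. C1_rep K v (SOME w. \<exists>M. C1_rep K v w M) M" by (rule someI_ex)
  then show ?thesis using C1_rep_unique[OF assms(1) _ assms(2)] assms(2) by (auto simp: C1_val_def)
qed

lemma C1_grad_outside: "x \<notin> closure (interior K) \<Longrightarrow> C1_grad K v x = 0"
  by (simp add: C1_grad_def)

lemma C1_rep_diff:
  assumes "C1_rep K v w M" "C1_rep K v' w' M'"
  shows "C1_rep K (\<lambda>x. v x - v' x) (\<lambda>x. w x - w' x) (\<lambda>x. M x - M' x)"
  using assms unfolding C1_rep_def
  by (auto intro!: continuous_intros derivative_eq_intros simp: matrix_vector_mult_diff_rdistrib)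

lemma C1_rep_scaleR:
  assumes "C1_rep K v w M"
  shows "C1_rep K (\<lambda>x. c *\<^sub>R v x) (\<lambda>x. c *\<^sub>R w x) (\<lambda>x. c *\<^sub>R M x)"
  using assms unfolding C1_rep_def
  by (auto intro!: continuous_intros derivative_eq_intros simp: scaleR_matrix_vector_assoc)

lemma
  assumes "in_C1 K v" "in_C1 K v'"
  shows in_C1_diff: "in_C1 K (\<lambda>x. v x - v' x)"
    and C1_grad_diff: "C1_grad K (\<lambda>x. v x - v' x) x = C1_grad K v x - C1_grad K v' x"
proof -
  obtain w M w' M' where r: "C1_rep K v w M" "C1_rep K v' w' M'"
    using assms by (auto simp: in_C1_def)
  show "in_C1 K (\<lambda>x. v x - v' x)" using C1_rep_diff[OF r] by (auto simp: in_C1_def)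
  show "C1_grad K (\<lambda>x. v x - v' x) x = C1_grad K v x - C1_grad K v' x"
  proof (cases "x \<in> closure (interior K)")
    case True
    then show ?thesis
      using C1_grad_eq[OF C1_rep_diff[OF r]] C1_grad_eq[OF r(1)] C1_grad_eq[OF r(2)] by simp
  qed (simp add: C1_grad_outside)
qed

lemma
  assumes "in_C1 K v"
  shows in_C1_scaleR: "in_C1 K (\<lambda>x. c *\<^sub>R v x)"
    and C1_grad_scaleR: "C1_grad K (\<lambda>x. c *\<^sub>R v x) x = c *\<^sub>R C1_grad K v x"
proof -
  obtain w M where r: "C1_rep K v w M" using assms by (auto simp: in_C1_def)
  show "in_C1 K (\<lambda>x. c *\<^sub>R v x)" using C1_rep_scaleR[OF r] by (auto simp: in_C1_def)
  show "C1_grad K (\<lambda>x. c *\<^sub>R v x) x = c *\<^sub>R C1_grad K v x"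
  proof (cases "x \<in> closure (interior K)")
    case True
    then show ?thesis using C1_grad_eq[OF C1_rep_scaleR[OF r]] C1_grad_eq[OF r] by simp
  qed (simp add: C1_grad_outside)
qed

lemma continuous_C1_grad:
  assumes "in_C1 K v" shows "continuous_on (closure (interior K)) (C1_grad K v)"
proof -
  obtain w M where r: "C1_rep K v w M" using assms by (auto simp: in_C1_def)
  then have "continuous_on (closure (interior K)) M" by (simp add: C1_rep_def)
  then show ?thesis by (rule continuous_on_eq) (simp add: C1_grad_eq[OF r])
qed

lemma bounded_image_zero_outside:
  fixes f :: "'a::heine_borel \<Rightarrow> 'b::real_normed_vector"
  assumes "bounded C" "closed C" "continuous_on C f" "\<And>x. x \<notin> C \<Longrightarrow> f x = 0"
  shows "bounded (f ` S)"
proof -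
  have "bounded (f ` C)"
    using assms by (intro compact_imp_bounded compact_continuous_image) (auto simp: compact_eq_bounded_closed)
  moreover have "f ` S \<subseteq> insert 0 (f ` C)" using assms(4) by blast
  ultimately show ?thesis using bounded_insert bounded_subset by blast
qed

lemma bounded_C1_grad:
  assumes "in_C1 K v" "bounded K" shows "bounded (C1_grad K v ` S)"
  using assms bounded_subset[OF assms(2) interior_subset]
  by (intro bounded_image_zero_outside[of "closure (interior K)"])
    (auto simp: C1_grad_outside intro: continuous_C1_grad)

lemma norm_C1_grad_le_C1_norm:
  assumes "in_C1 K v" "bounded K" "x \<in> K"
  shows "norm (C1_grad K v x) \<le> C1_norm K v"
proof -
  obtain w M where r: "C1_rep K v w M" using assms by (auto simp: in_C1_def)
  have "continuous_on (closure (interior K)) w" using r by (simp add: C1_rep_def)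
  then have "continuous_on (closure (interior K)) (C1_val K v)"
    by (rule continuous_on_eq) (simp add: C1_val_eq[OF r])
  then have "bounded (C1_val K v ` K)"
    using bounded_subset[OF assms(2) interior_subset]
    by (intro bounded_image_zero_outside[of "closure (interior K)"]) (auto simp: C1_val_def)
  then have "bdd_above ((\<lambda>x. norm (C1_val K v x)) ` K)" by (auto simp: bounded_iff bdd_above_def)
  from cSUP_upper[OF assms(3) this] have "0 \<le> (SUP x\<in>K. norm (C1_val K v x))"
    using norm_ge_zero order_trans by blast
  moreover have "bdd_above ((\<lambda>x. norm (C1_grad K v x)) ` K)"
    using bounded_C1_grad[OF assms(1,2), of K] by (auto simp: bounded_iff bdd_above_def)
  from cSUP_upper[OF assms(3) this] have "norm (C1_grad K v x) \<le> (SUP x\<in>K. norm (C1_grad K v x))" .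
  ultimately show ?thesis unfolding C1_norm_def by linarith
qed

lemma matrix_inv_inverse:
  assumes "invertible A"
  shows "A ** matrix_inv A = mat 1" "matrix_inv A ** A = mat 1"
proof -
  have "\<exists>A'. A ** A' = mat 1 \<and> A' ** A = mat 1" using assms by (simp add: invertible_def)
  from someI_ex[OF this] show "A ** matrix_inv A = mat 1" "matrix_inv A ** A = mat 1"
    by (simp_all add: matrix_inv_def)
qed

lemma continuous_on_matrix_mult [continuous_intros]:
  fixes A :: "'a::topological_space \<Rightarrow> real^'n^'m" and B :: "'a \<Rightarrow> real^'k^'n"
  assumes "continuous_on S A" "continuous_on S B"
  shows "continuous_on S (\<lambda>x. A x ** B x)"
  by (rule bounded_bilinear.continuous_on[OF bounded_bilinear_matrix_mult assms])

text \<open>The identity \<open>J z (1 + (A z - A x) J x) = J x\<close> for the inverses \<open>J\<close> reduces this to the division lemma.\<close>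

lemma continuous_on_matrix_inv:
  fixes A :: "'a::topological_space \<Rightarrow> real^'n^'n"
  assumes A: "continuous_on S A" and inv: "\<And>x. x \<in> S \<Longrightarrow> invertible (A x)"
  shows "continuous_on S (\<lambda>x. matrix_inv (A x))"
  unfolding continuous_on_def
proof
  fix x assume x: "x \<in> S"
  let ?J = "\<lambda>z. matrix_inv (A z)"
  interpret bounded_bilinear "(**) :: real^'n^'n \<Rightarrow> real^'n^'n \<Rightarrow> real^'n^'n"
    by (rule bounded_bilinear_matrix_mult)
  have "((\<lambda>z. (A z - A x) ** ?J x) \<longlongrightarrow> (A x - A x) ** ?J x) (at x within S)"
    using A x by (intro tendsto tendsto_intros) (auto simp: continuous_on_def)
  then have lim: "uniform_limit {()} (\<lambda>z _. (A z - A x) ** ?J x) (\<lambda>_. 0) (at x within S)"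
    by (simp add: zero_left uniform_limit_singleton)
  have "\<forall>\<^sub>F z in at x within S. \<forall>_\<in>{()}. ?J z + ?J z ** ((A z - A x) ** ?J x) = ?J x"
    unfolding eventually_at_filter
  proof (intro always_eventually allI impI ballI)
    fix z assume z: "z \<in> S"
    have "?J z ** ((A z - A x) ** ?J x) = (?J z ** A z) ** ?J x - ?J z ** (A x ** ?J x)"
      by (simp add: diff_left diff_right matrix_mul_assoc)
    then show "?J z + ?J z ** ((A z - A x) ** ?J x) = ?J x"
      using matrix_inv_inverse[OF inv[OF z]] matrix_inv_inverse[OF inv[OF x]] by simp
  qed
  from uniform_limit_divide[OF bounded_bilinear_axioms uniform_limit_const _ lim this]
  show "(?J \<longlongrightarrow> ?J x) (at x within S)"
    by (simp add: uniform_limit_singleton)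
qed

context small_field
begin

lemma Finv_has_derivative:
  "(Finv has_derivative (\<lambda>h. matrix_inv (DF x) *v h)) (at (F x))"
proof (rule has_derivative_inverse_basic[where f = F and f' = "\<lambda>h. DF x *v h" and T = "range F"])
  show "(F has_derivative (\<lambda>h. DF x *v h)) (at (Finv (F x)))"
    using deform_has_derivative by simp
  show "bounded_linear ((*v) (matrix_inv (DF x)))" by simp
  show "(*v) (matrix_inv (DF x)) \<circ> (*v) (DF x) = id"
    by (simp add: fun_eq_iff matrix_vector_mul_assoc matrix_inv_inverse[OF invertible_DF])
  show "open (range F)" by (rule open_deform) simp
  then show "isCont Finv (F x)"
    using continuous_Finv by (simp add: continuous_on_eq_continuous_at)
  show "F (Finv z) = z" if "z \<in> range F" for z using that by auto
qed simp

text \<open>Representatives are transported by the inverse of \<open>F\<close>. The exceptional null set goes to a null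
  set because \<open>F\<close> is differentiable.\<close>

lemma C1_rep_deform:
  assumes K: "bounded K" and rep: "C1_rep K (v \<circ> F) w M"
  shows "C1_rep (F ` K) v (w \<circ> Finv) (\<lambda>y. M (Finv y) ** matrix_inv (DF (Finv y)))"
proof -
  have int: "interior (F ` K) = F ` interior K" by (rule interior_deform_image)
  have cl: "closure (interior (F ` K)) = F ` closure (interior K)"
    unfolding int using bounded_subset[OF K interior_subset] by (rule closure_deform_image)
  note r = rep[unfolded C1_rep_def]
  let ?C = "closure (interior K)"
  have cF: "continuous_on (F ` ?C) Finv" by (rule continuous_on_subset[OF continuous_Finv]) auto
  have FC: "Finv ` (F ` ?C) = ?C" by (simp add: image_image)
  have "continuous_on ?C (\<lambda>x. M x ** matrix_inv (DF x))"
    using r by (intro continuous_intros continuous_on_matrix_inv continuous_field_jac[OF X] invertible_DF) auto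
  then have c2: "continuous_on (F ` ?C) ((\<lambda>x. M x ** matrix_inv (DF x)) \<circ> Finv)"
    by (intro continuous_on_compose cF) (simp only: FC)
  show ?thesis
    unfolding C1_rep_def
  proof (intro conjI ballI)
    show "continuous_on (closure (interior (F ` K))) (w \<circ> Finv)"
      unfolding cl using r by (intro continuous_on_compose cF) (simp only: FC)
    show "continuous_on (closure (interior (F ` K))) (\<lambda>y. M (Finv y) ** matrix_inv (DF (Finv y)))"
      unfolding cl using c2 by (simp add: o_def)
  next
    fix y assume "y \<in> interior (F ` K)"
    then obtain x where x: "x \<in> interior K" "y = F x" unfolding int by blast
    have "(w has_derivative (\<lambda>h. M x *v h)) (at (Finv (F x)))" using r x by simp
    from diff_chain_at[OF Finv_has_derivative this]
    show "(w \<circ> Finv has_derivative (\<lambda>h. (M (Finv y) ** matrix_inv (DF (Finv y))) *v h)) (at y)"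
      by (simp add: x o_def matrix_vector_mul_assoc)
  next
    have "{y \<in> interior (F ` K). v y \<noteq> (w \<circ> Finv) y} = F ` {x \<in> interior K. (v \<circ> F) x \<noteq> w x}"
      unfolding int by auto
    moreover have "negligible {x \<in> interior K. (v \<circ> F) x \<noteq> w x}"
      using r by (simp add: AE_lebesgue_on_iff_negligible)
    then have "negligible (F ` {x \<in> interior K. (v \<circ> F) x \<noteq> w x})"
      by (rule negligible_differentiable_image_negligible[OF order_refl])
        (meson deform_has_derivative differentiableI differentiable_at_imp_differentiable_on)
    ultimately show "AE x in lebesgue_on (interior (F ` K)). v x = (w \<circ> Finv) x"
      by (simp add: AE_lebesgue_on_iff_negligible)
  qed
qed

text \<open>The chain rule, valid on all of \<open>K\<close>: the boundary points are reached by continuity, and where the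
  gradient is zero by convention it is so on both sides. In this form, multiplied by the Jacobian, it
  can be fed into the division lemma.\<close>

lemma C1_grad_deform:
  assumes K: "bounded K" and v: "in_C1 K (v \<circ> F)"
  shows "C1_grad (F ` K) v (F x) ** DF x = C1_grad K (v \<circ> F) x"
proof -
  obtain w M where r: "C1_rep K (v \<circ> F) w M" using v by (auto simp: in_C1_def)
  have cl: "closure (interior (F ` K)) = F ` closure (interior K)"
    unfolding interior_deform_image using bounded_subset[OF K interior_subset] by (rule closure_deform_image)
  have iff: "F x \<in> closure (interior (F ` K)) \<longleftrightarrow> x \<in> closure (interior K)"
    unfolding cl using inj_deform[of UNIV] by (auto dest: injD)
  show ?thesis
  proof (cases "x \<in> closure (interior K)")
    case True
    have "C1_grad (F ` K) v (F x) = M x ** matrix_inv (DF x)"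
      using C1_grad_eq[OF C1_rep_deform[OF K r]] iff True by simp
    then show ?thesis
      using C1_grad_eq[OF r True] matrix_inv_inverse[OF invertible_DF, of x]
      by (simp flip: matrix_mul_assoc)
  next
    case False
    then show ?thesis using iff by (simp add: C1_grad_outside)
  qed
qed

end

section \<open>Strict differentiability of the volume\<close>

lemma strict_deriv_along_imp_tendsto:
  assumes "strict_deriv_along v X f f'" "x \<in> X"
  shows "((\<lambda>t. (f (t *\<^sub>R v) x - f 0 x) /\<^sub>R t) \<longlongrightarrow> f' x) (at_right 0)"
proof -
  have "((\<lambda>z. (f (fst z + snd z *\<^sub>R v) x - f (fst z) x) /\<^sub>R snd z) \<longlongrightarrow> f' x) (nhds 0 \<times>\<^sub>F at_right 0)"
    by (rule tendsto_uniform_limitI[OF strict_deriv_alongD(4)[OF assms(1)] assms(2)])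
  moreover have "filterlim (\<lambda>t. (0, t)) (nhds 0 \<times>\<^sub>F at_right 0) (at_right (0::real))"
    by (intro filterlim_Pair filterlim_ident tendsto_const)
  ultimately show ?thesis by (auto dest: filterlim_compose)
qed

lemma uniform_limit_reparam:
  assumes "uniform_limit X f l F" "h ` S \<subseteq> X"
  shows "uniform_limit S (\<lambda>z x. f z (h x)) (\<lambda>x. l (h x)) F"
proof (rule uniform_limitI)
  fix e :: real assume "0 < e"
  from uniform_limitD[OF assms(1) this] show "\<forall>\<^sub>F z in F. \<forall>x\<in>S. dist (f z (h x)) (l (h x)) < e"
    by eventually_elim (use assms(2) in blast)
qed

lemma strict_deriv_along_reparam:
  assumes "strict_deriv_along v X f f'" "h ` S \<subseteq> X"
  shows "strict_deriv_along v S (\<lambda>y x. f y (h x)) (\<lambda>x. f' (h x))"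
proof (rule strict_deriv_alongI)
  note f = strict_deriv_alongD[OF assms(1)]
  show "bounded ((\<lambda>x. f 0 (h x)) ` S)" "bounded ((\<lambda>x. f' (h x)) ` S)"
    using assms(2) by (auto intro: bounded_subset[OF f(1)] bounded_subset[OF f(2)])
qed (rule uniform_limit_reparam[OF strict_deriv_alongD(3)[OF assms(1)] assms(2)]
      uniform_limit_reparam[OF strict_deriv_alongD(4)[OF assms(1)] assms(2)])+

lemma uniform_limit_integral_lmeasurable:
  fixes g :: "'z \<Rightarrow> 'a::euclidean_space \<Rightarrow> real"
  assumes S: "S \<in> lmeasurable" and lim: "uniform_limit S g l F"
    and g: "\<forall>\<^sub>F z in F. g z integrable_on S" and l: "l integrable_on S"
  shows "uniform_limit X (\<lambda>z _. integral S (g z)) (\<lambda>_. integral S l) F"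
proof (rule uniform_limitI)
  fix e :: real assume e: "0 < e"
  define d where "d = e / (measure lebesgue S + 1)"
  have m: "0 \<le> measure lebesgue S" by simp
  then have d: "0 < d" using e by (simp add: d_def add_nonneg_pos)
  have de: "d * measure lebesgue S < e"
  proof -
    have "d * measure lebesgue S < d * (measure lebesgue S + 1)" using d by simp
    also have "\<dots> = e" using m by (simp add: d_def add_nonneg_eq_0_iff)
    finally show ?thesis .
  qed
  show "\<forall>\<^sub>F z in F. \<forall>x\<in>X. dist (integral S (g z)) (integral S l) < e"
    using uniform_limitD[OF lim d] g
  proof eventually_elim
    fix z assume z: "\<forall>x\<in>S. dist (g z x) (l x) < d" and gz: "g z integrable_on S"
    have "norm (integral S (\<lambda>x. g z x - l x)) \<le> integral S (\<lambda>x. d)"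
      using z by (intro integral_norm_bound_integral integrable_diff gz l integrable_on_const S)
        (auto simp: dist_norm intro: less_imp_le)
    also have "\<dots> = d * measure lebesgue S"
      using integral_mult_right[of S d "\<lambda>_. 1"] by (simp add: lmeasure_integral[OF S])
    finally show "\<forall>x\<in>X. dist (integral S (g z)) (integral S l) < e"
      using de by (simp add: integral_diff[OF gz l] dist_norm)
  qed
qed

lemma strict_deriv_along_integral:
  fixes f :: "'a::real_normed_vector \<Rightarrow> 'b::euclidean_space \<Rightarrow> real"
  assumes S: "S \<in> lmeasurable" and f: "strict_deriv_along v S f f'"
    and int: "\<forall>\<^sub>F y in nhds 0. f y integrable_on S" "f' integrable_on S"
  shows "strict_deriv_along v X (\<lambda>y _. integral S (f y)) (\<lambda>_. integral S f')"
proof (rule strict_deriv_alongI)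
  note f = strict_deriv_alongD[OF f]
  show "bounded ((\<lambda>_. integral S (f 0)) ` X)" "bounded ((\<lambda>_. integral S f') ` X)"
    by (auto simp: image_constant_conv)
  show "uniform_limit X (\<lambda>y _. integral S (f y)) (\<lambda>_. integral S (f 0)) (nhds 0)"
    using eventually_nhds_x_imp_x[OF int(1)]
    by (intro uniform_limit_integral_lmeasurable S f int)
  note ev = eventually_base_and_moved[OF int(1), of v]
  have "uniform_limit X (\<lambda>z _. integral S (\<lambda>x. (f (fst z + snd z *\<^sub>R v) x - f (fst z) x) /\<^sub>R snd z))
       (\<lambda>_. integral S f') (nhds 0 \<times>\<^sub>F at_right 0)"
  proof (rule uniform_limit_integral_lmeasurable[OF S f(4) _ int(2)])
    show "\<forall>\<^sub>F z in nhds 0 \<times>\<^sub>F at_right 0.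
        (\<lambda>x. (f (fst z + snd z *\<^sub>R v) x - f (fst z) x) /\<^sub>R snd z) integrable_on S"
      using ev by eventually_elim (intro integrable_cmul integrable_diff, simp_all)
  qed
  then show "uniform_limit X (\<lambda>z _. (integral S (f (fst z + snd z *\<^sub>R v)) - integral S (f (fst z))) /\<^sub>R snd z)
       (\<lambda>_. integral S f') (nhds 0 \<times>\<^sub>F at_right 0)"
    by (rule uniform_limit_eventually_cong)
      (use ev in \<open>eventually_elim, simp add: integral_diff\<close>)
qed

lemma integrable_on_bounded_continuous:
  fixes f :: "'a::euclidean_space \<Rightarrow> real"
  assumes "S \<in> lmeasurable" "continuous_on S f" "bounded (f ` S)"
  shows "f integrable_on S"
proof -
  obtain B where "\<And>x. x \<in> S \<Longrightarrow> norm (f x) \<le> B" using assms(3) by (auto simp: bounded_iff)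
  moreover have S: "S \<in> sets lebesgue" using assms(1) by (rule fmeasurableD)
  ultimately show ?thesis
    using measurable_bounded_by_integrable_imp_integrable[OF
        continuous_imp_measurable_on_sets_lebesgue[OF assms(2) S] integrable_on_const[OF assms(1)] _ S]
    by blast
qed

text \<open>The value of the derivative does not matter for the volume: once it exists it is identified as the
  shape derivative. Continuity is carried along because a bounded continuous function can be integrated over
  a set of finite measure.\<close>

definition strictly_C1_along ::
  "'a::real_normed_vector \<Rightarrow> 'x::topological_space set \<Rightarrow> ('a \<Rightarrow> 'x \<Rightarrow> 'b::real_normed_vector) \<Rightarrow> bool"
where
  "strictly_C1_along v X f \<longleftrightarrow>
     (\<exists>f'. strict_deriv_along v X f f' \<and> continuous_on X (f 0) \<and> continuous_on X f')"

lemma strictly_C1_along_cong: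
  assumes "strictly_C1_along v X f" "\<forall>\<^sub>F y in nhds 0. \<forall>x\<in>X. g y x = f y x"
  shows "strictly_C1_along v X g"
proof -
  obtain f' where f': "strict_deriv_along v X f f'" "continuous_on X (f 0)" "continuous_on X f'"
    using assms(1) by (auto simp: strictly_C1_along_def)
  have "continuous_on X (g 0)"
    using eventually_nhds_x_imp_x[OF assms(2)] by (intro continuous_on_eq[OF f'(2)]) simp
  then show ?thesis
    using strict_deriv_along_cong[OF f'(1) assms(2)] f'(3) by (auto simp: strictly_C1_along_def)
qed

lemma strictly_C1_along_const: "strictly_C1_along v X (\<lambda>y x. c)"
  unfolding strictly_C1_along_def
  by (intro exI[of _ "\<lambda>x. 0"] conjI strict_deriv_along_const continuous_intros)
    (simp add: image_constant_conv)

lemma strictly_C1_along_add: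
  assumes "strictly_C1_along v X f" "strictly_C1_along v X g"
  shows "strictly_C1_along v X (\<lambda>y x. f y x + g y x)"
  using assms unfolding strictly_C1_along_def
  by (blast intro: strict_deriv_along_add continuous_on_add)

lemma strictly_C1_along_mult:
  fixes f g :: "'a::real_normed_vector \<Rightarrow> 'x::topological_space \<Rightarrow> real"
  assumes "strictly_C1_along v X f" "strictly_C1_along v X g"
  shows "strictly_C1_along v X (\<lambda>y x. f y x * g y x)"
proof -
  obtain f' g' where
    *: "strict_deriv_along v X f f'" "continuous_on X (f 0)" "continuous_on X f'"
       "strict_deriv_along v X g g'" "continuous_on X (g 0)" "continuous_on X g'"
    using assms by (auto simp: strictly_C1_along_def)
  show ?thesis
    using bounded_bilinear.strict_deriv_along[OF bounded_bilinear_mult *(1,4)]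
      continuous_on_mult[OF *(2,5)]
      continuous_on_add[OF continuous_on_mult[OF *(3,5)] continuous_on_mult[OF *(2,6)]]
    unfolding strictly_C1_along_def by blast
qed

lemma strictly_C1_along_linear:
  assumes "bounded_linear h" "strictly_C1_along v X f"
  shows "strictly_C1_along v X (\<lambda>y x. h (f y x))"
  using assms(2) bounded_linear.strict_deriv_along[OF assms(1)] bounded_linear.continuous_on[OF assms(1)]
  unfolding strictly_C1_along_def by blast

lemma strictly_C1_along_sum:
  assumes "\<And>i. i \<in> I \<Longrightarrow> strictly_C1_along v X (f i)"
  shows "strictly_C1_along v X (\<lambda>y x. \<Sum>i\<in>I. f i y x)"
  using assms by (induction I rule: infinite_finite_induct)
    (auto intro: strictly_C1_along_const strictly_C1_along_add)

lemma strictly_C1_along_prod: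
  fixes f :: "'i \<Rightarrow> 'a::real_normed_vector \<Rightarrow> 'x::topological_space \<Rightarrow> real"
  assumes "\<And>i. i \<in> I \<Longrightarrow> strictly_C1_along v X (f i)"
  shows "strictly_C1_along v X (\<lambda>y x. \<Prod>i\<in>I. f i y x)"
  using assms by (induction I rule: infinite_finite_induct)
    (auto intro: strictly_C1_along_const strictly_C1_along_mult)

lemma strictly_C1_along_det:
  fixes A :: "'a::real_normed_vector \<Rightarrow> 'x::topological_space \<Rightarrow> real^'n^'n"
  assumes "strictly_C1_along v X A"
  shows "strictly_C1_along v X (\<lambda>y x. det (A y x))"
proof -
  have "strictly_C1_along v X (\<lambda>y x. A y x $ i $ j)" for i j
    by (rule strictly_C1_along_linear[OF _ assms])
      (intro bounded_linear_vec_nth[THEN bounded_linear_compose] bounded_linear_vec_nth)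
  then show ?thesis
    unfolding det_def
    by (intro strictly_C1_along_sum strictly_C1_along_mult strictly_C1_along_const strictly_C1_along_prod)
qed

lemma strictly_C1_along_integral:
  fixes f :: "'a::real_normed_vector \<Rightarrow> 'b::euclidean_space \<Rightarrow> real"
  assumes S: "S \<in> lmeasurable" and f: "strictly_C1_along v S f"
    and int: "\<forall>\<^sub>F y in nhds 0. f y integrable_on S"
  shows "strictly_C1_along v X (\<lambda>y _. integral S (f y))"
proof -
  obtain f' where f': "strict_deriv_along v S f f'" "continuous_on S f'"
    using f by (auto simp: strictly_C1_along_def)
  have "f' integrable_on S"
    by (rule integrable_on_bounded_continuous[OF S f'(2) strict_deriv_alongD(2)[OF f'(1)]])
  note * = strict_deriv_along_integral[OF S f'(1) int this]
  show ?thesis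
    unfolding strictly_C1_along_def
    by (intro exI[of _ "\<lambda>_. integral S f'"] conjI continuous_on_const *)
qed

text \<open>The change of variables formula is stated for vectors indexed by a well-ordered finite type. This
  copy of a finite type carries an arbitrary well-order; permuting coordinates does not change the
  Lebesgue measure, so the formula can be transported.\<close>

datatype 'a ordered = Ordered (unordered: 'a)

instance ordered :: (finite) finite
proof
  have "(UNIV :: 'a ordered set) = range Ordered"
    by (auto intro: ordered.exhaust_sel)
  then show "finite (UNIV :: 'a ordered set)" by (metis finite finite_imageI)
qed

instantiation ordered :: (finite) wellorder
begin

definition less_eq_ordered :: "'a ordered \<Rightarrow> 'a ordered \<Rightarrow> bool" where
  "a \<le> b \<longleftrightarrow> to_nat (unordered a) \<le> to_nat (unordered b)"

definition less_ordered :: "'a ordered \<Rightarrow> 'a ordered \<Rightarrow> bool" where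
  "a < b \<longleftrightarrow> to_nat (unordered a) < to_nat (unordered b)"

instance
proof
  fix P :: "'a ordered \<Rightarrow> bool" and a
  assume step: "\<And>x. (\<And>y. y < x \<Longrightarrow> P y) \<Longrightarrow> P x"
  show "P a"
    by (induction a rule: measure_induct_rule[of "\<lambda>x. to_nat (unordered x)"])
      (auto intro: step simp: less_ordered_def)
qed (auto simp: less_eq_ordered_def less_ordered_def ordered.expand)

end

definition reindex :: "real^'n::finite \<Rightarrow> real^'n ordered" where
  "reindex x = (\<chi> i. x $ unordered i)"

definition unindex :: "real^'n ordered \<Rightarrow> real^'n::finite" where
  "unindex x = (\<chi> i. x $ Ordered i)"

definition reindex_matrix :: "real^'n^'n::finite \<Rightarrow> real^'n ordered^'n ordered" where
  "reindex_matrix A = (\<chi> i j. A $ unordered i $ unordered j)"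

lemma unindex_reindex [simp]: "unindex (reindex x) = x"
  and reindex_unindex [simp]: "reindex (unindex y) = y"
  by (simp_all add: reindex_def unindex_def vec_eq_iff)

lemma linear_reindex: "linear reindex" and linear_unindex: "linear unindex"
  and linear_reindex_matrix: "linear reindex_matrix"
  by (rule linearI; simp add: reindex_def unindex_def reindex_matrix_def vec_eq_iff)+

lemma reindex_image: "reindex ` S = unindex -` S"
proof
  show "unindex -` S \<subseteq> reindex ` S"
    by (metis (no_types) imageI reindex_unindex subsetI vimageE)
qed auto

lemma bounded_linear_reindex: "bounded_linear reindex"
  and bounded_linear_unindex: "bounded_linear unindex"
  and bounded_linear_reindex_matrix: "bounded_linear reindex_matrix"
  using linear_reindex linear_unindex linear_reindex_matrix by (simp_all add: linear_conv_bounded_linear)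

lemma continuous_reindex: "continuous_on S reindex" and continuous_unindex: "continuous_on S' unindex"
  by (intro linear_continuous_on bounded_linear_reindex bounded_linear_unindex)+

lemma open_reindex: "open S \<Longrightarrow> open (reindex ` S)"
  unfolding reindex_image by (intro open_vimage continuous_unindex)

lemma bij_unordered: "bij (unordered :: 'a ordered \<Rightarrow> 'a)"
  by (rule bij_betw_byWitness[where f' = Ordered]) auto

lemma reindex_matrix_vector_mult: "reindex (A *v unindex x) = reindex_matrix A *v x"
proof -
  have "(\<Sum>j\<in>UNIV. A $ i $ j * x $ Ordered j) = (\<Sum>j\<in>UNIV. A $ i $ unordered j * x $ j)" for i
    using sum.reindex_bij_betw[OF bij_unordered, of "\<lambda>j. A $ i $ j * x $ Ordered j"] by simp
  then show ?thesis
    by (simp add: vec_eq_iff reindex_def unindex_def reindex_matrix_def matrix_vector_mult_def)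
qed

lemma reindex_matrix_1: "reindex_matrix (mat 1) = mat 1"
  by (auto simp: reindex_matrix_def mat_def vec_eq_iff ordered.expand)

lemma emeasure_lborel_box_cart:
  fixes l u :: "real^'n"
  assumes "\<And>i. l $ i \<le> u $ i"
  shows "emeasure lborel (box l u) = (\<Prod>i\<in>UNIV. u $ i - l $ i)"
proof -
  have "emeasure lborel (box l u) = (\<Prod>b\<in>Basis. (u - l) \<bullet> b)"
    using assms by (intro emeasure_lborel_box) (auto simp: Basis_vec_def inner_axis)
  also have "(\<Prod>b\<in>Basis. (u - l) \<bullet> b) = (\<Prod>b\<in>Basis. u \<bullet> b - l \<bullet> b)"
    by (simp only: inner_diff_left)
  also have "\<dots> = measure lborel (cbox l u)"
    using assms by (intro content_cbox[symmetric]) (auto simp: Basis_vec_def inner_axis)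
  also have "\<dots> = (\<Prod>i\<in>UNIV. u $ i - l $ i)"
    using assms by (intro content_cbox_cart) (auto simp: interval_ne_empty_cart)
  finally show ?thesis .
qed

lemma lborel_reindex: "lborel = distr lborel borel (reindex :: real^'n \<Rightarrow> _)"
proof (rule lborel_eqI)
  have m: "reindex \<in> borel_measurable (lborel :: (real^'n) measure)"
    by (simp add: borel_measurable_continuous_onI continuous_reindex)
  fix l u :: "real^'n ordered" assume "\<And>b. b \<in> Basis \<Longrightarrow> l \<bullet> b \<le> u \<bullet> b"
  then have "l \<bullet> axis i 1 \<le> u \<bullet> axis i 1" for i by (simp add: axis_in_Basis_iff)
  then have le: "l $ i \<le> u $ i" for i by (simp add: inner_axis)
  have "reindex -` box l u = (box (unindex l) (unindex u) :: (real^'n) set)"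
  proof -
    have "(\<forall>i. l $ i < x $ unordered i \<and> x $ unordered i < u $ i) \<longleftrightarrow>
          (\<forall>i. l $ Ordered i < x $ i \<and> x $ i < u $ Ordered i)" for x :: "real^'n"
      by (metis ordered.collapse ordered.sel)
    then show ?thesis by (auto simp: mem_box_cart reindex_def unindex_def)
  qed
  then have "emeasure (distr lborel borel (reindex :: real^'n \<Rightarrow> _)) (box l u) =
      emeasure lborel (box (unindex l) (unindex u) :: (real^'n) set)"
    using m by (simp add: emeasure_distr)
  also have "\<dots> = (\<Prod>i\<in>UNIV. u $ Ordered i - l $ Ordered i)"
    by (subst emeasure_lborel_box_cart) (auto simp: unindex_def le)
  also have "(\<Prod>i\<in>UNIV. u $ Ordered i - l $ Ordered i) = (\<Prod>i\<in>UNIV. u $ i - l $ i)"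
    using prod.reindex_bij_betw[OF bij_unordered, of "\<lambda>i. u $ Ordered i - l $ Ordered i"] by simp
  also have "ennreal (\<Prod>i\<in>UNIV. u $ i - l $ i) = emeasure lborel (box l u)"
    by (rule emeasure_lborel_box_cart[symmetric]) (rule le)
  also have "\<dots> = ennreal (\<Prod>b\<in>Basis. (u - l) \<bullet> b)"
    by (rule emeasure_lborel_box) fact
  finally show "emeasure (distr lborel borel (reindex :: real^'n \<Rightarrow> _)) (box l u) =
      ennreal (\<Prod>b\<in>Basis. (u - l) \<bullet> b)" .
qed simp

lemma measure_reindex:
  assumes "open S"
  shows "measure lebesgue (reindex ` S) = measure lebesgue S"
proof -
  have m: "reindex \<in> borel_measurable (lborel :: (real^'n) measure)"
    by (simp add: borel_measurable_continuous_onI continuous_reindex)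
  have o: "open (reindex ` S)" using assms by (rule open_reindex)
  have "measure lebesgue (reindex ` S) = measure lborel (reindex ` S)"
    using o by (simp add: measure_completion)
  also have "\<dots> = measure lborel (reindex -` reindex ` S \<inter> space lborel)"
    unfolding lborel_reindex by (rule measure_distr[OF m]) (use o in simp)
  also have "reindex -` reindex ` S \<inter> space lborel = S"
    by (auto dest: arg_cong[of _ _ unindex])
  also have "measure lborel S = measure lebesgue S"
    using assms by (simp add: measure_completion)
  finally show ?thesis .
qed

lemma continuous_on_det [continuous_intros]:
  fixes A :: "'a::topological_space \<Rightarrow> real^'n^'n"
  assumes "continuous_on S A"
  shows "continuous_on S (\<lambda>x. det (A x))"
  unfolding det_def by (intro continuous_intros assms)

text \<open>The determinant is taken of the reindexed matrix: only its being a polynomial in the entries of \<open>A\<close>,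
  with value \<open>1\<close> at the identity, is used later.\<close>

lemma measure_image_integral_det:
  fixes F :: "real^'n::finite \<Rightarrow> real^'n"
  assumes S: "open S" "bounded S" and FS: "open (F ` S)" and inj: "inj_on F S"
    and der: "\<And>x. x \<in> S \<Longrightarrow> (F has_derivative (\<lambda>h. A x *v h)) (at x)"
    and cont: "continuous_on S A" and bd: "bounded (A ` S)"
  shows "measure lebesgue (F ` S) = integral (reindex ` S) (\<lambda>x. \<bar>det (reindex_matrix (A (unindex x)))\<bar>)"
    and "(\<lambda>x. \<bar>det (reindex_matrix (A (unindex x)))\<bar>) integrable_on reindex ` S"
proof -
  let ?G = "reindex \<circ> F \<circ> unindex" and ?S = "reindex ` S"
  let ?d = "\<lambda>x. reindex_matrix (A (unindex x))"
  have S': "?S \<in> lmeasurable"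
    using open_reindex[OF S(1)] bounded_linear_image[OF S(2) bounded_linear_reindex]
    by (intro lmeasurable_open)
  have der': "(?G has_derivative (\<lambda>h. ?d x *v h)) (at x within ?S)" if "x \<in> ?S" for x
  proof -
    have x: "unindex x \<in> S" using that by auto
    note lin = bounded_linear_imp_has_derivative[OF bounded_linear_unindex]
      bounded_linear_imp_has_derivative[OF bounded_linear_reindex]
    have "(reindex \<circ> (F \<circ> unindex) has_derivative reindex \<circ> ((\<lambda>h. A (unindex x) *v h) \<circ> unindex)) (at x)"
      by (rule diff_chain_at[OF diff_chain_at[OF lin(1) der[OF x]] lin(2)])
    then show ?thesis
      by (simp add: o_def reindex_matrix_vector_mult has_derivative_at_withinI)
  qed
  have inj': "inj_on ?G ?S"
  proof (rule inj_onI)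
    fix x y assume "x \<in> ?S" "y \<in> ?S" and e: "?G x = ?G y"
    then obtain a b where ab: "a \<in> S" "b \<in> S" "x = reindex a" "y = reindex b" by blast
    have "F a = F b" using arg_cong[OF e, of unindex] ab by simp
    then show "x = y" using inj ab by (auto dest: inj_onD)
  qed
  have "continuous_on ?S (A \<circ> unindex)"
    using cont by (intro continuous_on_compose continuous_unindex) (simp add: image_image)
  then have "continuous_on ?S ?d"
    unfolding o_def by (rule bounded_linear.continuous_on[OF bounded_linear_reindex_matrix])
  then have c: "continuous_on ?S (\<lambda>x. \<bar>det (?d x)\<bar>)"
    by (intro continuous_intros)
  have "bounded (reindex_matrix ` A ` S)"
    by (rule bounded_linear_image[OF bd bounded_linear_reindex_matrix])
  then have "compact (closure (reindex_matrix ` A ` S))" by simp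
  then have "bounded ((\<lambda>M. \<bar>det M\<bar>) ` closure (reindex_matrix ` A ` S))"
    by (intro compact_imp_bounded compact_continuous_image continuous_intros)
  then have b: "bounded ((\<lambda>x. \<bar>det (?d x)\<bar>) ` ?S)"
    by (rule bounded_subset)
      (use closure_subset[of "reindex_matrix ` A ` S"] in \<open>auto intro!: imageI\<close>)
  show int: "(\<lambda>x. \<bar>det (?d x)\<bar>) integrable_on ?S"
    by (rule integrable_on_bounded_continuous[OF S' c b])
  have "measure lebesgue (?G ` ?S) = integral ?S (\<lambda>x. \<bar>det (matrix (\<lambda>h. ?d x *v h))\<bar>)"
    using int by (intro measure_differentiable_image_eq der' inj' fmeasurableD[OF S']) simp_all
  moreover have "?G ` ?S = reindex ` (F ` S)" by (simp add: image_image)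
  ultimately show "measure lebesgue (F ` S) = integral ?S (\<lambda>x. \<bar>det (?d x)\<bar>)"
    using measure_reindex[OF FS] by simp
qed

context field_space
begin

lemma small_fieldI: "field_norm D (E y) < 1/2 \<Longrightarrow> small_field D \<omega> (E y)"
  using E_admissible bounded_D D_nonempty by unfold_locales auto

lemma eventually_small_field: "\<forall>\<^sub>F y in nhds 0. small_field D \<omega> (E y)"
  using eventually_field_norm_less[of "1/2"] by (auto elim!: eventually_mono intro: small_fieldI)

text \<open>Near the identity the determinant is positive, so the volume of the deformed set is the integral
  of a polynomial in the entries of the Jacobian.\<close>

lemma strictly_C1_along_volume:
  assumes S: "open S" "bounded S"
  shows "strictly_C1_along v {0::real} (\<lambda>y _. measure lebesgue (deform (E y) ` S))"
proof -
  let ?S = "reindex ` S"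
  define d where "d y x = det (reindex_matrix (mat 1 + field_jac (E y) (unindex x)))" for y x
  have S': "?S \<in> lmeasurable"
    using open_reindex[OF S(1)] bounded_linear_image[OF S(2) bounded_linear_reindex]
    by (intro lmeasurable_open)
  have cj: "continuous_on ?S (\<lambda>x. field_jac (E y) (unindex x))" for y
    using continuous_on_compose[OF continuous_unindex continuous_field_jac[OF E_admissible]]
    by (simp add: o_def)
  have "strict_deriv_along v ?S (\<lambda>y x. field_jac (E y) (unindex x)) (\<lambda>x. field_jac (E v) (unindex x))"
    by (rule strict_deriv_along_reparam[OF strict_deriv_along_field_jac[of v UNIV]]) simp
  then have "strictly_C1_along v ?S (\<lambda>y x. field_jac (E y) (unindex x))"
    unfolding strictly_C1_along_def using cj by blast
  then have sd: "strictly_C1_along v ?S d"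
    unfolding d_def
    by (intro strictly_C1_along_det strictly_C1_along_linear[OF bounded_linear_reindex_matrix]
          strictly_C1_along_add strictly_C1_along_const)
  have d0: "d 0 x = 1" for x by (simp add: d_def jac_0 reindex_matrix_1)
  have pos: "\<forall>\<^sub>F y in nhds 0. \<forall>x\<in>?S. 0 < d y x"
  proof -
    have "uniform_limit ?S d (d 0) (nhds 0)"
      using sd by (auto simp: strictly_C1_along_def dest: strict_deriv_alongD(3))
    from uniform_limitD[OF this zero_less_one] show ?thesis
      by eventually_elim (auto simp: d0 dist_real_def abs_less_iff)
  qed
  have ev: "\<forall>\<^sub>F y in nhds 0. d y integrable_on ?S \<and> measure lebesgue (deform (E y) ` S) = integral ?S (d y)"
    using pos eventually_small_field
  proof eventually_elim
    fix y assume p: "\<forall>x\<in>?S. 0 < d y x" and sm: "small_field D \<omega> (E y)"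
    interpret small_field D \<omega> "E y" by (rule sm)
    have eq: "\<bar>det (reindex_matrix (DF (unindex x)))\<bar> = d y x" if "x \<in> ?S" for x
      using p that by (auto simp: d_def)
    have bd: "bounded ((\<lambda>x. DF x) ` S)"
      using bounded_translation[OF bounded_field_jac[OF X bounded_D D_nonempty, of S], of "mat 1"]
      by (simp add: image_image)
    have c: "continuous_on S (\<lambda>x. DF x)" by (intro continuous_intros continuous_field_jac[OF X])
    note m = measure_image_integral_det[OF S open_deform[OF S(1)] inj_deform deform_has_derivative c bd]
    show "d y integrable_on ?S \<and> measure lebesgue (deform (E y) ` S) = integral ?S (d y)"
      using m(1) integrable_eq[OF m(2), of "d y"] eq integral_cong[of ?S, OF eq] by simp
  qed
  have "strictly_C1_along v {0::real} (\<lambda>y _. integral ?S (d y))"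
    using ev by (intro strictly_C1_along_integral S' sd) (auto elim: eventually_mono)
  then show ?thesis
    by (rule strictly_C1_along_cong) (use ev in \<open>eventually_elim, simp\<close>)
qed

lemma strict_deriv_along_J_vol:
  assumes S: "open S" "bounded S"
  shows "strict_deriv_along v X (\<lambda>y _. J_vol V (deform (E y) ` S)) (\<lambda>_. shape_derivative (J_vol V) S (E v))"
proof -
  have v: "strictly_C1_along v {0::real} (\<lambda>y _. measure lebesgue (deform (E y) ` S) + (- V))"
    by (intro strictly_C1_along_add strictly_C1_along_volume strictly_C1_along_const S)
  have "strictly_C1_along v {0::real} (\<lambda>y _. J_vol V (deform (E y) ` S))"
    using strictly_C1_along_mult[OF v v] by (simp add: J_vol_def power2_eq_square)
  then obtain l where l: "strict_deriv_along v {0::real} (\<lambda>y _. J_vol V (deform (E y) ` S)) l"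
    by (auto simp: strictly_C1_along_def)
  have id: "deform (\<lambda>x. 0) ` S = S" by (simp add: deform_def)
  have "((\<lambda>t. (J_vol V (deform (scale_field t (E v)) ` S) - J_vol V S) / t) \<longlongrightarrow> l 0) (at_right 0)"
    using strict_deriv_along_imp_tendsto[OF l, of 0]
    by (simp add: E_0 E_scaleR id divide_inverse mult.commute)
  then have "shape_derivative (J_vol V) S (E v) = l 0"
    unfolding shape_derivative_def by (intro tendsto_Lim) simp_all
  moreover have "strict_deriv_along v X (\<lambda>y _. J_vol V (deform (E y) ` S)) (\<lambda>_. l 0)"
    by (rule strict_deriv_along_reparam[OF l]) auto
  ultimately show ?thesis by simp
qed

end

section \<open>The stress as a strictly differentiable family\<close>

text \<open>Otherwise a sequence of points whose values of \<open>f\<close> approach \<open>M\<close> while their values of \<open>g\<close> exceed those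
  at all maximisers by \<open>\<epsilon>\<close> would accumulate at a maximiser.\<close>

lemma near_maximizers_compact:
  fixes f g :: "'a::metric_space \<Rightarrow> real"
  assumes C: "compact C" and f: "continuous_on C f" and g: "continuous_on C g"
    and le: "\<And>x. x \<in> C \<Longrightarrow> f x \<le> M" and e: "0 < \<epsilon>"
  shows "\<exists>\<eta>>0. \<forall>x\<in>C. M - \<eta> < f x \<longrightarrow> (\<exists>a\<in>C. f a = M \<and> g x - \<epsilon> < g a)"
proof (rule ccontr)
  assume "\<not> ?thesis"
  then have "\<exists>x\<in>C. M - \<eta> < f x \<and> (\<forall>a\<in>C. f a = M \<longrightarrow> g a \<le> g x - \<epsilon>)" if "0 < \<eta>" for \<eta>
    using that by (meson not_le)
  then have "\<exists>x\<in>C. M - inverse (real (Suc n)) < f x \<and> (\<forall>a\<in>C. f a = M \<longrightarrow> g a \<le> g x - \<epsilon>)" for n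
    by simp
  then obtain x where x: "\<And>n. x n \<in> C" "\<And>n. M - inverse (real (Suc n)) < f (x n)"
    "\<And>n a. a \<in> C \<Longrightarrow> f a = M \<Longrightarrow> g a \<le> g (x n) - \<epsilon>"
    by metis
  obtain l r where l: "l \<in> C" "strict_mono r" "(x \<circ> r) \<longlonglongrightarrow> l"
    using C[unfolded compact_def] x(1) by metis
  have "\<forall>n. (x \<circ> r) n \<in> C" using x(1) by simp
  then have lim: "(\<lambda>n. f (x (r n))) \<longlonglongrightarrow> f l" "(\<lambda>n. g (x (r n))) \<longlonglongrightarrow> g l"
    using continuous_on_sequentially f g l by (auto simp: o_def continuous_on_sequentially)
  have "(\<lambda>n. M - inverse (real (Suc n))) \<longlonglongrightarrow> M - 0"
    by (intro tendsto_intros LIMSEQ_inverse_real_of_nat)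
  from LIMSEQ_subseq_LIMSEQ[OF this l(2)]
  have "(\<lambda>n. M - inverse (real (Suc (r n)))) \<longlonglongrightarrow> M" by (simp add: o_def)
  then have "M \<le> f l"
    by (rule LIMSEQ_le[OF _ lim(1)]) (use x(2) less_imp_le in blast)
  with le[OF l(1)] have fl: "f l = M" by simp
  have "(\<lambda>n. g (x (r n)) - \<epsilon>) \<longlonglongrightarrow> g l - \<epsilon>" by (intro tendsto_intros lim(2))
  then have "g l \<le> g l - \<epsilon>"
    by (rule LIMSEQ_le_const) (use x(3)[OF l(1) fl] in blast)
  then show False using e by simp
qed

text \<open>The additional index \<open>None\<close> will stand for the inactive branch \<open>0\<close> of \<open>max (s - \<delta>) 0\<close>.\<close>

lemma strict_deriv_along_option:
  assumes "strict_deriv_along v X f f'"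
  shows "strict_deriv_along v (insert None (Some ` X))
    (\<lambda>y i. case i of None \<Rightarrow> 0 | Some x \<Rightarrow> f y x) (\<lambda>i. case i of None \<Rightarrow> 0 | Some x \<Rightarrow> f' x)"
proof (rule strict_deriv_alongI)
  note f = strict_deriv_alongD[OF assms]
  have lim: "uniform_limit (insert None (Some ` X)) (\<lambda>z i. case i of None \<Rightarrow> 0 | Some x \<Rightarrow> h z x)
      (\<lambda>i. case i of None \<Rightarrow> 0 | Some x \<Rightarrow> l x) F" if "uniform_limit X h l F"
    for h :: "'z \<Rightarrow> 'b \<Rightarrow> 'c" and l F
  proof (rule uniform_limitI)
    fix e :: real assume "0 < e"
    with uniform_limitD[OF that this]
    show "\<forall>\<^sub>F z in F. \<forall>i\<in>insert None (Some ` X).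
        dist (case i of None \<Rightarrow> 0 | Some x \<Rightarrow> h z x) (case i of None \<Rightarrow> 0 | Some x \<Rightarrow> l x) < e"
      by (auto elim: eventually_mono)
  qed
  show "bounded ((\<lambda>i. case i of None \<Rightarrow> 0 | Some x \<Rightarrow> f 0 x) ` insert None (Some ` X))"
    "bounded ((\<lambda>i. case i of None \<Rightarrow> 0 | Some x \<Rightarrow> f' x) ` insert None (Some ` X))"
    using f(1,2) by (simp_all add: image_image)
  show "uniform_limit (insert None (Some ` X)) (\<lambda>y i. case i of None \<Rightarrow> 0 | Some x \<Rightarrow> f y x)
     (\<lambda>i. case i of None \<Rightarrow> 0 | Some x \<Rightarrow> f 0 x) (nhds 0)"
    by (rule lim[OF f(3)])
  have "uniform_limit (insert None (Some ` X))
     (\<lambda>z i. case i of None \<Rightarrow> 0 | Some x \<Rightarrow> (f (fst z + snd z *\<^sub>R v) x - f (fst z) x) /\<^sub>R snd z)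
     (\<lambda>i. case i of None \<Rightarrow> 0 | Some x \<Rightarrow> f' x) (nhds 0 \<times>\<^sub>F at_right 0)"
    by (rule lim[OF f(4)])
  then show "uniform_limit (insert None (Some ` X))
     (\<lambda>z i. ((case i of None \<Rightarrow> 0 | Some x \<Rightarrow> f (fst z + snd z *\<^sub>R v) x) -
       (case i of None \<Rightarrow> 0 | Some x \<Rightarrow> f (fst z) x)) /\<^sub>R snd z)
     (\<lambda>i. case i of None \<Rightarrow> 0 | Some x \<Rightarrow> f' x) (nhds 0 \<times>\<^sub>F at_right 0)"
    by (rule uniform_limit_eventually_cong) (auto split: option.split)
qed

lemma bounded_linear_symm: "bounded_linear (symm :: real^'n^'n::finite \<Rightarrow> _)"
  unfolding linear_conv_bounded_linear[symmetric]
  by (rule linearI) (simp_all add: symm_def transpose_def vec_eq_iff algebra_simps)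

lemma bounded_linear_B_op: "bounded_linear (B_op lam mu :: real^'n^'n::finite \<Rightarrow> _)"
proof -
  have "trace (r *\<^sub>R M) = r * trace M" for r and M :: "real^'n^'n"
    by (simp add: trace_def sum_distrib_left)
  then have "linear (B_op lam mu :: real^'n^'n \<Rightarrow> _)"
    by (intro linearI) (simp_all add: B_op_def trace_add algebra_simps)
  then show ?thesis by (simp add: linear_conv_bounded_linear)
qed

text \<open>The stress is the quadratic form of this bilinear form, evaluated at the gradient.\<close>

definition stress_form :: "real \<Rightarrow> real \<Rightarrow> real^'n^'n::finite \<Rightarrow> real^'n^'n \<Rightarrow> real" where
  "stress_form lam mu M N = B_op lam mu (symm M) \<bullet> symm N"

lemma bounded_bilinear_stress_form: "bounded_bilinear (stress_form lam mu)"
  unfolding stress_form_def[abs_def]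
  by (rule bounded_bilinear.comp[OF bounded_bilinear_inner
        bounded_linear_compose[OF bounded_linear_B_op bounded_linear_symm] bounded_linear_symm])

lemma SUP_penalty:
  fixes s :: "'x \<Rightarrow> real"
  assumes X: "X \<noteq> {}" and bdd: "bdd_above (s ` X)" and \<alpha>: "0 < \<alpha>"
  shows "(SUP i\<in>insert None (Some ` X). c + \<alpha> * (case i of None \<Rightarrow> 0 | Some x \<Rightarrow> s x - \<delta>)) =
     c + \<alpha> * max ((SUP x\<in>X. s x) - \<delta>) 0" (is "(SUP i\<in>?I. ?T i) = ?R")
proof (rule antisym)
  have le: "?T i \<le> ?R" if "i \<in> ?I" for i
  proof -
    have "(case i of None \<Rightarrow> 0 | Some x \<Rightarrow> s x - \<delta>) \<le> max ((SUP x\<in>X. s x) - \<delta>) 0"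
      using that cSUP_upper[OF _ bdd] by (auto simp: le_max_iff_disj)
    then show ?thesis using \<alpha> by (simp add: mult_left_mono)
  qed
  then show "(SUP i\<in>?I. ?T i) \<le> ?R" by (intro cSUP_least) auto
  have bddT: "bdd_above (?T ` ?I)" using le by (rule bdd_aboveI2)
  have none: "c \<le> (SUP i\<in>?I. ?T i)" using cSUP_upper[OF _ bddT, of None] by simp
  have "s x \<le> ((SUP i\<in>?I. ?T i) - c) / \<alpha> + \<delta>" if "x \<in> X" for x
  proof -
    have "c + \<alpha> * (s x - \<delta>) \<le> (SUP i\<in>?I. ?T i)" using cSUP_upper[OF _ bddT, of "Some x"] that by simp
    then show ?thesis using \<alpha> by (simp add: field_simps)
  qed
  then have "(SUP x\<in>X. s x) \<le> ((SUP i\<in>?I. ?T i) - c) / \<alpha> + \<delta>" by (intro cSUP_least X)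
  then have "c + \<alpha> * ((SUP x\<in>X. s x) - \<delta>) \<le> (SUP i\<in>?I. ?T i)" using \<alpha> by (simp add: field_simps)
  with none show "?R \<le> (SUP i\<in>?I. ?T i)" by (simp add: max_def)
qed

locale elastic_shape = field_space D \<omega> E
  for D \<omega> :: "(real^'n::finite) set" and E :: "'h::{real_inner,complete_space} \<Rightarrow> real^'n \<Rightarrow> real^'n" +
  fixes \<Omega> \<Gamma> :: "(real^'n) set" and f g :: "real^'n \<Rightarrow> real^'n" and lam mu :: real
  assumes open_Omega: "open \<Omega>" and bounded_Omega: "bounded \<Omega>"
    and K_nonempty: "closure (\<Omega> - \<omega>) \<noteq> {}"
    and regularity: "standing_regularity lam mu f g \<Gamma> D \<Omega> \<omega>"
begin

definition "K = closure (\<Omega> - \<omega>)"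

definition "pulled y = state lam mu f g \<Gamma> (deform (E y) ` \<Omega>) \<circ> deform (E y)"

text \<open>Gradient and stress of the state on the deformed set are read off at the image of a fixed point \<open>x\<close> of
  \<open>K\<close>, so that the families for different \<open>y\<close> have the common index set \<open>K\<close>.\<close>

definition "moved_grad y x = C1_grad (deform (E y) ` K) (state lam mu f g \<Gamma> (deform (E y) ` \<Omega>)) (deform (E y) x)"

definition "moved_stress y x = stress lam mu f g \<Gamma> \<omega> (deform (E y) ` \<Omega>) (deform (E y) x)"

definition "mat_deriv v = material_derivative lam mu f g \<Gamma> D \<Omega> (E v)"

text \<open>The derivatives along \<open>v\<close> of \<open>moved_grad\<close> and \<open>moved_stress\<close> at \<open>0\<close>, as they come out of the division
  lemma and of the product rule.\<close>

definition "moved_grad' v x = C1_grad K (mat_deriv v) x - C1_grad K (pulled 0) x ** field_jac (E v) x"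

definition "moved_stress' v x =
  stress_form lam mu (moved_grad' v x) (moved_grad 0 x) + stress_form lam mu (moved_grad 0 x) (moved_grad' v x)"

lemma K_ne: "K \<noteq> {}" and bounded_K: "bounded K"
  using K_nonempty bounded_Omega by (auto simp: K_def bounded_diff)

lemma deform_0: "deform (E 0) = (\<lambda>x. x)"
  by (simp add: deform_def[abs_def] E_0)

lemma pulled_state_eq: "pulled_state lam mu f g \<Gamma> \<Omega> (E v) (E y) t = pulled (y + t *\<^sub>R v)"
  by (simp add: pulled_state_def pulled_def E_add_scaleR Let_def)

lemma pulled_0: "pulled 0 = state lam mu f g \<Gamma> \<Omega>"
  by (simp add: pulled_def deform_0 o_def)

text \<open>The perturbations \<open>Y + t X\<close> of the standing assumption, with \<open>Y = E y\<close> and \<open>X = E v\<close>, are \<open>E (y + t v)\<close>, so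
  the assumption speaks of moving base points.\<close>

lemma regularity_E:
  shows mat_deriv_C1: "in_C1 K (mat_deriv v)"
    and pulled_C1: "\<exists>\<rho>>0. \<forall>y t. field_norm D (E y) < \<rho> \<longrightarrow> 0 \<le> t \<longrightarrow> t < \<rho> \<longrightarrow> in_C1 K (pulled (y + t *\<^sub>R v))"
    and pulled_conv: "0 < \<epsilon> \<Longrightarrow> \<exists>\<rho>>0. \<forall>y t. field_norm D (E y) < \<rho> \<longrightarrow> 0 < t \<longrightarrow> t < \<rho> \<longrightarrow>
        C1_norm K (\<lambda>x. pulled (y + t *\<^sub>R v) x - pulled 0 x) < \<epsilon>"
    and pulled_quotient: "0 < \<epsilon> \<Longrightarrow> \<exists>\<rho>>0. \<forall>y t. field_norm D (E y) < \<rho> \<longrightarrow> 0 < t \<longrightarrow> t < \<rho> \<longrightarrow>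
        C1_norm K (\<lambda>x. (pulled (y + t *\<^sub>R v) x - pulled y x) /\<^sub>R t - mat_deriv v x) < \<epsilon>"
proof -
  have p0: "pulled_state lam mu f g \<Gamma> \<Omega> (E v) (E y) 0 = pulled y" for y
    using pulled_state_eq[of v y 0] by simp
  note reg = bspec[OF regularity[unfolded standing_regularity_def Let_def] E_admissible[of v],
      folded K_def mat_deriv_def pulled_0]
  note reg1 = reg[THEN conjunct1] and reg2 = reg[THEN conjunct2, THEN conjunct1]
    and reg3 = reg[THEN conjunct2, THEN conjunct2, THEN conjunct1]
    and reg4 = reg[THEN conjunct2, THEN conjunct2, THEN conjunct2]
  show "in_C1 K (mat_deriv v)" by (rule reg1)
  show "\<exists>\<rho>>0. \<forall>y t. field_norm D (E y) < \<rho> \<longrightarrow> 0 \<le> t \<longrightarrow> t < \<rho> \<longrightarrow> in_C1 K (pulled (y + t *\<^sub>R v))"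
    using reg2
  proof (elim ex_forward conj_forward)
    fix \<rho> :: real
    assume "\<forall>Y\<in>admissible_fields D \<omega>. \<forall>t. field_norm D Y < \<rho> \<longrightarrow> 0 \<le> t \<longrightarrow> t < \<rho> \<longrightarrow>
       in_C1 K (pulled_state lam mu f g \<Gamma> \<Omega> (E v) Y t)"
    from bspec[OF this E_admissible]
    show "\<forall>y t. field_norm D (E y) < \<rho> \<longrightarrow> 0 \<le> t \<longrightarrow> t < \<rho> \<longrightarrow> in_C1 K (pulled (y + t *\<^sub>R v))"
      unfolding pulled_state_eq by simp
  qed
  show "\<exists>\<rho>>0. \<forall>y t. field_norm D (E y) < \<rho> \<longrightarrow> 0 < t \<longrightarrow> t < \<rho> \<longrightarrow>
        C1_norm K (\<lambda>x. pulled (y + t *\<^sub>R v) x - pulled 0 x) < \<epsilon>" if "0 < \<epsilon>"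
    using reg3[rule_format, OF that]
  proof (elim ex_forward conj_forward)
    fix \<rho> :: real
    assume "\<forall>Y\<in>admissible_fields D \<omega>. \<forall>t. field_norm D Y < \<rho> \<longrightarrow> 0 < t \<longrightarrow> t < \<rho> \<longrightarrow>
       C1_norm K (\<lambda>x. pulled_state lam mu f g \<Gamma> \<Omega> (E v) Y t x - pulled 0 x) < \<epsilon>"
    from bspec[OF this E_admissible]
    show "\<forall>y t. field_norm D (E y) < \<rho> \<longrightarrow> 0 < t \<longrightarrow> t < \<rho> \<longrightarrow>
        C1_norm K (\<lambda>x. pulled (y + t *\<^sub>R v) x - pulled 0 x) < \<epsilon>"
      unfolding pulled_state_eq by simp
  qed
  show "\<exists>\<rho>>0. \<forall>y t. field_norm D (E y) < \<rho> \<longrightarrow> 0 < t \<longrightarrow> t < \<rho> \<longrightarrow>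
        C1_norm K (\<lambda>x. (pulled (y + t *\<^sub>R v) x - pulled y x) /\<^sub>R t - mat_deriv v x) < \<epsilon>" if "0 < \<epsilon>"
    using reg4[rule_format, OF that]
  proof (elim ex_forward conj_forward)
    fix \<rho> :: real
    assume "\<forall>Y\<in>admissible_fields D \<omega>. \<forall>t. field_norm D Y < \<rho> \<longrightarrow> 0 < t \<longrightarrow> t < \<rho> \<longrightarrow>
       C1_norm K (\<lambda>x. (pulled_state lam mu f g \<Gamma> \<Omega> (E v) Y t x -
         pulled_state lam mu f g \<Gamma> \<Omega> (E v) Y 0 x) /\<^sub>R t - mat_deriv v x) < \<epsilon>"
    from bspec[OF this E_admissible]
    show "\<forall>y t. field_norm D (E y) < \<rho> \<longrightarrow> 0 < t \<longrightarrow> t < \<rho> \<longrightarrow>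
        C1_norm K (\<lambda>x. (pulled (y + t *\<^sub>R v) x - pulled y x) /\<^sub>R t - mat_deriv v x) < \<epsilon>"
      unfolding p0 pulled_state_eq by simp
  qed
qed

lemma eventually_pulled_C1: "\<forall>\<^sub>F y in nhds 0. in_C1 K (pulled y)"
proof -
  obtain \<rho> where \<rho>: "0 < \<rho>" "\<And>y t. field_norm D (E y) < \<rho> \<Longrightarrow> 0 \<le> t \<Longrightarrow> t < \<rho> \<Longrightarrow> in_C1 K (pulled (y + t *\<^sub>R 0))"
    using pulled_C1[of 0] by blast
  from eventually_field_norm_less[OF \<rho>(1)] show ?thesis
    by eventually_elim (use \<rho>(2)[of _ 0] \<rho>(1) in simp)
qed

lemma pulled_0_C1: "in_C1 K (pulled 0)"
  by (rule eventually_nhds_x_imp_x[OF eventually_pulled_C1])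

text \<open>The convergence to the state is assumed for \<open>t > 0\<close> only. Taking \<open>v = 0\<close> makes the perturbation
  independent of \<open>t\<close> and yields the convergence in \<open>y\<close> alone.\<close>

lemma strict_deriv_along_pulled_grad:
  "strict_deriv_along v K (\<lambda>y. C1_grad K (pulled y)) (C1_grad K (mat_deriv v))"
proof (rule strict_deriv_alongI)
  show "bounded (C1_grad K (pulled 0) ` K)" "bounded (C1_grad K (mat_deriv v) ` K)"
    by (intro bounded_C1_grad pulled_0_C1 mat_deriv_C1 bounded_K)+
  show "uniform_limit K (\<lambda>y. C1_grad K (pulled y)) (C1_grad K (pulled 0)) (nhds 0)"
  proof (rule uniform_limitI)
    fix e :: real assume "0 < e"
    then obtain \<rho> where \<rho>: "0 < \<rho>" "\<And>y t. field_norm D (E y) < \<rho> \<Longrightarrow> 0 < t \<Longrightarrow> t < \<rho> \<Longrightarrow>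
        C1_norm K (\<lambda>x. pulled (y + t *\<^sub>R 0) x - pulled 0 x) < e"
      using pulled_conv[of e 0] by blast
    from eventually_field_norm_less[OF \<rho>(1)] eventually_pulled_C1
    show "\<forall>\<^sub>F y in nhds 0. \<forall>x\<in>K. dist (C1_grad K (pulled y) x) (C1_grad K (pulled 0) x) < e"
    proof eventually_elim
      fix y assume y: "field_norm D (E y) < \<rho>" and c: "in_C1 K (pulled y)"
      have n: "C1_norm K (\<lambda>x. pulled y x - pulled 0 x) < e"
        using \<rho>(2)[OF y, of "\<rho>/2"] \<rho>(1) by simp
      show "\<forall>x\<in>K. dist (C1_grad K (pulled y) x) (C1_grad K (pulled 0) x) < e"
      proof
        fix x assume "x \<in> K"
        from norm_C1_grad_le_C1_norm[OF in_C1_diff[OF c pulled_0_C1] bounded_K this] n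
        show "dist (C1_grad K (pulled y) x) (C1_grad K (pulled 0) x) < e"
          by (simp add: C1_grad_diff[OF c pulled_0_C1] dist_norm)
      qed
    qed
  qed
  show "uniform_limit K (\<lambda>z x. (C1_grad K (pulled (fst z + snd z *\<^sub>R v)) x - C1_grad K (pulled (fst z)) x) /\<^sub>R snd z)
     (C1_grad K (mat_deriv v)) (nhds 0 \<times>\<^sub>F at_right 0)"
  proof (rule uniform_limitI)
    fix e :: real assume "0 < e"
    then obtain \<rho> where \<rho>: "0 < \<rho>" "\<And>y t. field_norm D (E y) < \<rho> \<Longrightarrow> 0 < t \<Longrightarrow> t < \<rho> \<Longrightarrow>
        C1_norm K (\<lambda>x. (pulled (y + t *\<^sub>R v) x - pulled y x) /\<^sub>R t - mat_deriv v x) < e"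
      using pulled_quotient[of e v] by blast
    from eventually_base_and_moved[OF eventually_field_norm_less[OF \<rho>(1)], of v]
      eventually_base_and_moved[OF eventually_pulled_C1, of v] eventually_step_pos[OF \<rho>(1)]
    show "\<forall>\<^sub>F z in nhds 0 \<times>\<^sub>F at_right 0. \<forall>x\<in>K.
       dist ((C1_grad K (pulled (fst z + snd z *\<^sub>R v)) x - C1_grad K (pulled (fst z)) x) /\<^sub>R snd z)
         (C1_grad K (mat_deriv v) x) < e"
    proof eventually_elim
      fix z :: "'h \<times> real"
      assume y: "field_norm D (E (fst z)) < \<rho> \<and> field_norm D (E (fst z + snd z *\<^sub>R v)) < \<rho>"
        and c: "in_C1 K (pulled (fst z)) \<and> in_C1 K (pulled (fst z + snd z *\<^sub>R v))"
        and t: "0 < snd z \<and> snd z < \<rho>"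
      have n: "C1_norm K (\<lambda>x. (pulled (fst z + snd z *\<^sub>R v) x - pulled (fst z) x) /\<^sub>R snd z - mat_deriv v x) < e"
        using \<rho>(2)[of "fst z" "snd z"] y t by simp
      have c1: "in_C1 K (\<lambda>x. pulled (fst z + snd z *\<^sub>R v) x - pulled (fst z) x)"
        using c by (intro in_C1_diff) simp_all
      note c2 = in_C1_scaleR[OF c1, of "inverse (snd z)"]
      show "\<forall>x\<in>K. dist ((C1_grad K (pulled (fst z + snd z *\<^sub>R v)) x - C1_grad K (pulled (fst z)) x) /\<^sub>R snd z)
         (C1_grad K (mat_deriv v) x) < e"
      proof
        fix x assume "x \<in> K"
        from norm_C1_grad_le_C1_norm[OF in_C1_diff[OF c2 mat_deriv_C1] bounded_K this] n
        have "norm (C1_grad K (\<lambda>x. (pulled (fst z + snd z *\<^sub>R v) x - pulled (fst z) x) /\<^sub>R snd z - mat_deriv v x) x) < e"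
          by (rule le_less_trans)
        then show "dist ((C1_grad K (pulled (fst z + snd z *\<^sub>R v)) x - C1_grad K (pulled (fst z)) x) /\<^sub>R snd z)
          (C1_grad K (mat_deriv v) x) < e"
          using c unfolding C1_grad_diff[OF c2 mat_deriv_C1] C1_grad_scaleR[OF c1]
          by (simp add: C1_grad_diff dist_norm)
      qed
    qed
  qed
qed

lemma strict_deriv_along_moved_grad:
  "strict_deriv_along v K moved_grad (moved_grad' v)"
proof -
  have "\<forall>\<^sub>F y in nhds 0. \<forall>x\<in>K. moved_grad y x + moved_grad y x ** field_jac (E y) x = C1_grad K (pulled y) x"
    using eventually_pulled_C1 eventually_small_field
  proof eventually_elim
    fix y assume c: "in_C1 K (pulled y)" and s: "small_field D \<omega> (E y)"
    interpret small_field D \<omega> "E y" by (rule s)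
    show "\<forall>x\<in>K. moved_grad y x + moved_grad y x ** field_jac (E y) x = C1_grad K (pulled y) x"
      using C1_grad_deform[OF bounded_K c[unfolded pulled_def]]
      by (simp add: moved_grad_def pulled_def matrix_add_ldistrib)
  qed
  from strict_deriv_along_divide[OF bounded_bilinear_matrix_mult strict_deriv_along_pulled_grad
      strict_deriv_along_field_jac jac_0 this]
  show ?thesis unfolding moved_grad'_def .
qed

lemma eventually_moved_stress:
  "\<forall>\<^sub>F y in nhds 0. (\<forall>x. moved_stress y x = stress_form lam mu (moved_grad y x) (moved_grad y x)) \<and>
     closure (deform (E y) ` \<Omega> - \<omega>) = deform (E y) ` K"
  using eventually_small_field
proof eventually_elim
  fix y assume s: "small_field D \<omega> (E y)"
  interpret small_field D \<omega> "E y" by (rule s)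
  have "closure (deform (E y) ` \<Omega> - \<omega>) = deform (E y) ` K"
    unfolding K_def by (rule closure_deform_diff_omega[OF bounded_Omega])
  then show "(\<forall>x. moved_stress y x = stress_form lam mu (moved_grad y x) (moved_grad y x)) \<and>
     closure (deform (E y) ` \<Omega> - \<omega>) = deform (E y) ` K"
    by (simp add: moved_stress_def moved_grad_def stress_def stress_form_def Let_def)
qed

lemma strict_deriv_along_moved_stress:
  "strict_deriv_along v K moved_stress (moved_stress' v)"
  unfolding moved_stress'_def[abs_def]
  by (rule strict_deriv_along_cong[OF bounded_bilinear.strict_deriv_along[OF bounded_bilinear_stress_form
        strict_deriv_along_moved_grad strict_deriv_along_moved_grad]])
    (use eventually_moved_stress in \<open>eventually_elim, simp\<close>)

lemma moved_stress_0: "moved_stress 0 x = stress lam mu f g \<Gamma> \<omega> \<Omega> x"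
  by (simp add: moved_stress_def deform_0)

lemma moved_grad_0: "moved_grad 0 = C1_grad K (pulled 0)"
  by (simp add: moved_grad_def[abs_def] deform_0 pulled_0)

definition "max_stress = (SUP x\<in>K. stress lam mu f g \<Gamma> \<omega> \<Omega> x)"

lemma eventually_bdd_moved_stress: "\<forall>\<^sub>F y in nhds 0. bdd_above (moved_stress y ` K)"
  using uniform_limitD[OF strict_deriv_alongD(3)[OF strict_deriv_along_moved_stress] zero_less_one]
proof eventually_elim
  fix y assume y: "\<forall>x\<in>K. dist (moved_stress y x) (moved_stress 0 x) < 1"
  obtain B where B: "\<And>x. x \<in> K \<Longrightarrow> norm (moved_stress 0 x) \<le> B"
    using strict_deriv_alongD(1)[OF strict_deriv_along_moved_stress] by (auto simp: bounded_iff)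
  show "bdd_above (moved_stress y ` K)"
  proof (rule bdd_aboveI2)
    fix x assume "x \<in> K"
    then show "moved_stress y x \<le> B + 1"
      using y[rule_format, of x] B[of x] unfolding dist_real_def real_norm_def by linarith
  qed
qed

lemma stress_le_max: "x \<in> K \<Longrightarrow> moved_stress 0 x \<le> max_stress"
  using cSUP_upper[OF _ eventually_nhds_x_imp_x[OF eventually_bdd_moved_stress]]
  by (simp add: max_stress_def moved_stress_0)

text \<open>The set \<open>K\<close> may have points outside the closure of its interior, where gradients are zero by convention, so the
  compactness argument covers only \<open>closure (interior K)\<close>. At the other points stress and
  derivative are zero.\<close>

lemma near_active:
  assumes "0 < \<epsilon>"
  shows "\<exists>\<eta>>0. \<forall>x\<in>K. max_stress - \<eta> < moved_stress 0 x \<longrightarrow>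
     (\<exists>a\<in>K. moved_stress 0 a = max_stress \<and> moved_stress' v x - \<epsilon> < moved_stress' v a)"
proof -
  let ?C = "closure (interior K)"
  have CK: "?C \<subseteq> K" using closure_mono[OF interior_subset[of K]] by (simp add: K_def)
  have C: "compact ?C" using bounded_subset[OF bounded_K interior_subset] by simp
  have s0: "moved_stress 0 x = stress_form lam mu (moved_grad 0 x) (moved_grad 0 x)" for x
    using eventually_nhds_x_imp_x[OF eventually_moved_stress] by simp
  have c1: "continuous_on ?C (moved_grad 0)"
    unfolding moved_grad_0 by (rule continuous_C1_grad[OF pulled_0_C1])
  have c2: "continuous_on ?C (moved_grad' v)"
    unfolding moved_grad'_def[abs_def]
    by (intro continuous_intros continuous_C1_grad pulled_0_C1 mat_deriv_C1 continuous_field_jac[OF E_admissible])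
  note bl = bounded_bilinear.continuous_on[OF bounded_bilinear_stress_form]
  have f: "continuous_on ?C (moved_stress 0)" unfolding s0[abs_def] by (intro bl c1)
  have g: "continuous_on ?C (moved_stress' v)"
    unfolding moved_stress'_def[abs_def] by (intro continuous_intros bl c1 c2)
  have out: "moved_stress 0 x = 0 \<and> moved_stress' v x = 0" if "x \<notin> ?C" for x
  proof -
    have "moved_grad 0 x = 0" using that by (simp add: moved_grad_0 C1_grad_outside)
    moreover have "moved_grad' v x = 0"
      using that bounded_bilinear.zero_left[OF bounded_bilinear_matrix_mult]
      by (simp add: moved_grad'_def C1_grad_outside)
    ultimately show ?thesis
      using bounded_bilinear.zero_left[OF bounded_bilinear_stress_form]
      by (simp add: s0 moved_stress'_def)
  qed
  obtain \<eta> where \<eta>: "0 < \<eta>" "\<And>x. x \<in> ?C \<Longrightarrow> max_stress - \<eta> < moved_stress 0 x \<Longrightarrow>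
      \<exists>a\<in>?C. moved_stress 0 a = max_stress \<and> moved_stress' v x - \<epsilon> < moved_stress' v a"
    using near_maximizers_compact[OF C f g _ assms, of max_stress] stress_le_max CK by blast
  \<comment> \<open>Points of \<open>K\<close> outside \<open>?C\<close> have stress zero: they are active, or their stress
    lies \<open>max_stress\<close> below the maximum.\<close>
  define \<eta>' where "\<eta>' = (if max_stress > 0 then min \<eta> max_stress else \<eta>)"
  have "\<exists>a\<in>K. moved_stress 0 a = max_stress \<and> moved_stress' v x - \<epsilon> < moved_stress' v a"
    if x: "x \<in> K" "max_stress - \<eta>' < moved_stress 0 x" for x
  proof (cases "x \<in> ?C")
    case True
    have "max_stress - \<eta> < moved_stress 0 x" using x(2) by (simp add: \<eta>'_def split: if_splits)
    then show ?thesis using \<eta>(2)[OF True] CK by blast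
  next
    case False
    then have "moved_stress 0 x = max_stress"
      using out[OF False] stress_le_max[OF x(1)] x(2) by (auto simp: \<eta>'_def split: if_splits)
    then show ?thesis using x(1) assms by (intro bexI[of _ x]) auto
  qed
  moreover have "0 < \<eta>'" using \<eta>(1) by (simp add: \<eta>'_def)
  ultimately show ?thesis by blast
qed

lemma active_set_eq: "active_set lam mu f g \<Gamma> \<omega> \<Omega> = {x \<in> K. moved_stress 0 x = max_stress}"
  by (simp add: active_set_def max_stress_def K_def moved_stress_0)

lemma active_nonempty: "active_set lam mu f g \<Gamma> \<omega> \<Omega> \<noteq> {}"
proof -
  obtain \<eta> where \<eta>: "0 < \<eta>" "\<And>x. x \<in> K \<Longrightarrow> max_stress - \<eta> < moved_stress 0 x \<Longrightarrow>
     \<exists>a\<in>K. moved_stress 0 a = max_stress"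
    using near_active[OF zero_less_one] by blast
  have "\<exists>x\<in>K. max_stress - \<eta> < moved_stress 0 x"
    using less_cSUP_iff[OF K_ne eventually_nhds_x_imp_x[OF eventually_bdd_moved_stress], of "max_stress - \<eta>"] \<eta>(1)
    by (simp add: max_stress_def moved_stress_0)
  then show ?thesis using \<eta>(2) by (auto simp: active_set_eq)
qed

lemma DJ_point_eq:
  assumes "x \<in> K"
  shows "DJ_point lam mu f g \<Gamma> \<omega> \<delta> \<Omega> x (E v) = moved_stress' v x"
proof -
  have J: "J_point lam mu f g \<Gamma> \<omega> \<delta> \<Omega> x (E v) t = moved_stress (t *\<^sub>R v) x - \<delta>" for t
    by (simp add: J_point_def moved_stress_def E_scaleR Let_def)
  have "((\<lambda>t. (J_point lam mu f g \<Gamma> \<omega> \<delta> \<Omega> x (E v) t - J_point lam mu f g \<Gamma> \<omega> \<delta> \<Omega> x (E v) 0) / t)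
      \<longlongrightarrow> moved_stress' v x) (at_right 0)"
    using strict_deriv_along_imp_tendsto[OF strict_deriv_along_moved_stress assms]
    by (simp add: J divide_inverse mult.commute)
  then show ?thesis
    unfolding DJ_point_def by (intro tendsto_Lim) simp_all
qed

section \<open>The subgradient of the penalised functional\<close>

lemma eventually_J_sigma:
  "\<forall>\<^sub>F y in nhds 0. J_sigma lam mu f g \<Gamma> \<omega> \<delta> (deform (E y) ` \<Omega>) = max ((SUP x\<in>K. moved_stress y x) - \<delta>) 0"
  using eventually_moved_stress
  by eventually_elim (simp add: J_sigma_def moved_stress_def image_image)

text \<open>In \<open>T\<close> the value \<open>J_vol\<close> and the factor \<open>\<alpha>\<close> are moved inside the maximum over the stress points and the
  index \<open>None\<close>; the image of the active indices under \<open>\<zeta>\<close> is \<open>\<Z>\<close>.\<close>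

theorem clarke_subgradient_G_fun:
  assumes \<alpha>: "0 < \<alpha>"
    and vol: "bounded_linear (\<lambda>h. shape_derivative (J_vol V) \<Omega> (E h))"
    and point: "\<And>x. x \<in> active_set lam mu f g \<Gamma> \<omega> \<Omega> \<Longrightarrow>
       bounded_linear (\<lambda>h. DJ_point lam mu f g \<Gamma> \<omega> \<delta> \<Omega> x (E h))"
  shows "closure (convex hull (Z_set lam mu f g \<Gamma> \<omega> \<delta> V \<alpha> \<Omega> E)) =
         {h. blinfun_inner_left h \<in> clarke_subgradient (G_fun lam mu f g \<Gamma> \<omega> \<delta> V \<alpha> \<Omega> E) 0}"
proof -
  let ?Act = "active_set lam mu f g \<Gamma> \<omega> \<Omega>"
  define I where "I = insert None (Some ` K)"
  define T where "T y i = J_vol V (deform (E y) ` \<Omega>) +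
      \<alpha> * (case i of None \<Rightarrow> 0 | Some x \<Rightarrow> moved_stress y x - \<delta>)" for y i
  define T' where "T' v i = shape_derivative (J_vol V) \<Omega> (E v) +
      \<alpha> * (case i of None \<Rightarrow> 0 | Some x \<Rightarrow> moved_stress' v x)" for v i
  define M where "M = (SUP i\<in>I. T 0 i)"
  define A where "A = {i\<in>I. T 0 i = M}"
  define \<zeta> where "\<zeta> i = grad_J_vol V \<Omega> E +
      \<alpha> *\<^sub>R (case i of None \<Rightarrow> 0 | Some x \<Rightarrow> grad_J_point lam mu f g \<Gamma> \<omega> \<delta> \<Omega> E x)" for i
  have SUP_T: "(SUP i\<in>I. T y i) = J_vol V (deform (E y) ` \<Omega>) + \<alpha> * max ((SUP x\<in>K. moved_stress y x) - \<delta>) 0"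
    if "bdd_above (moved_stress y ` K)" for y
    unfolding T_def I_def by (rule SUP_penalty[OF K_ne that \<alpha>])
  have M: "M = J_vol V (deform (E 0) ` \<Omega>) + \<alpha> * max (max_stress - \<delta>) 0"
    unfolding M_def using SUP_T[OF eventually_nhds_x_imp_x[OF eventually_bdd_moved_stress]]
    by (simp add: max_stress_def moved_stress_0)
  have None_A: "None \<in> A \<longleftrightarrow> max_stress \<le> \<delta>"
    using \<alpha> by (auto simp: A_def I_def T_def M max_def)
  have Some_A: "Some x \<in> A \<longleftrightarrow> x \<in> ?Act \<and> \<delta> \<le> max_stress" for x
  proof -
    have "Some x \<in> A \<longleftrightarrow> x \<in> K \<and> moved_stress 0 x - \<delta> = max (max_stress - \<delta>) 0"
      using \<alpha> by (auto simp: A_def I_def T_def M)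
    also have "\<dots> \<longleftrightarrow> x \<in> ?Act \<and> \<delta> \<le> max_stress"
      using stress_le_max[of x] by (auto simp: active_set_eq max_def)
    finally show ?thesis .
  qed
  have s_act: "stress lam mu f g \<Gamma> \<omega> \<Omega> x = max_stress" if "x \<in> ?Act" for x
    using that by (simp add: active_set_eq moved_stress_0)
  have Z: "Z_set lam mu f g \<Gamma> \<omega> \<delta> V \<alpha> \<Omega> E = \<zeta> ` A"
  proof -
    let ?z = "\<lambda>x. grad_J_vol V \<Omega> E + \<alpha> *\<^sub>R grad_J_point lam mu f g \<Gamma> \<omega> \<delta> \<Omega> E x"
    have A_eq: "A = (if max_stress \<le> \<delta> then {None} else {}) \<union> (if \<delta> \<le> max_stress then Some ` ?Act else {})"
    proof (rule set_eqI)
      fix i show "i \<in> A \<longleftrightarrow> i \<in> (if max_stress \<le> \<delta> then {None} else {}) \<union> (if \<delta> \<le> max_stress then Some ` ?Act else {})"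
        using None_A Some_A by (cases i) auto
    qed
    have z: "\<zeta> ` Some ` ?Act = ?z ` ?Act" "\<zeta> None = grad_J_vol V \<Omega> E"
      by (simp_all add: \<zeta>_def image_image)
    have c: "(\<forall>x\<in>?Act. stress lam mu f g \<Gamma> \<omega> \<Omega> x > \<delta>) \<longleftrightarrow> max_stress > \<delta>"
      "(\<forall>x\<in>?Act. stress lam mu f g \<Gamma> \<omega> \<Omega> x = \<delta>) \<longleftrightarrow> max_stress = \<delta>"
      using active_nonempty s_act by auto
    show ?thesis
      unfolding Z_set_def Let_def c A_eq using z by (auto simp: image_Un)
  qed
  have sd: "strict_deriv_along v I T (T' v)" for v
  proof -
    have "strict_deriv_along v K (\<lambda>y x. moved_stress y x + (- \<delta>)) (\<lambda>x. moved_stress' v x + 0)"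
      by (intro strict_deriv_along_add strict_deriv_along_moved_stress strict_deriv_along_const)
        (simp add: image_constant_conv)
    then have "strict_deriv_along v I (\<lambda>y i. case i of None \<Rightarrow> 0 | Some x \<Rightarrow> moved_stress y x - \<delta>)
        (\<lambda>i. case i of None \<Rightarrow> 0 | Some x \<Rightarrow> moved_stress' v x)"
      unfolding I_def by (intro strict_deriv_along_option) simp
    from bounded_linear.strict_deriv_along[OF bounded_linear_mult_right[of \<alpha>] this]
    show ?thesis
      unfolding T_def[abs_def] T'_def[abs_def]
      by (intro strict_deriv_along_add strict_deriv_along_J_vol open_Omega bounded_Omega)
  qed
  have A_ne: "A \<noteq> {}"
    using None_A Some_A active_nonempty by (cases "max_stress \<le> \<delta>") (auto simp: not_le intro: less_imp_le)
  have G: "\<forall>\<^sub>F y in nhds 0. G_fun lam mu f g \<Gamma> \<omega> \<delta> V \<alpha> \<Omega> E y = (SUP i\<in>I. T y i)"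
    using eventually_J_sigma[of \<delta>] eventually_bdd_moved_stress
    by eventually_elim (simp add: G_fun_def J_total_def SUP_T)
  have near: "\<exists>\<eta>>0. \<forall>i\<in>I. M - \<eta> < T 0 i \<longrightarrow> (\<exists>a\<in>A. T' v i - \<epsilon> < T' v a)" if e: "0 < \<epsilon>" for v \<epsilon>
  proof -
    obtain \<eta> where \<eta>: "0 < \<eta>" "\<And>x. x \<in> K \<Longrightarrow> max_stress - \<eta> < moved_stress 0 x \<Longrightarrow>
        \<exists>a\<in>K. moved_stress 0 a = max_stress \<and> moved_stress' v x - \<epsilon> / \<alpha> < moved_stress' v a"
      using near_active[of "\<epsilon> / \<alpha>" v] e \<alpha> by auto
    \<comment> \<open>The gap \<open>\<bar>max_stress - \<delta>\<bar>\<close> keeps the strictly inactive one of the two branches away from the maximum.\<close>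
    define \<eta>' where "\<eta>' = \<alpha> * (if max_stress = \<delta> then \<eta> else min \<eta> \<bar>max_stress - \<delta>\<bar>)"
    have "\<exists>a\<in>A. T' v i - \<epsilon> < T' v a" if i: "i \<in> I" "M - \<eta>' < T 0 i" for i
    proof -
      have "\<alpha> * (max (max_stress - \<delta>) 0 - (if max_stress = \<delta> then \<eta> else min \<eta> \<bar>max_stress - \<delta>\<bar>))
          < \<alpha> * (case i of None \<Rightarrow> 0 | Some x \<Rightarrow> moved_stress 0 x - \<delta>)"
        using i(2) by (simp add: M T_def \<eta>'_def right_diff_distrib)
      then have lt: "max (max_stress - \<delta>) 0 - (if max_stress = \<delta> then \<eta> else min \<eta> \<bar>max_stress - \<delta>\<bar>)
          < (case i of None \<Rightarrow> 0 | Some x \<Rightarrow> moved_stress 0 x - \<delta>)"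
        using \<alpha> by simp
      show ?thesis
      proof (cases i)
        case None
        then have "max_stress \<le> \<delta>" using lt by (auto simp: max_def min_def split: if_splits)
        then show ?thesis using None None_A e by (intro bexI[of _ None]) auto
      next
        case (Some x)
        then have x: "x \<in> K" using i(1) by (auto simp: I_def)
        have "\<delta> \<le> max_stress" "max_stress - \<eta> < moved_stress 0 x"
          using lt Some stress_le_max[OF x] by (auto simp: max_def min_def split: if_splits)
        then obtain a where a: "a \<in> K" "moved_stress 0 a = max_stress"
            "moved_stress' v x - \<epsilon> / \<alpha> < moved_stress' v a"
          using \<eta>(2)[OF x] by blast
        have "Some a \<in> A" using a \<open>\<delta> \<le> max_stress\<close> by (simp add: Some_A active_set_eq)
        moreover have "T' v i - \<epsilon> < T' v (Some a)"
          using a(3) \<alpha> Some by (simp add: T'_def field_simps)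
        ultimately show ?thesis by blast
      qed
    qed
    moreover have "0 < \<eta>'" using \<alpha> \<eta>(1) by (simp add: \<eta>'_def)
    ultimately show ?thesis by blast
  qed
  have \<zeta>: "\<zeta> i \<bullet> v = T' v i" if "i \<in> A" for i v
  proof -
    have gv: "grad_J_vol V \<Omega> E \<bullet> v = shape_derivative (J_vol V) \<Omega> (E v)"
      unfolding grad_J_vol_def by (rule riesz_representative_inner[OF vol])
    have gp: "grad_J_point lam mu f g \<Gamma> \<omega> \<delta> \<Omega> E x \<bullet> v = moved_stress' v x" if "x \<in> ?Act" for x
    proof -
      have "grad_J_point lam mu f g \<Gamma> \<omega> \<delta> \<Omega> E x \<bullet> v = DJ_point lam mu f g \<Gamma> \<omega> \<delta> \<Omega> x (E v)"
        unfolding grad_J_point_def by (rule riesz_representative_inner[OF point[OF that]])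
      also have "\<dots> = moved_stress' v x"
        using that by (intro DJ_point_eq) (simp add: active_set_eq)
      finally show ?thesis .
    qed
    show ?thesis
      using that Some_A gv gp by (cases i) (auto simp: \<zeta>_def T'_def inner_add_left)
  qed
  show ?thesis
    unfolding Z
    by (rule clarke_subgradient_SUP[OF sd A_def[unfolded M_def] A_ne near[unfolded M_def] G \<zeta>])
qed

end

theorem theorem5p6:
  fixes D \<Omega> \<omega> \<Gamma> :: "(real^'n::finite) set"
    and f g :: "real^'n \<Rightarrow> real^'n"
    and \<delta> V \<alpha> lam mu :: real
    and E :: "'h::{real_inner,complete_space} \<Rightarrow> real^'n \<Rightarrow> real^'n"
  assumes "lipschitz_set D" and "connected D"
    and "smooth_lipschitz_hypersurface \<Gamma>" and "\<Gamma> \<subseteq> D"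
    and "lipschitz_set \<Omega>" and "\<Omega> \<subseteq> D" and "\<Gamma> \<subseteq> frontier \<Omega>"
    and "open \<omega>" and "\<omega> \<subseteq> D" and "\<Gamma> \<subseteq> \<omega>"
    and "closure (\<Omega> - \<omega>) \<noteq> {}"
    and "H1 D f" and "H2 D g"
    and "\<delta> > 0" and "V > 0" and "\<alpha> > 0" and "lam > 0" and "mu > 0"
    and state_solvable:
      "\<exists>\<rho>>0. \<forall>Y\<in>admissible_fields D \<omega>. field_norm D Y < \<rho> \<longrightarrow>
         unique_ae_on (deform Y ` \<Omega>) (is_state lam mu f g \<Gamma> (deform Y ` \<Omega>))"
    and material_solvable:
      "\<forall>X\<in>admissible_fields D \<omega>. unique_ae_on \<Omega> (is_material_derivative lam mu f g \<Gamma> D \<Omega> X)"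
    and regularity: "standing_regularity lam mu f g \<Gamma> D \<Omega> \<omega>"
    and hilbert: "hilbert_space_of_fields D \<omega> E"
    and vol_continuous: "bounded_linear (\<lambda>h. shape_derivative (J_vol V) \<Omega> (E h))"
    and stress_continuous:
      "\<forall>x\<in>active_set lam mu f g \<Gamma> \<omega> \<Omega>. bounded_linear (\<lambda>h. DJ_point lam mu f g \<Gamma> \<omega> \<delta> \<Omega> x (E h))"
  shows "closure (convex hull (Z_set lam mu f g \<Gamma> \<omega> \<delta> V \<alpha> \<Omega> E)) =
         {h. blinfun_inner_left h \<in> clarke_subgradient (G_fun lam mu f g \<Gamma> \<omega> \<delta> V \<alpha> \<Omega> E) 0}"
proof -
  have "open D" "bounded D" "open \<Omega>" "bounded \<Omega>"
    using assms(1,5) by (auto simp: lipschitz_set_def)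
  moreover have "D \<noteq> {}" using \<open>\<Omega> \<subseteq> D\<close> \<open>closure (\<Omega> - \<omega>) \<noteq> {}\<close> by auto
  ultimately interpret elastic_shape D \<omega> E \<Omega> \<Gamma> f g lam mu
    using hilbert regularity \<open>closure (\<Omega> - \<omega>) \<noteq> {}\<close> by unfold_locales
  show ?thesis
    using stress_continuous by (intro clarke_subgradient_G_fun \<open>\<alpha> > 0\<close> vol_continuous) blast
qed

end
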